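(* Let $\beta\in(0,1)$, let $X$ be a skew Brownian motion with skewness parameter $\beta$ (skew point $0$), started at $0$, and let $A_1:=\mathrm{Leb}\{s\in[0,1]:X_s\ge0\}$. Then for any $n\ge1$, $$\mathbf{E}_0(A_1^n)=\sum_{k=0}^{n-1}\binom{n-1+k}{k}\frac{\beta^{n-k}}{2^{n+k-1}}.$$
   Context: Skew Brownian motion with skewness parameter $\beta\in(0,1)$ is the regular diffusion on $\mathbb{R}$ that behaves like a standard Brownian motion away from $0$, while the sign of every excursion from $0$ is chosen by an independent Bernoulli trial (positive with probability $\beta$). Equivalently, it is the diffusion with speed measure $m(\mathrm{d}x)=4\beta\,\mathrm{d}x$ for $x>0$ and $m(\mathrm{d}x)=4(1-\beta)\,\mathrm{d}x$ for $x<0$ (no mass at $0$), and scale function $S(x)=\frac{x}{2\beta}$ for $x\ge0$, $S(x)=\frac{x}{2(1-\beta)}$ for $x\le0$; its generator is $\frac{d}{dm}\frac{d}{dS}$. $\mathbf{E}_0$ is expectation for the process started at $0$; $\mathrm{Leb}$ is Lebesgue measure. *)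

theory Defs
  imports "HOL-Probability.Probability"
begin

text \<open>
  A regular, conservative diffusion on the real line in the standard form
  $(\Omega, \mathcal F, \mathcal F_t, X_t, (\mathbf P_x)_{x})$: a strong Markov family with continuous
  paths. The underlying measurable space is \<open>N\<close>; the measure carried by \<open>N\<close> and the \<open>F t\<close> is irrelevant.
  The time index is \<open>real\<close>, but only the values of \<open>X\<close> at nonnegative times matter.
\<close>

text \<open>
  The strong Markov property is stated for finite stopping times only. The usual form, on the event
  that a possibly infinite \<open>T\<close> is finite, follows by applying this to the minimum of \<open>T\<close> and a constant.
\<close>

locale regular_diffusion = filtration "space N" F
  for N :: "'a measure" and F :: "real \<Rightarrow> 'a measure" +
  fixes P :: "real \<Rightarrow> 'a measure" and X :: "real \<Rightarrow> 'a \<Rightarrow> real"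
  assumes subalgebra_F: "\<And>t. subalgebra N (F t)"
    and kernel: "P \<in> borel \<rightarrow>\<^sub>M prob_algebra N"
    and adapted: "\<And>t. 0 \<le> t \<Longrightarrow> X t \<in> borel_measurable (F t)"
    and continuous_paths: "\<And>\<omega>. \<omega> \<in> space N \<Longrightarrow> continuous_on {0..} (\<lambda>t. X t \<omega>)"
    and start: "\<And>x. AE \<omega> in P x. X 0 \<omega> = x"
    and strong_Markov:
      "\<And>T t f x. stopping_time F T \<Longrightarrow> (\<And>\<omega>. \<omega> \<in> space N \<Longrightarrow> 0 \<le> T \<omega>) \<Longrightarrow> 0 \<le> t \<Longrightarrow>
         f \<in> borel_measurable borel \<Longrightarrow> bounded (range f) \<Longrightarrow>
         AE \<omega> in P x. real_cond_exp (P x) (pre_sigma T) (\<lambda>\<omega>'. f (X (T \<omega>' + t) \<omega>')) \<omega>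
           = (\<integral>\<omega>'. f (X t \<omega>') \<partial>P (X (T \<omega>) \<omega>))"
    and regular: "\<And>x y. 0 < measure (P x) {\<omega> \<in> space N. \<exists>t\<ge>0. X t \<omega> = y}"

text \<open>Continuous functions vanishing at infinity.\<close>

definition C0 :: "(real \<Rightarrow> real) set" where
  "C0 = {f. continuous_on UNIV f \<and> (f \<longlongrightarrow> 0) at_infinity}"

text \<open>
  The (graph of the) infinitesimal generator of the transition semigroup on \<open>C0\<close> with the
  supremum norm.
\<close>

definition infinitesimal_generator ::
    "(real \<Rightarrow> 'a measure) \<Rightarrow> (real \<Rightarrow> 'a \<Rightarrow> real) \<Rightarrow> (real \<Rightarrow> real) \<Rightarrow> (real \<Rightarrow> real) \<Rightarrow> bool" where
  "infinitesimal_generator P X f g \<longleftrightarrow> f \<in> C0 \<and> g \<in> C0 \<and>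
     uniform_limit UNIV (\<lambda>t x. ((\<integral>\<omega>. f (X t \<omega>) \<partial>P x) - f x) / t) g (at_right 0)"

text \<open>
  Feller's operator: \<open>g\<close> is \<open>d/dm d/dS f\<close>. The inner derivative \<open>h\<close> is the right derivative with respect
  to the scale function; the outer one is in the sense of measures, so the intervals are half-open.
\<close>

definition dm_dS :: "real measure \<Rightarrow> (real \<Rightarrow> real) \<Rightarrow> (real \<Rightarrow> real) \<Rightarrow> (real \<Rightarrow> real) \<Rightarrow> bool" where
  "dm_dS m S f g \<longleftrightarrow> (\<exists>h.
     (\<forall>x. ((\<lambda>y. (f y - f x) / (S y - S x)) \<longlongrightarrow> h x) (at_right x)) \<and>
     (\<forall>a b. a < b \<longrightarrow> h b - h a = (LINT x:{a<..b}|m. g x)))"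

text \<open>
  A diffusion with speed measure \<open>m\<close> and scale function \<open>S\<close>, for natural boundaries at both infinities:
  the generator is \<open>d/dm d/dS\<close> with the maximal domain in \<open>C0\<close>. The diffusion is thereby determined
  in law. The normalisation is such that Brownian motion has \<open>S x = x\<close> and \<open>m\<close> twice Lebesgue measure.
\<close>

locale diffusion_speed_scale = regular_diffusion N F P X
  for N :: "'a measure" and F P X +
  fixes m :: "real measure" and S :: "real \<Rightarrow> real"
  assumes generator:
    "\<And>f g. infinitesimal_generator P X f g \<longleftrightarrow> f \<in> C0 \<and> g \<in> C0 \<and> dm_dS m S f g"

definition skew_speed :: "real \<Rightarrow> real measure" where
  "skew_speed \<beta> = density lborel
     (\<lambda>x. ennreal (if 0 < x then 4 * \<beta> else if x < 0 then 4 * (1 - \<beta>) else 0))"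

definition skew_scale :: "real \<Rightarrow> real \<Rightarrow> real" where
  "skew_scale \<beta> x = (if 0 \<le> x then x / (2 * \<beta>) else x / (2 * (1 - \<beta>)))"

text \<open>Expectation for the process started at \<open>x\<close> is integration with respect to \<open>P x\<close>.\<close>

definition skew_brownian_motion ::
    "'a measure \<Rightarrow> (real \<Rightarrow> 'a measure) \<Rightarrow> (real \<Rightarrow> 'a measure) \<Rightarrow> (real \<Rightarrow> 'a \<Rightarrow> real) \<Rightarrow> real \<Rightarrow> bool" where
  "skew_brownian_motion N F P X \<beta> \<longleftrightarrow>
     diffusion_speed_scale N F P X (skew_speed \<beta>) (skew_scale \<beta>)"

definition nonneg_occupation_time :: "(real \<Rightarrow> 'a \<Rightarrow> real) \<Rightarrow> real \<Rightarrow> 'a \<Rightarrow> real" where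
  "nonneg_occupation_time X t \<omega> = measure lborel {s \<in> {0..t}. 0 \<le> X s \<omega>}"

end

theory Submission
  imports Defs
begin

text \<open>
  Why the formula holds. Let \<open>A\<close> be the occupation time of \<open>[0,\<infinity>)\<close> and let \<open>e\<close> be an independent
  exponential time of rate \<open>l\<close>. Differentiating \<open>(A t - A s)^n\<close> backwards in \<open>s\<close> and using the Markov
  property gives Kac's formula: \<open>E_x ((l * A e)^n) / n!\<close> equals the \<open>n\<close>-th iterate of
  \<open>V_l (1_{[0,\<infinity>)} * _)\<close> applied to the constant \<open>1\<close>, where \<open>V_l g x\<close> is the expectation of \<open>g (X e)\<close>
  under \<open>P x\<close>, that is, \<open>l\<close> times the resolvent (\<open>kac_moment_formula\<close>). So only the resolvent of functions
  supported by the half-line has to be known.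

  The resolvent is extracted from the generator. Since the latter is prescribed with its maximal
  domain, for each \<open>C^2\<close> function \<open>B\<close> one may correct the kink condition at \<open>0\<close> by adding the right
  multiple of \<open>exp (- s * |x|)\<close>, \<open>s = sqrt (2 * l)\<close>, which is annihilated by \<open>l - (1/2) d^2/dx^2\<close> off
  \<open>0\<close>; the sum lies in the domain, and this evaluates \<open>V_l\<close> at \<open>B - B'' / (2 * l)\<close> (\<open>resolvent_C2\<close>).
  Averaging extends the identity to \<open>C^1\<close> functions whose second derivative may jump
  (\<open>resolvent_C1\<close>), and a piecewise exponential \<open>B\<close> yields, for \<open>x \<ge> 0\<close>,
  \<open>V_l (1_{[0,\<infinity>)} exp (- s q _)) x = (exp (- s q x) - (1 - \<beta> + \<beta> q) exp (- s x)) / (1 - q^2)\<close>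
  (\<open>resolvent_exp\<close>).

  With \<open>q = sqrt (1 - y)\<close>, a combination \<open>w\<close> of \<open>1\<close> and \<open>exp (- s q x)\<close> solves
  \<open>w = 1 + y * V_l (1_{[0,\<infinity>)} w)\<close>, so that the Neumann series of this equation sums to \<open>w\<close>. Hence
  the Kac iterates at \<open>0\<close> have the generating function
  \<open>(\<beta> / q + 1 - \<beta>) / (\<beta> * q + 1 - \<beta>)\<close>, which does not depend on \<open>l\<close>
  (\<open>kac_generating_function\<close>). Clearing the denominator
  gives a two-term recurrence for its coefficients, and Pascal's rule shows that the sums in the
  theorem satisfy the same recurrence (\<open>moment_coeff_recurrence\<close>).

  Finally, if the \<open>n\<close>-th iterate at \<open>0\<close> is a constant \<open>c\<close> for all \<open>l\<close>, then \<open>E_0 (A t ^ n)\<close> and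
  \<open>c * t ^ n\<close> have the same Laplace transform, and both are continuous in \<open>t\<close>; so they agree, in
  particular at \<open>t = 1\<close> (\<open>occupation_moment_scaling\<close>).
\<close>

section \<open>The coefficients and their recurrence\<close>

text \<open>
  It will turn out to be the moment of order \<open>n + 1\<close> divided by \<open>b\<close>.
\<close>

definition moment_coeff :: "real \<Rightarrow> nat \<Rightarrow> real" where
  "moment_coeff b n = (\<Sum>k\<le>n. real ((n + k) choose k) * (b ^ (n - k) / 2 ^ (n + k)))"

text \<open>
  Pascal's rule splits \<open>2 * moment_coeff b (n + 1)\<close> into two sums: one is \<open>b * moment_coeff b n\<close> plus a
  boundary term, the other, multiplied by \<open>b\<close>, is \<open>moment_coeff b (n + 1)\<close> minus a boundary term.
  Both boundary terms are the normalised central binomial coefficient.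
\<close>

lemma moment_coeff_recurrence:
  "(1 - 2*b) * moment_coeff b (Suc n) + b^2 * moment_coeff b n = (1 - b) * real ((2 * Suc n) choose Suc n) / 4 ^ Suc n"
proof -
  define s where "s n k = real ((n + k) choose k) / 2 ^ (n + k)" for n k
  have unfolded: "moment_coeff b n = (\<Sum>k\<le>n. s n k * b ^ (n - k))" for n
    by (simp add: moment_coeff_def s_def)
  have pascal: "2 * s (Suc n) (Suc k) = s n (Suc k) + s (Suc n) k" for n k
    by (simp add: s_def add_divide_distrib)
  have s0: "s n 0 = 1 / 2^n" for n by (simp add: s_def)
  define S where "S = (\<Sum>k\<le>n. s (Suc n) k * b ^ (n - k))"
  have bS: "moment_coeff b (Suc n) = b * S + s (Suc n) (Suc n)"
  proof -
    have "(\<Sum>k\<le>n. s (Suc n) k * b ^ (Suc n - k)) = b * S"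
      unfolding S_def sum_distrib_left by (intro sum.cong) (auto simp: Suc_diff_le)
    then show ?thesis by (simp add: unfolded)
  qed
  have "2 * moment_coeff b (Suc n) = 2 * s (Suc n) 0 * b ^ Suc n + (\<Sum>k\<le>n. 2 * s (Suc n) (Suc k) * b ^ (n - k))"
    by (simp add: unfolded sum.atMost_Suc_shift sum_distrib_left algebra_simps del: sum.atMost_Suc)
  also have "\<dots> = s n 0 * b ^ Suc n + (\<Sum>k\<le>n. s n (Suc k) * b ^ (n - k)) + S"
    by (simp add: pascal s0 S_def sum.distrib algebra_simps)
  also have "s n 0 * b ^ Suc n + (\<Sum>k\<le>n. s n (Suc k) * b ^ (n - k)) = (\<Sum>k\<le>Suc n. s n k * b ^ (Suc n - k))"
    by (simp add: sum.atMost_Suc_shift del: sum.atMost_Suc)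
  also have "\<dots> = b * moment_coeff b n + s n (Suc n)"
    by (simp add: unfolded sum_distrib_left Suc_diff_le algebra_simps)
  finally have two: "2 * moment_coeff b (Suc n) = b * moment_coeff b n + s n (Suc n) + S" .
  have sym: "s n (Suc n) = s (Suc n) n"
    using binomial_symmetric[of "Suc n" "n + Suc n"] by (simp add: s_def)
  have diag: "s (Suc n) (Suc n) = s n (Suc n)"
    using pascal[of n n] sym by simp
  have "s (Suc n) (Suc n) = real ((2 * Suc n) choose Suc n) / 4 ^ Suc n"
  proof -
    have "(2::real) ^ (Suc n + Suc n) = 4 ^ Suc n"
      by (simp only: power_add power_mult_distrib[symmetric]) simp
    then show ?thesis by (simp only: s_def mult_2)
  qed
  note central = this
  have "b * (2 * moment_coeff b (Suc n)) = b * (b * moment_coeff b n + s n (Suc n) + S)"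
    by (simp only: two)
  then have "(1 - 2*b) * moment_coeff b (Suc n) + b^2 * moment_coeff b n = (1 - b) * s (Suc n) (Suc n)"
    using bS unfolding diag[symmetric] by (simp add: algebra_simps power2_eq_square)
  then show ?thesis by (simp only: central times_divide_eq_right)
qed

text \<open>
  The binomial series with exponent \<open>-1/2\<close>, rewritten with central binomial coefficients because these
  are the inhomogeneity of the recurrence.
\<close>

lemma inverse_sqrt_series:
  fixes y :: real
  assumes "\<bar>y\<bar> < 1"
  shows "(\<lambda>n. real ((2 * n) choose n) / 4 ^ n * y ^ n) sums (1 / sqrt (1 - y))"
proof -
  have coeff: "((-1/2) gchoose n) * (-1) ^ n = real ((2 * n) choose n) / 4 ^ n" for n
  proof (induction n)
    case (Suc n)
    have c: "real (Suc n) * real ((2 * Suc n) choose Suc n) = 2 * (2 * real n + 1) * real ((2 * n) choose n)"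
    proof -
      have 1: "Suc n * ((2 * Suc n) choose Suc n) = (2 * n + 2) * ((2 * n + 1) choose n)"
        using Suc_times_binomial_eq[of "2*n+1" n] by simp
      have "(2 * n + 1) choose n = (2 * n + 1) choose Suc n"
        using binomial_symmetric[of "Suc n" "2*n+1"] by simp
      then have 2: "Suc n * ((2 * n + 1) choose n) = (2 * n + 1) * ((2 * n) choose n)"
        using Suc_times_binomial_eq[of "2*n" n] by simp
      from 1 have "Suc n * ((2 * Suc n) choose Suc n) = 2 * (Suc n * ((2 * n + 1) choose n))"
        by (simp add: algebra_simps)
      then have "Suc n * ((2 * Suc n) choose Suc n) = 2 * ((2 * n + 1) * ((2 * n) choose n))"
        using 2 by simp
      then have "real (Suc n * ((2 * Suc n) choose Suc n)) = real (2 * ((2 * n + 1) * ((2 * n) choose n)))"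
        by (rule arg_cong)
      then show ?thesis by (simp add: algebra_simps)
    qed
    have g: "real (Suc n) * ((-1/2) gchoose Suc n) = ((-1/2) gchoose n) * (-1/2 - real n)"
      using gbinomial_mult_1[of "-1/2 :: real" n] by (simp add: algebra_simps)
    have "real (Suc n) * (((-1/2) gchoose Suc n) * (-1) ^ Suc n)
        = (real (Suc n) * ((-1/2) gchoose Suc n)) * (-1) ^ Suc n"
      by (simp only: mult.assoc)
    also have "\<dots> = (((-1/2) gchoose n) * (-1) ^ n) * (1/2 + real n)"
      unfolding g by (simp add: algebra_simps)
    also have "\<dots> = real ((2 * n) choose n) / 4 ^ n * (1/2 + real n)" using Suc by simp
    also have "\<dots> = real (Suc n) * (real ((2 * Suc n) choose Suc n) / 4 ^ Suc n)"
      using c by (simp add: field_simps)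
    finally show ?case by (simp only: mult_cancel_left of_nat_eq_0_iff) simp
  qed simp
  have "(\<lambda>n. ((-1/2) gchoose n) * (-y) ^ n) sums (1 + (-y)) powr (-1/2)"
    by (rule gen_binomial_real) (use assms in simp)
  moreover have "(1 + (-y)) powr (-1/2) = 1 / sqrt (1 - y)"
    using assms by (simp add: powr_minus_divide powr_half_sqrt)
  moreover have "((-1/2) gchoose n) * (-y) ^ n = real ((2 * n) choose n) / 4 ^ n * y ^ n" for n
    by (subst coeff[symmetric]) (simp add: power_minus[of y])
  ultimately show ?thesis by simp
qed

lemma power_series_eq_0:
  fixes d :: "nat \<Rightarrow> real"
  assumes "\<And>y. y \<noteq> 0 \<Longrightarrow> \<bar>y\<bar> < 1 \<Longrightarrow> (\<lambda>n. d n * y ^ n) sums 0"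
  shows "d n = 0"
  using assms
proof (induction n arbitrary: d)
  case (0 d)
  have "((\<lambda>y::real. 0::real) \<longlongrightarrow> d 0) (at 0)"
    by (rule powser_limit_0_strong[where s=1 and a=d and f="\<lambda>_. 0"]) (use 0 in auto)
  then show ?case using LIM_unique tendsto_const by metis
next
  case (Suc n d)
  have d0: "d 0 = 0"
  proof -
    have "((\<lambda>y::real. 0::real) \<longlongrightarrow> d 0) (at 0)"
      by (rule powser_limit_0_strong[where s=1 and a=d and f="\<lambda>_. 0"]) (use Suc.prems in auto)
    then show ?thesis using LIM_unique tendsto_const by metis
  qed
  show ?case
  proof (rule Suc.IH[of "\<lambda>n. d (Suc n)"])
    fix y :: real assume y: "y \<noteq> 0" "\<bar>y\<bar> < 1"
    have "(\<lambda>n. d (Suc n) * y ^ Suc n) sums 0"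
      using Suc.prems[OF y] d0 by (subst sums_Suc_iff) simp
    then have "(\<lambda>n. d (Suc n) * y ^ Suc n * (1/y)) sums (0 * (1/y))"
      by (rule sums_mult2)
    then show "(\<lambda>n. d (Suc n) * y ^ n) sums 0" using y by (simp add: field_simps)
  qed
qed

text \<open>
  Put \<open>M\<close> for the generating function and \<open>q = sqrt (1 - y)\<close>. Then
  \<open>(M - 1) / y = b / (q * (b * q + (1 - b)))\<close>, and
  \<open>(1 - 2 * b) + b^2 * y = ((1 - b) - b * q) * (b * q + (1 - b))\<close>. Multiplying the two removes the
  denominator and leaves \<open>1/q\<close>, a known series: this is the recurrence of \<open>moment_coeff\<close>.
\<close>

lemma generating_function_coeff:
  fixes b :: real and mu :: "nat \<Rightarrow> real"
  assumes b: "0 < b" "b < 1"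
    and gf: "\<And>y. y \<noteq> 0 \<Longrightarrow> \<bar>y\<bar> < 1 \<Longrightarrow>
      (\<lambda>n. mu n * y ^ n) sums ((b / sqrt (1 - y) + (1 - b)) / (b * sqrt (1 - y) + (1 - b)))"
    and mu0: "mu 0 = 1"
  shows "mu (Suc n) = b * moment_coeff b n"
proof -
  define c where "c n = real ((2 * n) choose n) / 4 ^ n" for n
  define prev where "prev n = (case n of 0 \<Rightarrow> 0 | Suc m \<Rightarrow> mu (Suc m))" for n
  \<comment> \<open>coefficients of \<open>((1 - 2*b) + b^2 * y) * (M - 1) / y - b * (1 - b) / q + b^2\<close>\<close>
  define d where "d n = (1 - 2*b) * mu (Suc n) + b^2 * prev n - b * (1 - b) * c n + (if n = 0 then b^2 else 0)" for n
  have "d n = 0" for n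
  proof (rule power_series_eq_0)
    fix y :: real assume y: "y \<noteq> 0" "\<bar>y\<bar> < 1"
    define q where "q = sqrt (1 - y)"
    have q: "q > 0" "q^2 = 1 - y" using y by (auto simp: q_def)
    have den: "b * q + (1 - b) > 0" using b q by (simp add: add_pos_pos)
    define M where "M = (b / q + (1 - b)) / (b * q + (1 - b))"
    have M: "(\<lambda>n. mu n * y ^ n) sums M" using gf[OF y] by (simp add: M_def q_def)
    have M1: "(\<lambda>n. mu (Suc n) * y ^ Suc n) sums (M - 1)"
      using M mu0 by (subst sums_Suc_iff) simp
    have p: "(\<lambda>n. prev n * y ^ n) sums (M - 1)"
    proof -
      have "(\<lambda>n. prev (Suc n) * y ^ Suc n) sums (M - 1)" using M1 by (simp add: prev_def)
      then show ?thesis by (subst (asm) sums_Suc_iff) (simp add: prev_def)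
    qed
    have t: "(\<lambda>n. mu (Suc n) * y ^ n) sums ((M - 1) / y)"
      using sums_divide[OF M1, of y] y by simp
    have c: "(\<lambda>n. c n * y ^ n) sums (1 / q)"
      using inverse_sqrt_series[OF y(2)] by (simp add: c_def q_def)
    have i: "(\<lambda>n. if n = 0 then b^2 * y^n else 0) sums (b^2 * y^0)"
      by (rule sums_single)
    have "d n * y ^ n = (1 - 2*b) * (mu (Suc n) * y ^ n) + b^2 * (prev n * y ^ n)
        - b * (1 - b) * (c n * y ^ n) + (if n = 0 then b^2 * y^n else 0)" for n
      by (simp add: d_def ring_distribs)
    then have "(\<lambda>n. d n * y ^ n) sums
        ((1 - 2*b) * ((M - 1) / y) + b^2 * (M - 1) - b * (1 - b) * (1/q) + b^2 * y^0)"
      using sums_add[OF sums_diff[OF sums_add[OF sums_mult[OF t, of "1-2*b"] sums_mult[OF p, of "b^2"]]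
        sums_mult[OF c, of "b * (1-b)"]] i] by (simp only:)
    then have "(\<lambda>n. d n * y ^ n) sums
        ((1 - 2*b) * ((M - 1) / y) + b^2 * (M - 1) - b * (1 - b) * (1/q) + b^2)"
      by simp
    also have "(1 - 2*b) * ((M - 1) / y) + b^2 * (M - 1) - b * (1 - b) * (1/q) + b^2 = 0"
    proof -
      have M': "M - 1 = b * y / (q * (b * q + (1 - b)))"
      proof -
        have "M - 1 = (b / q - b * q) / (b * q + (1 - b))"
        proof -
          have "M - 1 = (b / q + (1 - b)) / (b * q + (1 - b)) - (b * q + (1 - b)) / (b * q + (1 - b))"
            using den by (subst divide_self) (auto simp: M_def)
          also have "\<dots> = ((b / q + (1 - b)) - (b * q + (1 - b))) / (b * q + (1 - b))"
            by (rule diff_divide_distrib[symmetric])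
          finally show ?thesis by simp
        qed
        also have "b / q - b * q = b * (1 - q^2) / q"
          using q(1) by (simp add: field_simps power2_eq_square)
        finally show ?thesis by (simp add: q(2))
      qed
      have "(1 - 2*b) * ((M - 1) / y) + b^2 * (M - 1)
          = b * ((1 - 2*b) + b^2 * y) / (q * (b * q + (1 - b)))"
      proof -
        define E where "E = q * (b * q + (1 - b))"
        have "(M - 1) / y = b / E" using y by (simp add: M' E_def)
        moreover have "b^2 * (M - 1) = b^2 * (b * y / E)" by (simp add: M' E_def)
        moreover have "(1 - 2*b) * (b / E) + b^2 * (b * y / E) = b * ((1 - 2*b) + b^2 * y) / E"
          by (simp only: times_divide_eq_right add_divide_distrib[symmetric]) (simp add: algebra_simps)
        ultimately show ?thesis by (simp only: E_def)
      qed
      also have "(1 - 2*b) + b^2 * y = ((1 - b) - b * q) * (b * q + (1 - b))"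
      proof -
        have y: "y = 1 - q^2" using q by simp
        show ?thesis unfolding y by (simp add: algebra_simps power2_eq_square)
      qed
      also have "b * (((1 - b) - b * q) * (b * q + (1 - b))) / (q * (b * q + (1 - b)))
          = b * ((1 - b) - b * q) / q"
        using den by simp
      finally have "(1 - 2*b) * ((M - 1) / y) + b^2 * (M - 1) = b * ((1 - b) - b * q) / q" .
      moreover have "b * ((1 - b) - b * q) / q = b * (1 - b) * (1/q) - b^2"
        using q(1) by (simp add: field_simps power2_eq_square)
      ultimately show ?thesis by simp
    qed
    finally show "(\<lambda>n. d n * y ^ n) sums 0" .
  qed
  note dz = this
  have rec0: "(1 - 2*b) * mu (Suc 0) = b * (1 - b) - b^2"
    and rec: "(1 - 2*b) * mu (Suc (Suc n)) + b^2 * mu (Suc n) = b * (1 - b) * c (Suc n)" for n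
  proof -
    have c0: "c 0 = 1" by (simp add: c_def)
    show "(1 - 2*b) * mu (Suc 0) = b * (1 - b) - b^2"
      using dz[of 0] unfolding d_def prev_def c0 by simp
    show "(1 - 2*b) * mu (Suc (Suc n)) + b^2 * mu (Suc n) = b * (1 - b) * c (Suc n)" for n
      using dz[of "Suc n"] unfolding d_def prev_def by simp
  qed
  define e where "e n = mu (Suc n) - b * moment_coeff b n" for n
  have occ0: "moment_coeff b 0 = 1" by (simp add: moment_coeff_def)
  have e0: "(1 - 2*b) * e 0 = 0"
    using rec0 by (simp add: e_def occ0 algebra_simps power2_eq_square)
  have e: "(1 - 2*b) * e (Suc n) + b^2 * e n = 0" for n
  proof -
    have "(1 - 2*b) * e (Suc n) + b^2 * e n = ((1 - 2*b) * mu (Suc (Suc n)) + b^2 * mu (Suc n))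
       - b * ((1 - 2*b) * moment_coeff b (Suc n) + b^2 * moment_coeff b n)"
      by (simp add: e_def algebra_simps)
    then show ?thesis unfolding moment_coeff_recurrence rec by (simp only: c_def) (simp only: mult.assoc times_divide_eq_right diff_self)
  qed
  \<comment> \<open>for \<open>b = 1/2\<close> the leading coefficient of the recurrence vanishes and its second term decides\<close>
  have "e n = 0"
  proof (cases "1 - 2*b = 0")
    case True
    then show ?thesis using e[of n] b by simp
  next
    case False
    show ?thesis
    proof (induction n)
      case 0 show ?case using e0 False by (metis mult_eq_0_iff)
    next
      case (Suc n)
      have "(1 - 2*b) * e (Suc n) + b^2 * 0 = 0" using e[of n] unfolding Suc.IH .
      then have "(1 - 2*b) * e (Suc n) = 0" by (simp only: mult_zero_right add_0_right)
      then show ?case using False by (metis mult_eq_0_iff)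
    qed
  qed
  then show ?thesis by (simp add: e_def)
qed

section \<open>Uniqueness of Laplace transforms\<close>

text \<open>
  After the substitution \<open>x = exp (-t)\<close> the hypothesis says that the continuous function
  \<open>chi x = x * f (- ln x)\<close> on \<open>[0,1]\<close> is orthogonal to all polynomials for a weight that is positive on
  \<open>(0,1)\<close>; approximating \<open>chi\<close> itself by polynomials makes its weighted square integral vanish. The growth
  bound is what makes \<open>chi\<close> continuous at \<open>0\<close>. Integration stays on the \<open>t\<close>-side, with respect to
  an exponential law.
\<close>

lemma laplace_uniqueness:
  fixes f :: "real \<Rightarrow> real"
  assumes cont: "continuous_on {0..} f"
    and bound: "\<And>t. 0 \<le> t \<Longrightarrow> \<bar>f t\<bar> \<le> C * exp (t / 2)"
    and lap: "\<And>k::nat. k \<ge> 1 \<Longrightarrow> (LINT t:{0..}|lborel. exp (- real k * t) * f t) = 0"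
    and t: "0 \<le> t"
  shows "f t = 0"
proof -
  define g where "g t = indicator {0..} t * f t" for t :: real
  have [measurable]: "g \<in> borel_measurable borel"
    using borel_measurable_continuous_on_indicator[of "{0..}" f] cont by (simp add: g_def[abs_def])
  have C: "C \<ge> 0" using bound[of 0] by simp
  define Mu where "Mu = density lborel (\<lambda>t. ennreal (exponential_density (1/2) t))"
  interpret Mu: prob_space Mu unfolding Mu_def by (rule prob_space_exponential_density) simp
  have LI: "(LINT t:{0..}|lborel. exp (- t/2) * h t) = 2 * (\<integral>t. h t \<partial>Mu)"
    if [measurable]: "h \<in> borel_measurable borel" for h :: "real \<Rightarrow> real"
  proof -
    have "(\<integral>t. h t \<partial>Mu) = (\<integral>t. exponential_density (1/2) t * h t \<partial>lborel)"
      unfolding Mu_def by (subst integral_density) (auto simp: erlang_density_nonneg)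
    also have "2 * \<dots> = (\<integral>t. 2 * (exponential_density (1/2) t * h t) \<partial>lborel)" by simp
    also have "\<dots> = (LINT t:{0..}|lborel. exp (- t/2) * h t)"
      unfolding set_lebesgue_integral_def
      by (intro Bochner_Integration.integral_cong) (auto simp: exponential_density_def split: split_indicator)
    finally show ?thesis by simp
  qed
  define chi where "chi x = (if x \<le> 0 then 0 else x * f (- ln x))" for x :: real
  have chi_exp: "chi (exp (-t)) = exp (-t) * f t" for t by (simp add: chi_def)
  have chi_cont: "continuous_on {0..1} chi"
    unfolding continuous_on_eq_continuous_within
  proof
    fix x :: real assume x: "x \<in> {0..1}"
    show "continuous (at x within {0..1}) chi"
    proof (cases "x = 0")
      case True
      have b: "norm (chi y) \<le> C * sqrt y" if "y \<in> {0..1}" for y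
      proof (cases "y = 0")
        case False
        then have y: "0 < y" "y \<le> 1" using that by auto
        then have "\<bar>f (- ln y)\<bar> \<le> C * exp (- ln y / 2)" by (intro bound) simp
        also have "exp (- ln y / 2) = 1 / sqrt y"
        proof -
          have "sqrt y = exp (ln y / 2)" using y by (simp add: powr_half_sqrt[symmetric] powr_def)
          moreover have "exp (- ln y / 2) * exp (ln y / 2) = 1" by (simp add: exp_add[symmetric])
          ultimately show ?thesis by (simp add: eq_divide_eq)
        qed
        finally have "y * \<bar>f (- ln y)\<bar> \<le> y * (C * (1 / sqrt y))" using y by (intro mult_left_mono) auto
        also have "\<dots> = C * (y / sqrt y)" by (simp add: mult.commute)
        also have "y / sqrt y = sqrt y" using y by (simp add: real_div_sqrt)
        finally show ?thesis using y by (simp add: chi_def abs_mult)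
      qed (simp add: chi_def)
      have "((\<lambda>y. C * sqrt y) \<longlongrightarrow> C * sqrt 0) (at 0 within {0..1})"
        by (intro tendsto_intros)
      moreover have "\<forall>y. y \<noteq> 0 \<longrightarrow> y \<in> {0..1} \<longrightarrow> norm (chi y) \<le> C * sqrt y"
        by (intro allI impI b)
      then have "\<forall>\<^sub>F y in at 0 within {0..1}. norm (chi y) \<le> C * sqrt y"
        unfolding eventually_at_filter by (rule always_eventually)
      ultimately have "(chi \<longlongrightarrow> 0) (at 0 within {0..1})"
        using Lim_null_comparison[of chi "\<lambda>y. C * sqrt y"] by simp
      then show ?thesis by (simp add: True continuous_within chi_def)
    next
      case False
      then have x0: "x > 0" using x by auto
      have "continuous_on {0<..1} (\<lambda>x. x * f (- ln x))"
        by (intro continuous_intros continuous_on_compose2[OF cont]) auto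
      then have "continuous_on {0<..1} chi"
        by (rule continuous_on_eq) (auto simp: chi_def)
      then have "continuous (at x within {0<..1}) chi"
        using x x0 by (simp add: continuous_on_eq_continuous_within)
      moreover have "at x within {0<..1} = at x within {0..1}"
        by (rule at_within_nhd[of _ "{0<..}"]) (use x0 in auto)
      ultimately show ?thesis by simp
    qed
  qed
  define u where "u t = exp (-t) * g t" for t
  have [measurable]: "u \<in> borel_measurable borel" unfolding u_def by measurable
  have ub: "exp (-t) * \<bar>f t\<bar> \<le> C" if "0 \<le> t" for t
  proof -
    have "exp (-t) * \<bar>f t\<bar> \<le> exp (-t) * (C * exp (t/2))"
      using bound[OF that] by (intro mult_left_mono) auto
    also have "\<dots> = C * exp (-t/2)" by (simp add: mult_exp_exp)
    also have "\<dots> \<le> C * 1" using that C by (intro mult_left_mono) auto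
    finally show ?thesis by simp
  qed
  have ub': "\<bar>u t\<bar> \<le> C" for t
    using ub[of t] C by (auto simp: u_def g_def abs_mult split: split_indicator)
  \<comment> \<open>one power of \<open>exp (-t)\<close> is spent on \<open>u\<close> and one on the weight, whence the exponent \<open>k + 2 \<ge> 1\<close>\<close>
  have mom: "(\<integral>t. exp (-t) ^ k * (exp (-t/2) * u t) \<partial>Mu) = 0" for k :: nat
  proof -
    have "2 * (\<integral>t. exp (-t) ^ k * (exp (-t/2) * u t) \<partial>Mu)
        = (LINT t:{0..}|lborel. exp (- t/2) * (exp (-t) ^ k * (exp (-t/2) * u t)))"
      by (rule LI[symmetric]) measurable
    also have "\<dots> = (LINT t:{0..}|lborel. exp (- real (k + 2) * t) * f t)"
    proof -
      have e: "exp (- t/2) * (exp (-t) ^ k * (exp (-t/2) * exp (-t))) = exp (- real (k + 2) * t)" for t :: real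
      proof -
        have "- t/2 + (real k * (-t) + (-t/2 + -t)) = - real (k + 2) * t" by (simp add: algebra_simps)
        then show ?thesis by (simp only: exp_of_nat_mult[symmetric] exp_add[symmetric])
      qed
      have "exp (- t/2) * (exp (-t) ^ k * (exp (-t/2) * u t)) = exp (- real (k + 2) * t) * f t"
        if "t \<in> {0..}" for t
        using that e[of t] by (simp only: u_def g_def mult.assoc[symmetric] indicator_simps mult_1_right)
      then show ?thesis by (intro set_lebesgue_integral_cong) auto
    qed
    also have "\<dots> = 0" by (rule lap) simp
    finally show ?thesis by simp
  qed
  have poly: "(\<integral>t. p (exp (-t)) * (exp (-t/2) * u t) \<partial>Mu) = 0" if p: "real_polynomial_function p" for p
  proof -
    from p obtain a n where p: "p = (\<lambda>x. \<Sum>i\<le>n. a i * x ^ i)"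
      using real_polynomial_function_iff_sum by blast
    have i: "integrable Mu (\<lambda>t. a i * (exp (-t) ^ i * (exp (-t/2) * u t)))" for i
    proof (intro integrable_mult_right Mu.integrable_const_bound[where B=C])
      show "AE t in Mu. norm (exp (-t) ^ i * (exp (-t/2) * u t)) \<le> C"
      proof (rule AE_I2)
        fix t show "norm (exp (-t) ^ i * (exp (-t/2) * u t)) \<le> C"
        proof (cases "0 \<le> t")
          case True
          have "norm (exp (-t) ^ i * (exp (-t/2) * u t)) \<le> 1 * (1 * C)"
            unfolding norm_mult using True C ub'[of t]
            by (intro mult_mono) (auto simp: power_le_one)
          then show ?thesis by simp
        qed (use C in \<open>simp add: u_def g_def\<close>)
      qed
      show "(\<lambda>t. exp (-t) ^ i * (exp (-t/2) * u t)) \<in> borel_measurable Mu" unfolding Mu_def by measurable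
    qed
    have "(\<integral>t. p (exp (-t)) * (exp (-t/2) * u t) \<partial>Mu)
        = (\<integral>t. (\<Sum>i\<le>n. a i * (exp (-t) ^ i * (exp (-t/2) * u t))) \<partial>Mu)"
      by (simp add: p sum_distrib_right mult.assoc)
    also have "\<dots> = (\<Sum>i\<le>n. \<integral>t. a i * (exp (-t) ^ i * (exp (-t/2) * u t)) \<partial>Mu)"
      by (intro Bochner_Integration.integral_sum i)
    also have "\<dots> = (\<Sum>i\<le>n. a i * (\<integral>t. exp (-t) ^ i * (exp (-t/2) * u t) \<partial>Mu))" by simp
    also have "\<dots> = 0" by (simp only: mom) simp
    finally show ?thesis .
  qed
  have eb: "exp (-t/2) * \<bar>u t\<bar> \<le> C" for t
  proof (cases "0 \<le> t")
    case True
    have "exp (-t/2) * \<bar>u t\<bar> \<le> 1 * C" using True ub'[of t] by (intro mult_mono) auto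
    then show ?thesis by simp
  qed (use C in \<open>simp add: u_def g_def\<close>)
  define v where "v t = u t * (exp (-t/2) * u t)" for t
  have [measurable]: "v \<in> borel_measurable borel" unfolding v_def by measurable
  have [measurable_cong]: "sets Mu = sets borel" by (simp add: Mu_def)
  have int_v: "integrable Mu v"
  proof (rule Mu.integrable_const_bound[where B="C*C"])
    show "AE t in Mu. norm (v t) \<le> C * C"
      unfolding v_def norm_mult using ub' eb C by (intro AE_I2 mult_mono) (auto simp: abs_mult)
  qed simp
  have small: "(\<integral>t. v t \<partial>Mu) \<le> e * C" if e: "e > 0" for e
  proof -
    obtain p where p: "real_polynomial_function p" "\<And>x. x \<in> {0..1} \<Longrightarrow> \<bar>chi x - p x\<bar> < e"
      using Stone_Weierstrass_real_polynomial_function[OF compact_Icc chi_cont e] by blast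
    have cp: "continuous_on UNIV p" using p(1) by (simp add: continuous_on_polymonial_function real_polynomial_function_eq)
    then have [measurable]: "p \<in> borel_measurable borel" by (rule borel_measurable_continuous_onI)
    let ?w = "\<lambda>t. exp (-t/2) * u t"
    let ?d = "\<lambda>t. (u t - p (exp (-t))) * ?w t"
    have db: "\<bar>?d t\<bar> \<le> e * C" for t
    proof (cases "0 \<le> t")
      case True
      have "\<bar>u t - p (exp (-t))\<bar> \<le> e"
        using p(2)[of "exp (-t)"] True by (simp add: chi_exp u_def g_def)
      then show ?thesis unfolding abs_mult using eb[of t] e by (intro mult_mono) (auto simp: abs_mult)
    qed (use C e in \<open>simp add: u_def g_def\<close>)
    have int_d: "integrable Mu ?d"
      by (rule Mu.integrable_const_bound[where B="e*C"]) (use db in auto)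
    have "(\<integral>t. p (exp (-t)) * ?w t \<partial>Mu) = (\<integral>t. v t - ?d t \<partial>Mu)"
      by (intro Bochner_Integration.integral_cong) (auto simp: v_def algebra_simps)
    also have "\<dots> = (\<integral>t. v t \<partial>Mu) - (\<integral>t. ?d t \<partial>Mu)" using int_v int_d by simp
    finally have "(\<integral>t. v t \<partial>Mu) = (\<integral>t. ?d t \<partial>Mu)" using poly[OF p(1)] by simp
    also have "\<dots> \<le> (\<integral>t. e * C \<partial>Mu)"
      using db by (intro integral_mono int_d) (auto intro: order_trans[OF abs_ge_self])
    finally show ?thesis by (simp add: Mu.prob_space)
  qed
  have vnn: "0 \<le> v t" for t
  proof -
    have "v t = exp (-t/2) * (u t * u t)" by (simp add: v_def)
    then show ?thesis by simp
  qed
  have "(\<integral>t. v t \<partial>Mu) \<le> 0"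
  proof (rule field_le_epsilon)
    fix e :: real assume e: "e > 0"
    have "(\<integral>t. v t \<partial>Mu) \<le> e / (C + 1) * C" by (rule small) (use e C in auto)
    also have "\<dots> \<le> e" using e C by (simp add: field_simps)
    finally show "(\<integral>t. v t \<partial>Mu) \<le> 0 + e" by simp
  qed
  then have "(\<integral>t. v t \<partial>Mu) = 0" using Bochner_Integration.integral_nonneg[of Mu v] vnn by (simp add: order_antisym)
  then have "AE t in Mu. v t = 0" using integral_nonneg_eq_0_iff_AE[OF int_v] vnn by simp
  then have "AE t in lborel. 0 < exponential_density (1/2) t \<longrightarrow> v t = 0"
    unfolding Mu_def by (subst (asm) AE_density) (auto simp: ennreal_eq_0_iff)
  then have "AE t in lborel. t \<in> {0..} \<longrightarrow> f t = 0"
    by eventually_elim (auto simp: exponential_density_def v_def u_def g_def)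
  then have z: "AE t\<in>{0<..} in lebesgue. t \<in> {t \<in> {0..}. f t = 0}"
    by (intro AE_completion) (auto elim!: eventually_mono)
  have cl: "closed {t \<in> {0..}. f t = 0}"
    by (rule continuous_closed_preimage_constant[OF cont]) simp
  have "{0<..} \<subseteq> {t \<in> {0..}. f t = 0}"
    using mem_closed_if_AE_lebesgue_open[OF open_greaterThan cl z] by blast
  then have "closure {0<..} \<subseteq> {t \<in> {0..}. f t = 0}"
    by (rule closure_minimal[OF _ cl])
  then show ?thesis using t by auto
qed

section \<open>Transition operators and the resolvent\<close>

lemma integral_measurable_kernel:
  fixes f :: "'a \<Rightarrow> 'b \<Rightarrow> real"
  assumes f[measurable]: "(\<lambda>(x, y). f x y) \<in> borel_measurable (M \<Otimes>\<^sub>M N)"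
    and L[measurable]: "L \<in> M \<rightarrow>\<^sub>M subprob_algebra N"
  shows "(\<lambda>x. \<integral>y. f x y \<partial>L x) \<in> borel_measurable M"
proof -
  note integral_measurable_subprob_algebra[measurable] measurable_distr2[measurable]
  have "(\<lambda>x. integral\<^sup>L (distr (L x) (M \<Otimes>\<^sub>M N) (\<lambda>y. (x, y))) (\<lambda>(x, y). f x y)) \<in> borel_measurable M"
    by measurable
  then show ?thesis
    by (rule measurable_cong[THEN iffD1, rotated]) (simp add: integral_distr)
qed

abbreviation exp_time :: "real \<Rightarrow> real measure" where
  "exp_time l \<equiv> density lborel (\<lambda>u. ennreal (exponential_density l u))"

lemma measure_exp_time_UNIV: "0 < l \<Longrightarrow> measure (exp_time l) UNIV = 1"
  using prob_space.prob_space[OF prob_space_exponential_density, of l] by simp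

context regular_diffusion
begin

lemma sets_P [simp, measurable_cong]: "sets (P x) = sets N"
  and space_P [simp]: "space (P x) = space N"
  and prob_space_P: "prob_space (P x)"
proof -
  have "P x \<in> space (prob_algebra N)" using measurable_space[OF kernel, of x] by simp
  then show 1: "sets (P x) = sets N" and "prob_space (P x)" by (auto simp: space_prob_algebra)
  show "space (P x) = space N" using 1 by (rule sets_eq_imp_space_eq)
qed

lemma measure_P_space [simp]: "measure (P x) (space N) = 1"
  using prob_space.prob_space[OF prob_space_P, of x] by simp

lemma kernel_subprob [measurable]: "P \<in> borel \<rightarrow>\<^sub>M subprob_algebra N"
  using kernel by (rule measurable_prob_algebraD)

lemma measurable_X [measurable]: "0 \<le> t \<Longrightarrow> X t \<in> borel_measurable N"
  by (rule measurable_from_subalg[OF subalgebra_F adapted])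

text \<open>
  The paths are approximated by their values at the grid points below; measurability is only known
  for one time at a time, and continuity turns it into joint measurability. The truncation \<open>max 0 u\<close>
  is there because nothing is known about the process at negative times.
\<close>

lemma measurable_process [measurable]: "(\<lambda>(u, \<omega>). X (max 0 u) \<omega>) \<in> borel_measurable (borel \<Otimes>\<^sub>M N)"
proof (rule borel_measurable_LIMSEQ_real)
  fix n :: nat
  have "(\<lambda>z. (\<lambda>i z. X (real i / real (Suc n)) (snd z)) (nat \<lfloor>max 0 (fst z) * real (Suc n)\<rfloor>) z)
      \<in> borel_measurable (borel \<Otimes>\<^sub>M N)"
    by (rule measurable_compose_countable) measurable
  then show "(\<lambda>(u, \<omega>). X (real (nat \<lfloor>max 0 u * real (Suc n)\<rfloor>) / real (Suc n)) \<omega>)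
      \<in> borel_measurable (borel \<Otimes>\<^sub>M N)"
    by (simp add: case_prod_beta')
next
  fix z :: "real \<times> 'a" assume z: "z \<in> space (borel \<Otimes>\<^sub>M N)"
  obtain u \<omega> where [simp]: "z = (u, \<omega>)" by (cases z)
  have w: "\<omega> \<in> space N" using z by (simp add: space_pair_measure)
  define v where "v = max 0 u"
  have v: "0 \<le> v" by (simp add: v_def)
  define a where "a n = real (nat \<lfloor>v * real (Suc n)\<rfloor>) / real (Suc n)" for n
  have a: "a n = of_int \<lfloor>v * real (Suc n)\<rfloor> / real (Suc n)" for n
    using v by (simp add: a_def)
  have "a \<longlonglongrightarrow> v"
  proof (rule real_tendsto_sandwich)
    show "\<forall>\<^sub>F n in sequentially. v - 1 / real (Suc n) \<le> a n"
    proof (rule always_eventually, rule allI)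
      fix n
      have "v * real (Suc n) - 1 \<le> of_int \<lfloor>v * real (Suc n)\<rfloor>" by linarith
      then have "(v * real (Suc n) - 1) / real (Suc n) \<le> a n"
        unfolding a by (rule divide_right_mono) simp
      then show "v - 1 / real (Suc n) \<le> a n" by (simp add: diff_divide_distrib)
    qed
    show "\<forall>\<^sub>F n in sequentially. a n \<le> v"
    proof (rule always_eventually, rule allI)
      fix n
      have "a n \<le> (v * real (Suc n)) / real (Suc n)"
        unfolding a by (rule divide_right_mono) (auto simp: of_int_floor_le)
      then show "a n \<le> v" by simp
    qed
    have "(\<lambda>n. v - 1 / real (Suc n)) \<longlonglongrightarrow> v - 0"
      by (intro tendsto_intros LIMSEQ_Suc[OF lim_1_over_n])
    then show "(\<lambda>n. v - 1 / real (Suc n)) \<longlonglongrightarrow> v" by simp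
  qed simp
  moreover have "0 \<le> a n" for n by (simp add: a_def)
  ultimately have "(\<lambda>n. X (a n) \<omega>) \<longlonglongrightarrow> X v \<omega>"
    using continuous_on_tendsto_compose[OF continuous_paths[OF w], of a v sequentially] v
    by simp
  then show "(\<lambda>n. (case z of (u, \<omega>) \<Rightarrow> X (real (nat \<lfloor>max 0 u * real (Suc n)\<rfloor>) / real (Suc n)) \<omega>))
      \<longlonglongrightarrow> (case z of (u, \<omega>) \<Rightarrow> X (max 0 u) \<omega>)"
    by (simp add: a_def v_def)
qed

definition transition :: "real \<Rightarrow> (real \<Rightarrow> real) \<Rightarrow> real \<Rightarrow> real" where
  "transition t g x = (\<integral>\<omega>. g (X t \<omega>) \<partial>P x)"

lemma measurable_transition [measurable]:
  assumes [measurable]: "g \<in> borel_measurable borel"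
  shows "(\<lambda>(u, x). transition (max 0 u) g x) \<in> borel_measurable (borel \<Otimes>\<^sub>M borel)"
proof -
  have [measurable]: "(\<lambda>x. X (max 0 (fst (fst x))) (snd x))
    \<in> borel_measurable ((borel \<Otimes>\<^sub>M borel) \<Otimes>\<^sub>M N)"
    using measurable_compose[OF _ measurable_process,
       of "\<lambda>x. (fst (fst x), snd x)" "(borel \<Otimes>\<^sub>M borel) \<Otimes>\<^sub>M N"] by simp
  have "(\<lambda>z. \<integral>\<omega>. g (X (max 0 (fst z)) \<omega>) \<partial>P (snd z)) \<in> borel_measurable (borel \<Otimes>\<^sub>M borel)"
    by (rule integral_measurable_kernel[where N=N]) (auto simp: case_prod_beta')
  then show ?thesis by (simp add: transition_def case_prod_beta')
qed

lemma measurable_transition_space: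
  assumes [measurable]: "g \<in> borel_measurable borel" and "0 \<le> t"
  shows "transition t g \<in> borel_measurable borel"
proof -
  have "(\<lambda>x. (\<lambda>(u, x). transition (max 0 u) g x) (t, x)) \<in> borel_measurable borel"
    by measurable
  then show ?thesis using \<open>0 \<le> t\<close> by simp
qed

lemma integrable_transition:
  fixes g :: "real \<Rightarrow> real"
  assumes [measurable]: "g \<in> borel_measurable borel" and "\<And>y. \<bar>g y\<bar> \<le> C" "0 \<le> t"
  shows "integrable (P x) (\<lambda>\<omega>. g (X t \<omega>))"
proof -
  interpret prob_space "P x" by (rule prob_space_P)
  have [measurable]: "X t \<in> borel_measurable N" using assms by simp
  show ?thesis by (rule integrable_const_bound[where B=C]) (use assms in auto)
qed

lemma abs_transition_le:
  assumes "g \<in> borel_measurable borel" and b: "\<And>y. \<bar>g y\<bar> \<le> C" and "0 \<le> t"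
  shows "\<bar>transition t g x\<bar> \<le> C"
proof -
  interpret prob_space "P x" by (rule prob_space_P)
  have "\<bar>transition t g x\<bar> \<le> (\<integral>\<omega>. \<bar>g (X t \<omega>)\<bar> \<partial>P x)"
    unfolding transition_def by (rule integral_abs_bound)
  also have "\<dots> \<le> (\<integral>\<omega>. C \<partial>P x)"
    using integrable_transition[OF assms] b by (intro integral_mono) auto
  finally show ?thesis by (simp add: prob_space)
qed

text \<open>
  The strong Markov property at the constant time \<open>s\<close>, for which the stopped sigma-algebra contains \<open>F s\<close>,
  in integrated form.
\<close>

lemma Markov_property:
  assumes st: "0 \<le> s" "0 \<le> t" and [measurable]: "g \<in> borel_measurable borel"
    and b: "\<And>y. \<bar>g y\<bar> \<le> C" and B: "B \<in> sets (F s)"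
  shows "(\<integral>\<omega>. indicator B \<omega> * g (X (s + t) \<omega>) \<partial>P x)
       = (\<integral>\<omega>. indicator B \<omega> * transition t g (X s \<omega>) \<partial>P x)"
proof -
  let ?G = "pre_sigma (\<lambda>_. s)"
  have st_const: "stopping_time F (\<lambda>_. s)" by (rule stopping_time_const)
  have sub: "subalgebra (P x) ?G"
    unfolding subalgebra_def
  proof (intro conjI subsetI)
    fix A assume "A \<in> sets ?G"
    then have "{\<omega>\<in>A. s \<le> s} \<in> sets (F s)" by (rule sets_pre_sigmaD[OF st_const])
    then show "A \<in> sets (P x)" using subalgebra_F[of s] by (auto simp: subalgebra_def)
  qed (simp add: space_pre_sigma)
  have BG: "B \<in> sets ?G"
  proof (rule sets_pre_sigmaI[OF st_const])
    fix t show "{\<omega> \<in> B. s \<le> t} \<in> sets (F t)"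
      using B sets_F_mono[of s t] by (cases "s \<le> t") auto
  qed
  have [measurable]: "X (s + t) \<in> borel_measurable N" "X s \<in> borel_measurable N"
    "transition t g \<in> borel_measurable borel"
    using st measurable_transition_space by auto
  have BN[measurable]: "B \<in> sets N" using BG sub by (auto simp: subalgebra_def)
  interpret prob_space "P x" by (rule prob_space_P)
  interpret sigma_finite_subalgebra "P x" ?G
    by (intro finite_measure_subalgebra_is_sigma_finite finite_measure_subalgebra.intro
        finite_measure_subalgebra_axioms.intro finite_measure_axioms sub)
  have i: "integrable (P x) (\<lambda>\<omega>. indicator B \<omega> * g (X (s + t) \<omega>))"
    using integrable_mult_indicator[of B "P x" "\<lambda>\<omega>. g (X (s + t) \<omega>)"] st
      integrable_transition[OF assms(3) b, of "s + t" x] by simp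
  have "(\<integral>\<omega>. indicator B \<omega> * g (X (s + t) \<omega>) \<partial>P x)
      = (\<integral>\<omega>. indicator B \<omega> * real_cond_exp (P x) ?G (\<lambda>\<omega>. g (X (s + t) \<omega>)) \<omega> \<partial>P x)"
    by (rule real_cond_exp_intg(2)[symmetric, OF i]) (use BG in auto)
  also have "\<dots> = (\<integral>\<omega>. indicator B \<omega> * transition t g (X s \<omega>) \<partial>P x)"
  proof (rule integral_cong_AE)
    have "bounded (range g)" using b by (auto simp: bounded_iff)
    then have "AE \<omega> in P x. real_cond_exp (P x) ?G (\<lambda>\<omega>. g (X (s + t) \<omega>)) \<omega> = transition t g (X s \<omega>)"
      using strong_Markov[OF st_const, of t g x] st unfolding transition_def by simp
    then show "AE \<omega> in P x. indicator B \<omega> * real_cond_exp (P x) ?G (\<lambda>\<omega>. g (X (s + t) \<omega>)) \<omega>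
        = indicator B \<omega> * transition t g (X s \<omega>)" by eventually_elim simp
  next
    have [measurable]: "real_cond_exp (P x) ?G (\<lambda>\<omega>. g (X (s + t) \<omega>)) \<in> borel_measurable (P x)"
      by (rule borel_measurable_cond_exp2)
    show "(\<lambda>\<omega>. indicator B \<omega> * real_cond_exp (P x) ?G (\<lambda>\<omega>. g (X (s + t) \<omega>)) \<omega>)
        \<in> borel_measurable (P x)" by measurable
  qed simp
  finally show ?thesis .
qed

lemma transition_add:
  assumes "0 \<le> s" "0 \<le> t" "g \<in> borel_measurable borel" "\<And>y. \<bar>g y\<bar> \<le> C"
  shows "transition (s + t) g x = transition s (transition t g) x"
proof -
  have "space N \<in> sets (F s)" using sets.top[of "F s"] by (simp add: space_F)
  from Markov_property[OF assms this, of x]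
  have "(\<integral>\<omega>. indicator (space N) \<omega> * g (X (s + t) \<omega>) \<partial>P x)
       = (\<integral>\<omega>. indicator (space N) \<omega> * transition t g (X s \<omega>) \<partial>P x)" .
  moreover have "(\<integral>\<omega>. indicator (space N) \<omega> * h \<omega> \<partial>P x) = (\<integral>\<omega>. h \<omega> \<partial>P x)" for h :: "'a \<Rightarrow> real"
    by (intro Bochner_Integration.integral_cong) auto
  ultimately show ?thesis by (simp add: transition_def)
qed

lemma transition_0:
  assumes [measurable]: "g \<in> borel_measurable borel"
  shows "transition 0 g x = g x"
proof -
  interpret prob_space "P x" by (rule prob_space_P)
  have "transition 0 g x = (\<integral>\<omega>. g x \<partial>P x)"
    unfolding transition_def
    by (rule integral_cong_AE) (use start[of x] in \<open>auto elim!: eventually_mono\<close>)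
  then show ?thesis by (simp add: prob_space)
qed

lemma continuous_transition:
  assumes g: "continuous_on UNIV g" and b: "\<And>y. \<bar>g y\<bar> \<le> C"
  shows "continuous_on {0..} (\<lambda>t. transition t g x)"
  unfolding continuous_on_sequentially
proof (intro allI ballI impI, elim conjE)
  fix u :: "nat \<Rightarrow> real" and a assume a: "a \<in> {0..}" and u: "\<forall>n. u n \<in> {0..}" and lim: "u \<longlonglongrightarrow> a"
  have [measurable]: "g \<in> borel_measurable borel" using g by (rule borel_measurable_continuous_onI)
  have [measurable]: "X a \<in> borel_measurable N" "X (u n) \<in> borel_measurable N" for n using a u by auto
  interpret prob_space "P x" by (rule prob_space_P)
  have "(\<lambda>n. \<integral>\<omega>. g (X (u n) \<omega>) \<partial>P x) \<longlonglongrightarrow> (\<integral>\<omega>. g (X a \<omega>) \<partial>P x)"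
  proof (rule integral_dominated_convergence[where w="\<lambda>_. C"])
    show "AE \<omega> in P x. (\<lambda>n. g (X (u n) \<omega>)) \<longlonglongrightarrow> g (X a \<omega>)"
    proof (rule AE_I2)
      fix \<omega> assume "\<omega> \<in> space (P x)"
      then have "(\<lambda>n. X (u n) \<omega>) \<longlonglongrightarrow> X a \<omega>"
        using continuous_on_tendsto_compose[OF continuous_paths[of \<omega>] lim] a u by simp
      then show "(\<lambda>n. g (X (u n) \<omega>)) \<longlonglongrightarrow> g (X a \<omega>)"
        using continuous_on_tendsto_compose[OF g] by simp
    qed
  qed (use b in auto)
  then show "((\<lambda>t. transition t g x) \<circ> u) \<longlonglongrightarrow> transition a g x"
    by (simp add: transition_def comp_def)
qed

text \<open>
  This is \<open>l\<close> times the usual resolvent: with this normalisation it is the expectation of \<open>g\<close> at an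
  independent exponential time, hence a contraction for the supremum norm.
\<close>

definition resolvent :: "real \<Rightarrow> (real \<Rightarrow> real) \<Rightarrow> real \<Rightarrow> real" where
  "resolvent l g x = (\<integral>u. transition (max 0 u) g x \<partial>exp_time l)"

lemma measurable_transition_time:
  assumes [measurable]: "g \<in> borel_measurable borel"
  shows "(\<lambda>u. transition (max 0 u) g x) \<in> borel_measurable borel"
proof -
  have "(\<lambda>u. (\<lambda>(u, x). transition (max 0 u) g x) (u, x)) \<in> borel_measurable borel"
    by measurable
  then show ?thesis by simp
qed

lemma measurable_resolvent [measurable]:
  assumes [measurable]: "g \<in> borel_measurable borel" and l: "0 < l"
  shows "resolvent l g \<in> borel_measurable borel"
proof -
  interpret prob_space "exp_time l" by (rule prob_space_exponential_density) fact
  show ?thesis unfolding resolvent_def[abs_def]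
    by (rule borel_measurable_lebesgue_integral) 
       (use measurable_compose[OF measurable_Pair[OF measurable_snd measurable_fst] measurable_transition[OF assms(1)]] 
         in \<open>simp add: case_prod_beta'\<close>)
qed

lemma integrable_resolvent:
  assumes "g \<in> borel_measurable borel" "\<And>y. \<bar>g y\<bar> \<le> C" "0 < l"
  shows "integrable (exp_time l) (\<lambda>u. transition (max 0 u) g x)"
proof -
  interpret prob_space "exp_time l" by (rule prob_space_exponential_density) fact
  show ?thesis
    by (rule integrable_const_bound[where B=C])
       (use measurable_transition_time[OF assms(1)] abs_transition_le[OF assms(1,2)] in auto)
qed

lemma abs_resolvent_le:
  assumes "g \<in> borel_measurable borel" "\<And>y. \<bar>g y\<bar> \<le> C" "0 < l"
  shows "\<bar>resolvent l g x\<bar> \<le> C"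
proof -
  interpret prob_space "exp_time l" by (rule prob_space_exponential_density) fact
  have "\<bar>resolvent l g x\<bar> \<le> (\<integral>u. \<bar>transition (max 0 u) g x\<bar> \<partial>exp_time l)"
    unfolding resolvent_def by (rule integral_abs_bound)
  also have "\<dots> \<le> (\<integral>u. C \<partial>exp_time l)"
    using integrable_resolvent[OF assms] abs_transition_le[OF assms(1,2)]
    by (intro integral_mono) auto
  finally show ?thesis by (simp add: measure_exp_time_UNIV[OF \<open>0 < l\<close>])
qed

lemma resolvent_nonneg:
  assumes "\<And>y. 0 \<le> g y"
  shows "0 \<le> resolvent l g x"
  unfolding resolvent_def transition_def using assms by (intro Bochner_Integration.integral_nonneg) auto

lemma transition_lincomb:
  assumes "f \<in> borel_measurable borel" "\<And>y. \<bar>f y\<bar> \<le> C"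
    and "g \<in> borel_measurable borel" "\<And>y. \<bar>g y\<bar> \<le> D" and "0 \<le> t"
  shows "transition t (\<lambda>y. a * f y + b * g y) x = a * transition t f x + b * transition t g x"
  unfolding transition_def
  using integrable_transition[OF assms(1,2,5)] integrable_transition[OF assms(3,4,5)] by simp

lemma resolvent_lincomb:
  assumes "f \<in> borel_measurable borel" "\<And>y. \<bar>f y\<bar> \<le> C"
    and "g \<in> borel_measurable borel" "\<And>y. \<bar>g y\<bar> \<le> D" and "0 < l"
  shows "resolvent l (\<lambda>y. a * f y + b * g y) x = a * resolvent l f x + b * resolvent l g x"
proof -
  have "transition (max 0 u) (\<lambda>y. a * f y + b * g y) x
      = a * transition (max 0 u) f x + b * transition (max 0 u) g x" for u
    by (rule transition_lincomb[OF assms(1-4)]) simp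
  then show ?thesis
    unfolding resolvent_def
    using integrable_resolvent[OF assms(1,2,5)] integrable_resolvent[OF assms(3,4,5)] by simp
qed

lemma resolvent_dominated:
  assumes [measurable]: "\<And>k. g k \<in> borel_measurable borel" "h \<in> borel_measurable borel"
    and b: "\<And>k y. \<bar>g k y\<bar> \<le> C" and lim: "\<And>y. (\<lambda>k. g k y) \<longlonglongrightarrow> h y" and l: "0 < l"
  shows "(\<lambda>k. resolvent l (g k) x) \<longlonglongrightarrow> resolvent l h x"
proof -
  interpret e: prob_space "exp_time l" by (rule prob_space_exponential_density) fact
  interpret prob_space "P x" by (rule prob_space_P)
  have t: "(\<lambda>k. transition t (g k) x) \<longlonglongrightarrow> transition t h x" if t: "0 \<le> t" for t
    unfolding transition_def
  proof (rule integral_dominated_convergence[where w="\<lambda>_. C"])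
    have [measurable]: "X t \<in> borel_measurable N" using t by simp
    show "(\<lambda>\<omega>. h (X t \<omega>)) \<in> borel_measurable (P x)" "(\<lambda>\<omega>. g k (X t \<omega>)) \<in> borel_measurable (P x)" for k
      by measurable
  qed (use b lim in auto)
  show ?thesis
    unfolding resolvent_def
  proof (rule integral_dominated_convergence[where w="\<lambda>_. C"])
    show "AE u in exp_time l. (\<lambda>k. transition (max 0 u) (g k) x) \<longlonglongrightarrow> transition (max 0 u) h x"
      by (intro AE_I2 t) simp
    show "AE u in exp_time l. norm (transition (max 0 u) (g k) x) \<le> C" for k
      using abs_transition_le[of "g k" C] b by (intro AE_I2) auto
  qed (use measurable_transition_time in auto)
qed

end

lemma C0_bounded:
  assumes "f \<in> C0" obtains C where "\<And>y. \<bar>f y\<bar> \<le> C"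
proof -
  have c: "continuous_on UNIV f" and l: "(f \<longlongrightarrow> 0) at_infinity" using assms by (auto simp: C0_def)
  from tendstoD[OF l, of 1] obtain b where b: "\<And>x. b \<le> norm x \<Longrightarrow> norm (f x) < 1"
    by (auto simp: eventually_at_infinity)
  have "compact (f ` {-\<bar>b\<bar>..\<bar>b\<bar>})"
    by (intro compact_continuous_image continuous_on_subset[OF c]) auto
  then have "bounded (f ` {-\<bar>b\<bar>..\<bar>b\<bar>})" by (rule compact_imp_bounded)
  then obtain K where "\<forall>z\<in>f ` {-\<bar>b\<bar>..\<bar>b\<bar>}. norm z \<le> K"
    unfolding bounded_iff ..
  then have K: "norm (f x) \<le> K" if "x \<in> {-\<bar>b\<bar>..\<bar>b\<bar>}" for x
    using that by (rule bspec[OF _ imageI])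
  show thesis
  proof
    fix y show "\<bar>f y\<bar> \<le> max K 1"
    proof (cases "\<bar>y\<bar> \<le> \<bar>b\<bar>")
      case True then show ?thesis using K[of y] by (simp add: abs_le_iff le_max_iff_disj)
    next
      case False
      then have "b \<le> norm y" by simp
      from b[OF this] show ?thesis by (simp add: le_max_iff_disj)
    qed
  qed
qed

context regular_diffusion
begin

text \<open>
  Uniform convergence of the difference quotients at time \<open>0\<close> propagates to every time \<open>u\<close>, since by the
  semigroup property the quotient at \<open>u\<close> is the image of the quotient at \<open>0\<close> under a contraction.
\<close>

lemma transition_difference_quotient:
  assumes f: "f \<in> borel_measurable borel" "\<And>y. \<bar>f y\<bar> \<le> C"
    and g: "g \<in> borel_measurable borel" "\<And>y. \<bar>g y\<bar> \<le> D"
    and h: "0 < h" and u: "0 \<le> u"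
    and e: "\<And>y. \<bar>(transition h f y - f y) / h - g y\<bar> \<le> e"
  shows "\<bar>(transition (u + h) f x - transition u f x) / h - transition u g x\<bar> \<le> e"
proof -
  have mT: "transition h f \<in> borel_measurable borel" using f h by (intro measurable_transition_space) auto
  have bT: "\<bar>transition h f y\<bar> \<le> C" for y using abs_transition_le[OF f] h by simp
  let ?k = "\<lambda>y. (transition h f y - f y) / h - g y"
  have iT: "integrable (P x) (\<lambda>\<omega>. transition h f (X u \<omega>))" by (rule integrable_transition[OF mT bT u])
  have if': "integrable (P x) (\<lambda>\<omega>. f (X u \<omega>))" by (rule integrable_transition[OF f u])
  have ig: "integrable (P x) (\<lambda>\<omega>. g (X u \<omega>))" by (rule integrable_transition[OF g u])
  have "transition (u + h) f x = transition u (transition h f) x"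
    by (rule transition_add[OF u _ f]) (use h in simp)
  then have "(transition (u + h) f x - transition u f x) / h - transition u g x = transition u ?k x"
    using iT if' ig by (simp add: transition_def)
  moreover have "\<bar>transition u ?k x\<bar> \<le> e"
  proof (intro abs_transition_le e u)
    note [measurable] = f(1) g(1) mT
    show "?k \<in> borel_measurable borel" by measurable
  qed
  ultimately show ?thesis by simp
qed

text \<open>
  The previous lemma controls right difference quotients, uniformly in the base point. The left
  quotient at \<open>u\<close> is the right quotient at \<open>y < u\<close>, and \<open>transition y g x\<close> is close to
  \<open>transition u g x\<close> by continuity of the paths; so the derivative is two-sided.
\<close>

lemma transition_has_derivative:
  assumes gen: "infinitesimal_generator P X f g" and u: "0 < u"
  shows "((\<lambda>t. transition t f x) has_real_derivative transition u g x) (at u)"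
proof -
  have f0: "f \<in> C0" and g0: "g \<in> C0" using gen by (auto simp: infinitesimal_generator_def)
  obtain C where C: "\<And>y. \<bar>f y\<bar> \<le> C" using C0_bounded[OF f0] by blast
  obtain D where D: "\<And>y. \<bar>g y\<bar> \<le> D" using C0_bounded[OF g0] by blast
  have fm: "f \<in> borel_measurable borel" and gm: "g \<in> borel_measurable borel"
    using f0 g0 by (auto simp: C0_def intro: borel_measurable_continuous_onI)
  have cg: "continuous_on UNIV g" using g0 by (simp add: C0_def)
  let ?F = "\<lambda>t. transition t f x" and ?G = "\<lambda>t. transition t g x"
  have contG: "continuous_on {0..} ?G" by (rule continuous_transition[OF cg D])
  show ?thesis
    unfolding has_field_derivative_iff
  proof (rule LIM_I)
    fix r :: real assume r: "0 < r"
    have "uniform_limit UNIV (\<lambda>t y. (transition t f y - f y) / t) g (at_right 0)"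
      using gen by (simp add: infinitesimal_generator_def transition_def)
    from uniform_limitD[OF this, of "r/2"] r
    obtain d1 where d1: "d1 > 0"
      and q: "\<And>t y. 0 < t \<Longrightarrow> t < d1 \<Longrightarrow> \<bar>(transition t f y - f y) / t - g y\<bar> < r/2"
      by (auto simp: eventually_at_right_field dist_real_def)
    have "\<exists>d>0. \<forall>t\<in>{0..}. dist t u < d \<longrightarrow> dist (?G t) (?G u) < r/2"
      using contG u r unfolding continuous_on_iff by (meson atLeast_iff half_gt_zero less_imp_le)
    then obtain d2 where d2: "d2 > 0" "\<And>t. 0 \<le> t \<Longrightarrow> \<bar>t - u\<bar> < d2 \<Longrightarrow> \<bar>?G t - ?G u\<bar> < r/2"
      by (auto simp: dist_real_def)
    show "\<exists>s>0. \<forall>y. y \<noteq> u \<and> norm (y - u) < s \<longrightarrow> norm ((?F y - ?F u) / (y - u) - ?G u) < r"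
    proof (intro exI[of _ "min (min d1 d2) u"] conjI allI impI)
      show "0 < min (min d1 d2) u" using d1 d2 u by simp
      fix y assume y: "y \<noteq> u \<and> norm (y - u) < min (min d1 d2) u"
      then have yp: "0 < y" by auto
      have main: "\<bar>(?F (v + h) - ?F v) / h - ?G v\<bar> \<le> r/2"
        if "0 < h" "h < d1" "0 \<le> v" for v h
        by (rule transition_difference_quotient[OF fm C gm D that(1,3)]) (use q[OF that(1,2)] in \<open>auto intro: less_imp_le\<close>)
      show "norm ((?F y - ?F u) / (y - u) - ?G u) < r"
      proof (cases "u < y")
        case True
        then show ?thesis using main[of "y - u" u] y u r by auto
      next
        case False
        then have "y < u" using y by auto
        then have "\<bar>(?F u - ?F y) / (u - y) - ?G y\<bar> \<le> r/2" using main[of "u - y" y] y yp by auto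
        moreover have "\<bar>?G y - ?G u\<bar> < r/2" using d2(2)[of y] y yp by auto
        moreover have "(?F y - ?F u) / (y - u) = (?F u - ?F y) / (u - y)"
          by (metis minus_diff_eq minus_divide_divide)
        ultimately show ?thesis by (simp only: real_norm_def)
      qed
    qed
  qed
qed

text \<open>
  The resolvent inverts \<open>1 - (generator) / l\<close> from the left: integrate the derivative of
  \<open>- exp (- l * t) * transition t f x\<close> over \<open>(0,\<infinity>)\<close>.
\<close>

lemma resolvent_generator:
  assumes gen: "infinitesimal_generator P X f g" and l: "0 < l"
  shows "resolvent l (\<lambda>y. f y - g y / l) x = f x"
proof -
  have f0: "f \<in> C0" and g0: "g \<in> C0" using gen by (auto simp: infinitesimal_generator_def)
  obtain C where C: "\<And>y. \<bar>f y\<bar> \<le> C" using C0_bounded[OF f0] by blast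
  obtain D where D: "\<And>y. \<bar>g y\<bar> \<le> D" using C0_bounded[OF g0] by blast
  have fm: "f \<in> borel_measurable borel" and gm: "g \<in> borel_measurable borel"
    using f0 g0 by (auto simp: C0_def intro: borel_measurable_continuous_onI)
  have cf: "continuous_on UNIV f" and cg: "continuous_on UNIV g" using f0 g0 by (auto simp: C0_def)
  let ?F = "\<lambda>t. transition t f x" and ?G = "\<lambda>t. transition t g x"
  have contF: "continuous_on {0..} ?F" by (rule continuous_transition[OF cf C])
  have contG: "continuous_on {0..} ?G" by (rule continuous_transition[OF cg D])
  define H where "H t = - exp (- l * t) * ?F t" for t
  define h where "h t = exp (- l * t) * (l * ?F t - ?G t)" for t
  have cont_h: "continuous_on {0..} h"
    unfolding h_def by (intro continuous_intros contF contG)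
  have bF: "\<bar>?F t\<bar> \<le> C" if "0 \<le> t" for t using abs_transition_le[OF fm C that] .
  have bG: "\<bar>?G t\<bar> \<le> D" if "0 \<le> t" for t using abs_transition_le[OF gm D that] .
  have dens: "resolvent l (\<lambda>y. f y - g y / l) x = (\<integral>t. indicator {0..} t * h t \<partial>lborel)"
  proof -
    have "resolvent l (\<lambda>y. f y - g y / l) x = (\<integral>u. ?F (max 0 u) - ?G (max 0 u) / l \<partial>exp_time l)"
      unfolding resolvent_def
      using transition_lincomb[OF fm C gm D, of "max 0 u" 1 "-1/l" x for u]
      by (intro Bochner_Integration.integral_cong) auto
    also have "\<dots> = (\<integral>u. exponential_density l u * (?F (max 0 u) - ?G (max 0 u) / l) \<partial>lborel)"
      using measurable_transition_time[OF fm] measurable_transition_time[OF gm] l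
      by (subst integral_density) auto
    also have "\<dots> = (\<integral>t. indicator {0..} t * h t \<partial>lborel)"
      using l by (intro Bochner_Integration.integral_cong)
        (auto simp: h_def exponential_density_def algebra_simps split: split_indicator)
    finally show ?thesis .
  qed
  have int_h: "integrable lborel (\<lambda>t. indicator {0..} t * h t)"
  proof (rule Bochner_Integration.integrable_bound[where f="\<lambda>t. ((l * C + D) / l) * exponential_density l t"])
    interpret prob_space "exp_time l" by (rule prob_space_exponential_density) fact
    have "integrable (exp_time l) (\<lambda>_. 1::real)" by simp
    then have "integrable lborel (\<lambda>t. exponential_density l t *\<^sub>R (1::real))"
      using l by (subst (asm) integrable_density) auto
    then show "integrable lborel (\<lambda>t. ((l * C + D) / l) * exponential_density l t)" by simp
    show "(\<lambda>t. indicator {0..} t * h t) \<in> borel_measurable lborel"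
      using borel_measurable_continuous_on_indicator[OF _ cont_h] by simp
    show "AE t in lborel. norm (indicator {0..} t * h t) \<le> norm (((l * C + D) / l) * exponential_density l t)"
    proof (rule AE_I2)
      fix t
      show "norm (indicator {0..} t * h t) \<le> norm (((l * C + D) / l) * exponential_density l t)"
      proof (cases "0 \<le> t")
        case True
        have "\<bar>l * ?F t - ?G t\<bar> \<le> l * C + D"
        proof -
          have "\<bar>l * ?F t\<bar> \<le> l * C" using bF[OF True] l by (simp add: abs_mult)
          then show ?thesis using bG[OF True] by linarith
        qed
        then have "\<bar>h t\<bar> \<le> exp (- l * t) * (l * C + D)"
          unfolding h_def abs_mult by (simp add: mult_left_mono)
        also have "\<dots> = ((l * C + D) / l) * exponential_density l t"
          using l True by (simp add: exponential_density_def mult.commute)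
        also have "\<dots> \<le> norm \<dots>" by (simp only: real_norm_def abs_ge_self)
        finally show ?thesis using True by simp
      qed simp
    qed
  qed
  have ein: "einterval 0 \<infinity> = {0<..}" by (auto simp: einterval_def)
  have "(LBINT t=0..\<infinity>. h t) = 0 - (- f x)"
  proof (rule interval_integral_FTC_integrable[where F=H])
    fix t assume "(0::ereal) < ereal t"
    then have t: "0 < t" by simp
    have "(H has_real_derivative h t) (at t)"
      unfolding H_def h_def
      by (rule derivative_eq_intros transition_has_derivative[OF gen t] refl)+ (simp add: algebra_simps)
    then show "(H has_vector_derivative h t) (at t)" by (simp add: has_real_derivative_iff_has_vector_derivative)
    have "continuous_on {0<..} h" using cont_h by (rule continuous_on_subset) auto
    then show "isCont h t" using t by (simp add: continuous_on_eq_continuous_at)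
  next
    have "set_integrable lborel {0..} h" using int_h by (simp add: set_integrable_def)
    then show "set_integrable lborel (einterval 0 \<infinity>) h"
      unfolding ein by (rule set_integrable_subset) auto
    have "continuous_on {0..} H" unfolding H_def by (intro continuous_intros contF)
    then have "(H \<longlongrightarrow> H 0) (at 0 within {0..})" by (auto simp: continuous_on_def)
    then have "(H \<longlongrightarrow> H 0) (at_right 0)" by (rule tendsto_within_subset) auto
    moreover have "H 0 = - f x" using transition_0[OF fm] by (simp add: H_def)
    ultimately show "((H \<circ> real_of_ereal) \<longlongrightarrow> - f x) (at_right 0)"
      by (simp add: zero_ereal_def ereal_tendsto_simps1)
    have "(H \<longlongrightarrow> 0) at_top"
    proof (rule Lim_null_comparison)
      show "\<forall>\<^sub>F t in at_top. norm (H t) \<le> C * exp (- l * t)"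
        using eventually_ge_at_top[of 0]
      proof eventually_elim
        case (elim t)
        then show ?case using mult_left_mono[OF bF[OF elim], of "exp (- l * t)"]
          by (simp add: H_def abs_mult mult.commute)
      qed
      have "((\<lambda>t. exp (- l * t)) \<longlongrightarrow> 0) at_top" using l
        by (intro filterlim_compose[OF exp_at_bot])
          (simp add: filterlim_uminus_at_bot filterlim_tendsto_pos_mult_at_top[OF tendsto_const] filterlim_ident)
      then show "((\<lambda>t. C * exp (- l * t)) \<longlongrightarrow> 0) at_top"
        using tendsto_mult_right_zero by blast
    qed
    then show "((H \<circ> real_of_ereal) \<longlongrightarrow> 0) (at_left \<infinity>)"
      by (simp add: ereal_tendsto_simps1)
  qed simp
  moreover have "(LBINT t=0..\<infinity>. h t) = (LBINT t:{0<..}. h t)"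
    by (simp add: interval_lebesgue_integral_def ein)
  moreover have "(LBINT t:{0<..}. h t) = (\<integral>t. indicator {0..} t * h t \<partial>lborel)"
    unfolding set_lebesgue_integral_def
  proof (rule integral_cong_AE)
    show "AE t in lborel. indicator {0<..} t *\<^sub>R h t = indicator {0..} t * h t"
      using AE_lborel_singleton[of 0] by eventually_elim (auto split: split_indicator)
    show "(\<lambda>t. indicator {0..} t * h t) \<in> borel_measurable lborel"
      using int_h by auto
    have "continuous_on {0<..} h" using cont_h by (rule continuous_on_subset) auto
    then show "(\<lambda>t. indicator {0<..} t *\<^sub>R h t) \<in> borel_measurable lborel"
      using borel_measurable_continuous_on_indicator[of "{0<..}" h] by simp
  qed
  ultimately show ?thesis using dens by simp
qed

end

section \<open>Functions in the domain of the generator\<close>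

lemma C0_lincomb:
  assumes "f \<in> C0" "g \<in> C0" shows "(\<lambda>x. a * f x + b * g x) \<in> C0"
proof -
  have "((\<lambda>x. a * f x + b * g x) \<longlongrightarrow> a * 0 + b * 0) at_infinity"
    using assms by (intro tendsto_intros) (auto simp: C0_def)
  then show ?thesis using assms by (auto simp: C0_def intro!: continuous_intros)
qed

lemma C0_shift:
  assumes "f \<in> C0" shows "(\<lambda>x. f (x + d)) \<in> C0"
proof -
  have "filterlim (\<lambda>x::real. x + d) at_infinity at_infinity"
    unfolding filterlim_at_infinity[OF order_refl]
  proof (intro allI impI)
    fix r :: real
    have "\<forall>x. r + \<bar>d\<bar> \<le> norm x \<longrightarrow> r \<le> norm (x + d)"
      unfolding real_norm_def by arith
    then show "\<forall>\<^sub>F x in at_infinity. r \<le> norm (x + d)"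
      unfolding eventually_at_infinity by (rule exI)
  qed
  then have "((\<lambda>x. f (x + d)) \<longlongrightarrow> 0) at_infinity"
    using assms by (auto simp: C0_def intro: filterlim_compose)
  moreover have "continuous_on UNIV (\<lambda>x. f (x + d))"
    using assms by (auto simp: C0_def intro!: continuous_on_compose2[of UNIV f] continuous_intros)
  ultimately show ?thesis by (simp add: C0_def)
qed

lemma C0_exp_bound:
  fixes f :: "real \<Rightarrow> real"
  assumes "continuous_on UNIV f" "0 < c" "\<And>x. \<bar>f x\<bar> \<le> M * exp (- c * \<bar>x\<bar>)"
  shows "f \<in> C0"
proof -
  have "((\<lambda>x::real. exp (- c * \<bar>x\<bar>)) \<longlongrightarrow> 0) at_infinity"
  proof (rule filterlim_compose[OF exp_at_bot])
    have "filterlim (\<lambda>x::real. c * norm x) at_top at_infinity"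
      by (rule filterlim_tendsto_pos_mult_at_top[OF tendsto_const \<open>0 < c\<close> filterlim_norm_at_top])
    then show "filterlim (\<lambda>x::real. - c * \<bar>x\<bar>) at_bot at_infinity"
      by (simp add: filterlim_uminus_at_bot)
  qed
  then have "((\<lambda>x::real. M * exp (- c * \<bar>x\<bar>)) \<longlongrightarrow> M * 0) at_infinity"
    by (intro tendsto_mult tendsto_const)
  then have "((\<lambda>x::real. M * exp (- c * \<bar>x\<bar>)) \<longlongrightarrow> 0) at_infinity" by simp
  moreover have "\<forall>\<^sub>F x in at_infinity. norm (f x) \<le> M * exp (- c * \<bar>x\<bar>)"
    by (rule always_eventually) (simp only: real_norm_def assms(3) simp_thms)
  ultimately have "(f \<longlongrightarrow> 0) at_infinity" by (rule Lim_null_comparison[rotated])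
  then show ?thesis using assms(1) by (simp add: C0_def)
qed

text \<open>
  At the gluing point the value from the right is taken, which is also the convention of the operator
  \<open>dm_dS\<close>.
\<close>

lemma right_derivative_glued:
  fixes f1 f2 d1 d2 :: "real \<Rightarrow> real"
  assumes d1: "\<And>x. (f1 has_real_derivative d1 x) (at x)"
    and d2: "\<And>x. (f2 has_real_derivative d2 x) (at x)"
    and f: "\<And>x. f x = (if 0 \<le> x then f1 x else f2 x)"
  shows "((\<lambda>y. (f y - f x) / (y - x)) \<longlongrightarrow> (if 0 \<le> x then d1 x else d2 x)) (at_right x)"
proof (cases "0 \<le> x")
  case True
  have "((\<lambda>y. (f1 y - f1 x) / (y - x)) \<longlongrightarrow> d1 x) (at_right x)"
    using has_field_derivative_at_within[OF d1, of x "{x<..}"] by (simp add: has_field_derivative_iff)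
  moreover have "\<forall>\<^sub>F y in at_right x. (f1 y - f1 x) / (y - x) = (f y - f x) / (y - x)"
    using True by (auto simp: eventually_at_filter f)
  ultimately show ?thesis using True by (simp add: Lim_transform_eventually)
next
  case False
  have "((\<lambda>y. (f2 y - f2 x) / (y - x)) \<longlongrightarrow> d2 x) (at_right x)"
    using has_field_derivative_at_within[OF d2, of x "{x<..}"] by (simp add: has_field_derivative_iff)
  moreover have "\<forall>\<^sub>F y in at_right x. (f2 y - f2 x) / (y - x) = (f y - f x) / (y - x)"
    using False by (auto simp: eventually_at_right_field f intro!: exI[of _ 0])
  ultimately show ?thesis using False by (simp add: Lim_transform_eventually)
qed

lemma skew_scale_diff:
  assumes "0 < \<beta>" "\<beta> < 1"
  shows "0 \<le> x \<Longrightarrow> 0 \<le> y \<Longrightarrow> skew_scale \<beta> y - skew_scale \<beta> x = (y - x) / (2 * \<beta>)"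
    and "x < 0 \<Longrightarrow> y < 0 \<Longrightarrow> skew_scale \<beta> y - skew_scale \<beta> x = (y - x) / (2 * (1 - \<beta>))"
  by (auto simp: skew_scale_def diff_divide_distrib)


text \<open>
  Functions smooth on each half-line belong to the domain of \<open>d/dm d/dS\<close> when the derivative
  with respect to \<open>S\<close> is continuous at \<open>0\<close>, because \<open>m\<close> has no atom there; this is the hypothesis
  \<open>flux\<close>. Off \<open>0\<close> the densities of \<open>S\<close> and \<open>m\<close> multiply to \<open>2\<close>, so the operator is half the second
  derivative on both sides.
\<close>

lemma dm_dS_skew:
  assumes \<beta>: "0 < \<beta>" "\<beta> < 1"
    and d1: "\<And>x. (f1 has_real_derivative d1 x) (at x)"
    and d2: "\<And>x. (f2 has_real_derivative d2 x) (at x)"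
    and e1: "\<And>x. (d1 has_real_derivative e1 x) (at x)"
    and e2: "\<And>x. (d2 has_real_derivative e2 x) (at x)"
    and f: "\<And>x. f x = (if 0 \<le> x then f1 x else f2 x)"
    and g: "\<And>x. x \<noteq> 0 \<Longrightarrow> g x = (if 0 \<le> x then e1 x else e2 x) / 2"
    and flux: "\<beta> * d1 0 = (1 - \<beta>) * d2 0"
    and cont: "continuous_on UNIV g"
  shows "dm_dS (skew_speed \<beta>) (skew_scale \<beta>) f g"
  unfolding dm_dS_def
proof (intro exI conjI allI impI)
  define h where "h x = (if 0 \<le> x then 2 * \<beta> * d1 x else 2 * (1 - \<beta>) * d2 x)" for x
  define \<rho> where "\<rho> x = (if 0 < x then 4 * \<beta> else if x < 0 then 4 * (1 - \<beta>) else 0)" for x :: real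
  show "((\<lambda>y. (f y - f x) / (skew_scale \<beta> y - skew_scale \<beta> x)) \<longlongrightarrow> h x) (at_right x)" for x
  proof (cases "0 \<le> x")
    case True
    have "((\<lambda>y. 2 * \<beta> * ((f y - f x) / (y - x))) \<longlongrightarrow> 2 * \<beta> * d1 x) (at_right x)"
      using right_derivative_glued[OF d1 d2 f, of x] True by (intro tendsto_mult tendsto_const) simp
    moreover have "\<forall>\<^sub>F y in at_right x. 2 * \<beta> * ((f y - f x) / (y - x)) = (f y - f x) / (skew_scale \<beta> y - skew_scale \<beta> x)"
      using True skew_scale_diff(1)[OF \<beta>, of x] by (auto simp: eventually_at_filter)
    ultimately show ?thesis using True by (simp add: h_def Lim_transform_eventually)
  next
    case False
    have "((\<lambda>y. 2 * (1 - \<beta>) * ((f y - f x) / (y - x))) \<longlongrightarrow> 2 * (1 - \<beta>) * d2 x) (at_right x)"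
      using right_derivative_glued[OF d1 d2 f, of x] False by (intro tendsto_mult tendsto_const) simp
    moreover have "\<forall>\<^sub>F y in at_right x. 2 * (1 - \<beta>) * ((f y - f x) / (y - x)) = (f y - f x) / (skew_scale \<beta> y - skew_scale \<beta> x)"
      using False skew_scale_diff(2)[OF \<beta>, of x] by (auto simp: eventually_at_right_field intro!: exI[of _ 0])
    ultimately show ?thesis using False by (simp add: h_def Lim_transform_eventually)
  qed
  have [measurable]: "g \<in> borel_measurable borel" using cont by (rule borel_measurable_continuous_onI)
  have [measurable]: "\<rho> \<in> borel_measurable borel" unfolding \<rho>_def by measurable
  \<comment> \<open>continuity of \<open>h\<close> lets the fundamental theorem of calculus pass over the point \<open>0\<close>\<close>
  have ch: "continuous_on UNIV h"
  proof -
    have "continuous_on ({0..} \<union> {..0}) (\<lambda>x. if x \<in> {0..} then 2 * \<beta> * d1 x else 2 * (1 - \<beta>) * d2 x)"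
    proof (rule continuous_on_If)
      have c1: "continuous_on UNIV d1" and c2: "continuous_on UNIV d2"
        using e1 e2 by (auto intro!: continuous_at_imp_continuous_on DERIV_isCont)
      show "continuous_on {0..} (\<lambda>x. 2 * \<beta> * d1 x)" "continuous_on {..0} (\<lambda>x. 2 * (1 - \<beta>) * d2 x)"
        by (intro continuous_intros continuous_on_subset[OF c1] continuous_on_subset[OF c2]; simp)+
      fix x :: real assume "x \<in> {..0}" "x \<in> {0..}"
      then have "x = 0" by auto
      moreover have "2 * \<beta> * d1 0 = 2 * (1 - \<beta>) * d2 0"
        using flux by (simp only: mult.assoc)
      ultimately show "2 * \<beta> * d1 x = 2 * (1 - \<beta>) * d2 x" by (simp only:)
    qed simp_all
    moreover have "{0..} \<union> {..0} = (UNIV :: real set)" by auto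
    ultimately show ?thesis by (simp add: h_def[abs_def])
  qed
  have dh: "(h has_real_derivative \<rho> x * g x) (at x)" if "x \<noteq> 0" for x
  proof (cases "0 < x")
    case True
    have "((\<lambda>x. 2 * \<beta> * d1 x) has_real_derivative 2 * \<beta> * e1 x) (at x)"
      by (rule DERIV_cmult[OF e1])
    then have "(h has_real_derivative 2 * \<beta> * e1 x) (at x)"
      by (rule has_field_derivative_transform_within_open[where S="{0<..}"]) (use True in \<open>auto simp: h_def\<close>)
    moreover have "2 * \<beta> * e1 x = \<rho> x * g x" using True g[OF that] by (simp add: \<rho>_def)
    ultimately show ?thesis by (simp only:)
  next
    case False
    then have x: "x < 0" using that by simp
    have "((\<lambda>x. 2 * (1 - \<beta>) * d2 x) has_real_derivative 2 * (1 - \<beta>) * e2 x) (at x)"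
      by (rule DERIV_cmult[OF e2])
    then have "(h has_real_derivative 2 * (1 - \<beta>) * e2 x) (at x)"
      by (rule has_field_derivative_transform_within_open[where S="{..<0}"]) (use x in \<open>auto simp: h_def\<close>)
    moreover have "e2 x = 2 * g x" using x g[OF that] by simp
    then have "2 * (1 - \<beta>) * e2 x = \<rho> x * g x" using x by (simp add: \<rho>_def)
    ultimately show ?thesis by (simp only:)
  qed
  fix a b :: real assume ab: "a < b"
  have hi: "((\<lambda>x. \<rho> x * g x) has_integral (h b - h a)) {a..b}"
  proof (rule fundamental_theorem_of_calculus_interior_strong[of "{0}"])
    show "(h has_vector_derivative \<rho> x * g x) (at x)" if "x \<in> {a<..<b} - {0}" for x
      using dh[of x] that by (simp add: has_real_derivative_iff_has_vector_derivative)
    show "continuous_on {a..b} h" using ch by (rule continuous_on_subset) simp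
  qed (use ab in auto)
  have "compact (g ` {a..b})"
    by (intro compact_continuous_image continuous_on_subset[OF cont]) auto
  then have "bounded (g ` {a..b})" by (rule compact_imp_bounded)
  then obtain K where "\<forall>z\<in>g ` {a..b}. norm z \<le> K" unfolding bounded_iff ..
  then have K: "norm (g x) \<le> K" if "x \<in> {a..b}" for x using that by (rule bspec[OF _ imageI])
  have int: "set_integrable lborel {a..b} (\<lambda>x. \<rho> x * g x)"
    unfolding set_integrable_def
  proof (rule Bochner_Integration.integrable_bound[where f="\<lambda>x. indicator {a..b} x *\<^sub>R (4 * K)"])
    show "integrable lborel (\<lambda>x. indicator {a..b} x *\<^sub>R (4 * K))"
      by (intro integrable_scaleR_left integrable_real_indicator) (auto simp: emeasure_lborel_Icc_eq)
    show "AE x in lborel. norm (indicat_real {a..b} x *\<^sub>R (\<rho> x * g x)) \<le> norm (indicat_real {a..b} x *\<^sub>R (4 * K))"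
    proof (rule AE_I2)
      fix x
      have "norm (\<rho> x * g x) \<le> 4 * K" if "x \<in> {a..b}"
        unfolding norm_mult using K[OF that] \<beta> by (intro mult_mono) (auto simp: \<rho>_def)
      then show "norm (indicat_real {a..b} x *\<^sub>R (\<rho> x * g x)) \<le> norm (indicat_real {a..b} x *\<^sub>R (4 * K))"
        by (auto split: split_indicator)
    qed
  qed measurable
  have "(LINT x:{a<..b}|skew_speed \<beta>. g x) = (\<integral>x. \<rho> x * (indicator {a<..b} x * g x) \<partial>lborel)"
    unfolding set_lebesgue_integral_def skew_speed_def \<rho>_def[symmetric]
    by (subst integral_density) (use \<beta> in \<open>auto simp: \<rho>_def\<close>)
  also have "\<dots> = (LINT x:{a..b}|lborel. \<rho> x * g x)"
    unfolding set_lebesgue_integral_def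
  proof (rule integral_cong_AE)
    show "AE x in lborel. \<rho> x * (indicator {a<..b} x * g x) = indicator {a..b} x *\<^sub>R (\<rho> x * g x)"
      using AE_lborel_singleton[of a] by eventually_elim (auto split: split_indicator)
  qed measurable
  also have "\<dots> = integral {a..b} (\<lambda>x. \<rho> x * g x)"
    by (rule set_borel_integral_eq_integral(2)[OF int])
  also have "\<dots> = h b - h a" using hi by (rule integral_unique)
  finally show "h b - h a = (LINT x:{a<..b}|skew_speed \<beta>. g x)" ..
qed

section \<open>The resolvent of skew Brownian motion\<close>

locale skew_BM = diffusion_speed_scale N F P X "skew_speed \<beta>" "skew_scale \<beta>"
  for N :: "'a measure" and F P X \<beta> +
  assumes \<beta>: "0 < \<beta>" "\<beta> < 1"
begin

text \<open>
  The function \<open>E x = exp (- s * |x|)\<close> satisfies \<open>E - E'' / (2 * l) = 0\<close> off \<open>0\<close> and has a kink at \<open>0\<close>.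
  Adding \<open>\<kappa> * E\<close> to \<open>B\<close> therefore leaves \<open>B - B'' / (2 * l)\<close> unchanged off \<open>0\<close>, and
  \<open>\<kappa>\<close> is the one value for which the sum satisfies the flux condition
  \<open>\<beta> * (B' 0 - \<kappa> * s) = (1 - \<beta>) * (B' 0 + \<kappa> * s)\<close>.
\<close>

lemma resolvent_C2:
  assumes B1: "\<And>x. (B has_real_derivative B' x) (at x)"
    and B2: "\<And>x. (B' has_real_derivative B'' x) (at x)"
    and C0: "B \<in> C0" "B'' \<in> C0" and l: "0 < l"
  shows "resolvent l (\<lambda>y. B y - B'' y / (2 * l)) x
       = B x + (2 * \<beta> - 1) * B' 0 / sqrt (2 * l) * exp (- sqrt (2 * l) * \<bar>x\<bar>)"
proof -
  define s where "s = sqrt (2 * l)"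
  have s: "0 < s" "s * s = 2 * l" using l by (auto simp: s_def)
  define \<kappa> where "\<kappa> = (2 * \<beta> - 1) * B' 0 / s"
  have \<kappa>s: "\<kappa> * s = (2 * \<beta> - 1) * B' 0" using s by (simp add: \<kappa>_def)
  define E where "E x = exp (- s * \<bar>x\<bar>)" for x
  define f where "f x = 1 * B x + \<kappa> * E x" for x
  define g where "g x = (1/2) * B'' x + (l * \<kappa>) * E x" for x
  have E0: "E \<in> C0"
    unfolding E_def by (rule C0_exp_bound[where c=s and M=1]) (use s in \<open>auto intro!: continuous_intros\<close>)
  have f0: "f \<in> C0" unfolding f_def by (intro C0_lincomb C0 E0)
  have g0: "g \<in> C0" unfolding g_def by (intro C0_lincomb C0 E0)
  have "dm_dS (skew_speed \<beta>) (skew_scale \<beta>) f g"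
  proof (rule dm_dS_skew[OF \<beta>,
      where ?f1.0="\<lambda>x. B x + \<kappa> * exp (- s * x)" and ?d1.0="\<lambda>x. B' x - \<kappa> * s * exp (- s * x)"
      and ?e1.0="\<lambda>x. B'' x + \<kappa> * s * s * exp (- s * x)"
      and ?f2.0="\<lambda>x. B x + \<kappa> * exp (s * x)" and ?d2.0="\<lambda>x. B' x + \<kappa> * s * exp (s * x)"
      and ?e2.0="\<lambda>x. B'' x + \<kappa> * s * s * exp (s * x)"])
    fix x
    show "((\<lambda>x. B x + \<kappa> * exp (- s * x)) has_real_derivative B' x - \<kappa> * s * exp (- s * x)) (at x)"
      "((\<lambda>x. B x + \<kappa> * exp (s * x)) has_real_derivative B' x + \<kappa> * s * exp (s * x)) (at x)"
      "((\<lambda>x. B' x - \<kappa> * s * exp (- s * x)) has_real_derivative B'' x + \<kappa> * s * s * exp (- s * x)) (at x)"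
      "((\<lambda>x. B' x + \<kappa> * s * exp (s * x)) has_real_derivative B'' x + \<kappa> * s * s * exp (s * x)) (at x)"
      by (rule derivative_eq_intros B1 B2 refl | simp)+
    show "f x = (if 0 \<le> x then B x + \<kappa> * exp (- s * x) else B x + \<kappa> * exp (s * x))"
      by (simp add: f_def E_def)
    have "\<kappa> * s * s = \<kappa> * (s * s)" by (simp only: mult.assoc)
    also have "\<dots> = 2 * (l * \<kappa>)" by (simp only: s(2) ac_simps)
    finally have ks: "\<kappa> * s * s = 2 * (l * \<kappa>)" .
    show "g x = (if 0 \<le> x then B'' x + \<kappa> * s * s * exp (- s * x) else B'' x + \<kappa> * s * s * exp (s * x)) / 2"
      unfolding ks by (simp add: g_def E_def add_divide_distrib)
  next
    show "\<beta> * (B' 0 - \<kappa> * s * exp (- s * 0)) = (1 - \<beta>) * (B' 0 + \<kappa> * s * exp (s * 0))"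
      unfolding \<kappa>s by (simp add: algebra_simps)
    show "continuous_on UNIV g" using g0 by (simp add: C0_def)
  qed
  then have "infinitesimal_generator P X f g" using f0 g0 by (simp add: generator)
  from resolvent_generator[OF this l, of x]
  have "resolvent l (\<lambda>y. f y - g y / l) x = f x" .
  moreover have "f y - g y / l = B y - B'' y / (2 * l)" for y
    using l by (simp add: f_def g_def field_simps)
  ultimately have "resolvent l (\<lambda>y. B y - B'' y / (2 * l)) x = f x" by (simp only:)
  then show ?thesis by (simp add: f_def E_def \<kappa>_def s_def)
qed

end

lemma exists_antiderivative:
  fixes B :: "real \<Rightarrow> real"
  assumes "continuous_on UNIV B"
  obtains A where "\<And>x. (A has_real_derivative B x) (at x)"
proof
  fix x :: real
  define b where "b = \<bar>x\<bar> + 1"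
  have "((\<lambda>u. LBINT y=ereal 0..ereal u. B y) has_vector_derivative B x) (at x within {-b..b})"
    by (rule interval_integral_FTC2) (use assms in \<open>auto simp: b_def intro: continuous_on_subset\<close>)
  moreover have "at x within {-b..b} = at x"
    by (rule at_within_interior) (auto simp: b_def abs_if)
  ultimately show "((\<lambda>u. LBINT y=ereal 0..ereal u. B y) has_real_derivative B x) (at x)"
    by (simp add: has_real_derivative_iff_has_vector_derivative)
qed

text \<open>
  The quotient is the mean of \<open>B\<close> over \<open>[x, x + d]\<close>, so by the mean value theorem it is a value of
  \<open>B\<close> near \<open>x\<close> and inherits decay and bounds.
\<close>

lemma C0_average:
  assumes A: "\<And>x. (A has_real_derivative B x) (at x)" and B: "B \<in> C0" and d: "0 < d"
  shows "(\<lambda>x. (A (x + d) - A x) / d) \<in> C0"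
    and "(\<And>y. \<bar>B y\<bar> \<le> C) \<Longrightarrow> \<bar>(A (x + d) - A x) / d\<bar> \<le> C"
proof -
  have mvt: "\<exists>z. x < z \<and> z < x + d \<and> (A (x + d) - A x) / d = B z" for x
  proof -
    obtain z where "x < z" "z < x + d" "A (x + d) - A x = (x + d - x) * B z"
      using MVT2[of x "x + d" A B] A d by auto
    then show ?thesis using d by (intro exI[of _ z]) simp
  qed
  show "\<bar>(A (x + d) - A x) / d\<bar> \<le> C" if "\<And>y. \<bar>B y\<bar> \<le> C"
    using mvt[of x] that by metis
  have cA: "continuous_on UNIV A"
    by (intro continuous_at_imp_continuous_on ballI DERIV_isCont[OF A])
  have "continuous_on UNIV (\<lambda>x. A (x + d))"
    by (rule continuous_on_compose2[OF cA]) (auto intro: continuous_intros)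
  then have "continuous_on UNIV (\<lambda>x. (A (x + d) - A x) / d)"
    using d by (intro continuous_on_divide continuous_on_diff continuous_on_const cA) auto
  moreover have "((\<lambda>x. (A (x + d) - A x) / d) \<longlongrightarrow> 0) at_infinity"
  proof (rule tendstoI)
    fix e :: real assume "0 < e"
    moreover have "(B \<longlongrightarrow> 0) at_infinity" using B by (simp add: C0_def)
    ultimately have "\<forall>\<^sub>F x in at_infinity. dist (B x) 0 < e" by (rule tendstoD[rotated])
    then obtain b where b: "\<And>x. b \<le> norm x \<Longrightarrow> dist (B x) 0 < e"
      unfolding eventually_at_infinity by blast
    show "\<forall>\<^sub>F x in at_infinity. dist ((A (x + d) - A x) / d) 0 < e"
      unfolding eventually_at_infinity
    proof (intro exI allI impI)
      fix x :: real assume x: "b + d \<le> norm x"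
      obtain z where z: "x < z" "z < x + d" "(A (x + d) - A x) / d = B z" using mvt by blast
      have "b \<le> norm z" using x z unfolding real_norm_def by arith
      then show "dist ((A (x + d) - A x) / d) 0 < e" unfolding z(3) by (rule b)
    qed
  qed
  ultimately show "(\<lambda>x. (A (x + d) - A x) / d) \<in> C0" by (simp add: C0_def)
qed

context skew_BM
begin

text \<open>
  The means of \<open>B\<close> over \<open>[x, x + d]\<close> are \<open>C^2\<close>, with second derivative
  \<open>(B' (x + d) - B' x) / d\<close>. As \<open>d\<close> decreases to \<open>0\<close> these quotients stay below the Lipschitz constant and
  converge at every point to the right derivative of \<open>B'\<close>. Dominated convergence then passes to
  the limit in \<open>resolvent_C2\<close>. Taking means to the right only is what keeps the limit pointwise, also at
  a jump of \<open>B''\<close>.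
\<close>

lemma resolvent_C1:
  assumes B1: "\<And>x. (B has_real_derivative B' x) (at x)"
    and C0: "B \<in> C0" "B' \<in> C0"
    and lip: "\<And>x y. \<bar>B' x - B' y\<bar> \<le> L * \<bar>x - y\<bar>"
    and B2: "\<And>x. ((\<lambda>y. (B' y - B' x) / (y - x)) \<longlongrightarrow> B'' x) (at_right x)"
    and m: "B'' \<in> borel_measurable borel" and l: "0 < l"
  shows "resolvent l (\<lambda>y. B y - B'' y / (2 * l)) x
       = B x + (2 * \<beta> - 1) * B' 0 / sqrt (2 * l) * exp (- sqrt (2 * l) * \<bar>x\<bar>)"
proof -
  obtain A where A: "\<And>x. (A has_real_derivative B x) (at x)"
    using exists_antiderivative[of B] C0(1) by (auto simp: C0_def)
  obtain C where C: "\<And>y. \<bar>B y\<bar> \<le> C" using C0_bounded[OF C0(1)] by blast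
  define d where "d k = 1 / real (Suc k)" for k
  have d: "0 < d k" for k by (simp add: d_def)
  have d0: "d \<longlonglongrightarrow> 0" unfolding d_def by (rule LIMSEQ_Suc[OF lim_1_over_n])
  define q where "q f k x = (f (x + d k) - f x) / d k" for f :: "real \<Rightarrow> real" and k x
  have q_lim: "(\<lambda>k. q f k x) \<longlonglongrightarrow> c"
    if "((\<lambda>y. (f y - f x) / (y - x)) \<longlongrightarrow> c) (at_right x)" for f c x
  proof -
    have "filterlim (\<lambda>k. x + d k) (at_right x) sequentially"
      unfolding filterlim_at
    proof
      show "\<forall>\<^sub>F k in sequentially. x + d k \<in> {x<..} \<and> x + d k \<noteq> x"
        using d by (intro always_eventually allI) (simp add: less_imp_neq[symmetric])
      show "(\<lambda>k. x + d k) \<longlonglongrightarrow> x" using tendsto_add[OF tendsto_const d0, of x] by simp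
    qed
    from filterlim_compose[OF that this] show ?thesis by (simp add: q_def)
  qed
  have q_deriv: "(\<lambda>k. q f k x) \<longlonglongrightarrow> f' x" if "\<And>x. (f has_real_derivative f' x) (at x)" for f f' x
    using has_field_derivative_at_within[OF that, of x "{x<..}"]
    by (intro q_lim) (simp add: has_field_derivative_iff)
  have q_diff: "(q f k has_real_derivative q f' k x) (at x)"
    if "\<And>x. (f has_real_derivative f' x) (at x)" for f f' k x
  proof -
    have "((\<lambda>x. f (x + d k)) has_real_derivative f' (x + d k)) (at x)"
      using that[of "x + d k"] by (simp add: DERIV_shift)
    from DERIV_cdivide[OF DERIV_diff[OF this that]] show ?thesis by (simp add: q_def[abs_def])
  qed
  have approx: "resolvent l (\<lambda>y. q A k y - q B' k y / (2 * l)) x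
      = q A k x + (2 * \<beta> - 1) * q B k 0 / sqrt (2 * l) * exp (- sqrt (2 * l) * \<bar>x\<bar>)" for k
  proof (rule resolvent_C2[OF q_diff q_diff _ _ l])
    show "q A k \<in> C0" unfolding q_def[abs_def] by (rule C0_average(1)[OF A C0(1) d])
    have "q B' k = (\<lambda>x. (1 / d k) * B' (x + d k) + (- 1 / d k) * B' x)"
      by (auto simp: q_def diff_divide_distrib)
    then show "q B' k \<in> C0" by (simp only:) (intro C0_lincomb C0_shift C0)
  qed (use A B1 in auto)
  have cB': "B' \<in> borel_measurable borel" using C0 by (auto simp: C0_def intro: borel_measurable_continuous_onI)
  have cB: "B \<in> borel_measurable borel" using C0 by (auto simp: C0_def intro: borel_measurable_continuous_onI)
  have mA: "A \<in> borel_measurable borel"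
    by (intro borel_measurable_continuous_onI continuous_at_imp_continuous_on ballI DERIV_isCont[OF A])
  have "(\<lambda>k. resolvent l (\<lambda>y. q A k y - q B' k y / (2 * l)) x)
      \<longlonglongrightarrow> resolvent l (\<lambda>y. B y - B'' y / (2 * l)) x"
  proof (rule resolvent_dominated[where C="C + L / (2 * l)"])
    note [measurable] = cB' mA cB m
    show "(\<lambda>y. q A k y - q B' k y / (2 * l)) \<in> borel_measurable borel" for k
      unfolding q_def by measurable
    show "(\<lambda>y. B y - B'' y / (2 * l)) \<in> borel_measurable borel" by measurable
    show "\<bar>q A k y - q B' k y / (2 * l)\<bar> \<le> C + L / (2 * l)" for k y
    proof -
      have "\<bar>q A k y\<bar> \<le> C" unfolding q_def by (rule C0_average(2)[OF A C0(1) d C])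
      moreover have "\<bar>q B' k y\<bar> \<le> L"
        using lip[of "y + d k" y] d[of k] by (simp add: q_def abs_divide divide_le_eq)
      then have "\<bar>q B' k y / (2 * l)\<bar> \<le> L / (2 * l)"
        using l by (simp add: abs_divide divide_right_mono)
      ultimately show ?thesis by linarith
    qed
    show "(\<lambda>k. q A k y - q B' k y / (2 * l)) \<longlonglongrightarrow> B y - B'' y / (2 * l)" for y
      using l by (intro tendsto_intros q_deriv A q_lim B2) auto
  qed fact
  moreover have "(\<lambda>k. q A k x + (2 * \<beta> - 1) * q B k 0 / sqrt (2 * l) * exp (- sqrt (2 * l) * \<bar>x\<bar>))
      \<longlonglongrightarrow> B x + (2 * \<beta> - 1) * B' 0 / sqrt (2 * l) * exp (- sqrt (2 * l) * \<bar>x\<bar>)"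
    using l by (intro tendsto_intros q_deriv A B1) auto
  ultimately show ?thesis unfolding approx by (rule LIMSEQ_unique)
qed

end

lemma derivative_glued:
  fixes f1 f2 d1 d2 :: "real \<Rightarrow> real"
  assumes d1: "\<And>x. (f1 has_real_derivative d1 x) (at x)"
    and d2: "\<And>x. (f2 has_real_derivative d2 x) (at x)"
    and eq: "f1 0 = f2 0" "d1 0 = d2 0"
  shows "((\<lambda>x. if 0 \<le> x then f1 x else f2 x) has_real_derivative (if 0 \<le> x then d1 x else d2 x)) (at x)"
proof -
  let ?f = "\<lambda>x. if 0 \<le> x then f1 x else f2 x"
  consider "x > 0" | "x < 0" | "x = 0" by linarith
  then show ?thesis
  proof cases
    case 1
    have "(?f has_real_derivative d1 x) (at x)"
      by (rule has_field_derivative_transform_within_open[OF d1, of "{0<..}"]) (use 1 in auto)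
    then show ?thesis using 1 by simp
  next
    case 2
    have "(?f has_real_derivative d2 x) (at x)"
      by (rule has_field_derivative_transform_within_open[OF d2, of "{..<0}"]) (use 2 in auto)
    then show ?thesis using 2 by simp
  next
    case 3
    have r: "((\<lambda>y. (?f y - ?f 0) / (y - 0)) \<longlongrightarrow> d1 0) (at_right 0)"
      using right_derivative_glued[OF d1 d2, of ?f 0] by simp
    have "((\<lambda>y. (f2 y - f2 0) / (y - 0)) \<longlongrightarrow> d2 0) (at_left 0)"
      using has_field_derivative_at_within[OF d2, of 0 "{..<0}"] by (simp add: has_field_derivative_iff)
    moreover have "\<forall>\<^sub>F y in at_left 0. (f2 y - f2 0) / (y - 0) = (?f y - ?f 0) / (y - 0)"
      unfolding eventually_at_filter by (rule always_eventually) (simp add: eq)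
    ultimately have "((\<lambda>y. (?f y - ?f 0) / (y - 0)) \<longlongrightarrow> d1 0) (at_left 0)"
      unfolding eq(2) by (rule Lim_transform_eventually)
    then have "((\<lambda>y. (?f y - ?f 0) / (y - 0)) \<longlongrightarrow> d1 0) (at 0)"
      using r by (rule filterlim_split_at)
    then show ?thesis using 3 by (simp add: has_field_derivative_iff)
  qed
qed

text \<open>
  The truncation \<open>max x 0\<close> makes it possible to write a function glued at \<open>0\<close> by a single formula, from
  which continuity and Lipschitz bounds follow without a case distinction.
\<close>

lemma exp_decay_lipschitz:
  fixes c x y :: real
  assumes "0 \<le> c"
  shows "\<bar>exp (- c * max x 0) - exp (- c * max y 0)\<bar> \<le> c * \<bar>x - y\<bar>"
proof -
  have *: "\<bar>exp (- u) - exp (- v)\<bar> \<le> v - u" if "0 \<le> u" "u \<le> v" for u v :: real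
  proof -
    have "exp (- u) - exp (- v) = exp (- u) * (1 - exp (- (v - u)))"
      by (simp add: algebra_simps exp_add[symmetric])
    also have "\<dots> \<le> 1 * (v - u)"
    proof (rule mult_mono)
      show "1 - exp (- (v - u)) \<le> v - u" using exp_ge_add_one_self[of "- (v - u)"] by linarith
    qed (use that in auto)
    finally show ?thesis using that by (simp add: abs_if)
  qed
  have **: "\<bar>exp (- c * max x 0) - exp (- c * max y 0)\<bar> \<le> c * (y - x)" if "x \<le> y" for x y
  proof -
    have m: "max x 0 \<le> max y 0" "max y 0 - max x 0 \<le> y - x" using that by auto
    have "\<bar>exp (- (c * max x 0)) - exp (- (c * max y 0))\<bar> \<le> c * max y 0 - c * max x 0"
      using assms m(1) by (intro *) (auto intro: mult_left_mono)
    also have "\<dots> = c * (max y 0 - max x 0)" by (simp add: right_diff_distrib)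
    also have "\<dots> \<le> c * (y - x)" using m(2) assms by (rule mult_left_mono)
    finally show ?thesis by simp
  qed
  show ?thesis
  proof (cases "x \<le> y")
    case True
    then have e: "\<bar>x - y\<bar> = y - x" by simp
    show ?thesis unfolding e by (rule **[OF True])
  next
    case False
    then have e: "\<bar>x - y\<bar> = x - y" and le: "y \<le> x" by simp_all
    show ?thesis unfolding e by (subst abs_minus_commute) (rule **[OF le])
  qed
qed

lemma C0_two_sided_exp:
  fixes r s :: real
  assumes rs: "0 < r" "0 < s" and f: "\<And>x. f x = (if 0 \<le> x then k1 * exp (- r * x) + k2 * exp (- s * x) else k3 * exp (s * x))"
    and cont: "continuous_on UNIV f"
  shows "f \<in> C0"
proof (rule C0_exp_bound[OF cont, where c="min r s" and M="\<bar>k1\<bar> + \<bar>k2\<bar> + \<bar>k3\<bar>"])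
  show "0 < min r s" using rs by simp
  fix x :: real
  let ?e = "exp (- min r s * \<bar>x\<bar>)"
  have le: "exp (- c * \<bar>x\<bar>) \<le> ?e" if "c = r \<or> c = s" for c
  proof -
    have "min r s * \<bar>x\<bar> \<le> c * \<bar>x\<bar>" using that by (intro mult_right_mono) auto
    then show ?thesis by simp
  qed
  have t: "\<bar>k * exp (- c * \<bar>x\<bar>)\<bar> \<le> \<bar>k\<bar> * ?e" if "c = r \<or> c = s" for c k
    using le[OF that] by (simp add: abs_mult mult_left_mono)
  show "\<bar>f x\<bar> \<le> (\<bar>k1\<bar> + \<bar>k2\<bar> + \<bar>k3\<bar>) * ?e"
  proof (cases "0 \<le> x")
    case True
    have "\<bar>f x\<bar> \<le> \<bar>k1\<bar> * ?e + \<bar>k2\<bar> * ?e"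
    proof -
      have "\<bar>f x\<bar> \<le> \<bar>k1 * exp (- r * \<bar>x\<bar>)\<bar> + \<bar>k2 * exp (- s * \<bar>x\<bar>)\<bar>"
        using True by (simp add: f abs_triangle_ineq)
      then show ?thesis using t[OF disjI1[OF refl], of k1] t[OF disjI2[OF refl], of k2] by linarith
    qed
    moreover have "0 \<le> \<bar>k3\<bar> * ?e" by simp
    ultimately show ?thesis unfolding distrib_right by linarith
  next
    case False
    have "\<bar>f x\<bar> \<le> \<bar>k3\<bar> * ?e" using t[of s k3] False by (simp add: f)
    moreover have "0 \<le> \<bar>k1\<bar> * ?e" "0 \<le> \<bar>k2\<bar> * ?e" by simp_all
    ultimately show ?thesis unfolding distrib_right by linarith
  qed
qed

context skew_BM
begin

text \<open>
  The function \<open>B\<close> is the decaying \<open>C^1\<close> solution of \<open>B - B'' / (2 * l) = 1_{[0,\<infinity>)} exp (- s q _)\<close>, found by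
  variation of constants.
\<close>

lemma resolvent_exp:
  assumes q: "0 < q" "q \<noteq> 1" and l: "0 < l" and x: "0 \<le> x"
  defines "s \<equiv> sqrt (2 * l)"
  shows "resolvent l (\<lambda>y. indicator {0..} y * exp (- (s * q) * y)) x
       = (exp (- (s * q) * x) - (1 - \<beta> + \<beta> * q) * exp (- s * x)) / (1 - q^2)"
proof -
  have s: "0 < s" "s * s = 2 * l" using l by (auto simp: s_def)
  define r where "r = s * q"
  have r: "0 < r" using s q by (simp add: r_def)
  have q2: "1 - q^2 = (1 - q) * (1 + q)" by (simp add: algebra_simps power2_eq_square)
  have nz: "1 - q \<noteq> 0" "1 + q \<noteq> 0" "1 - q^2 \<noteq> 0" using q by (auto simp: q2)
  \<comment> \<open>\<open>K\<close> gives the particular solution on the right; \<open>a\<close> and \<open>b\<close>, the coefficients of the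
    homogeneous solutions, are forced by \<open>match0\<close> and \<open>match1\<close>\<close>
  define K where "K = 1 / (1 - q^2)"
  define a where "a = - (K * (1 + q) / 2)"
  define b where "b = K * (1 - q) / 2"
  have match0: "K + a = b" by (simp add: a_def b_def algebra_simps)
  have match1: "- r * K - s * a = s * b" by (simp add: a_def b_def r_def algebra_simps)
  define B where "B x = (if 0 \<le> x then K * exp (- r * x) + a * exp (- s * x) else b * exp (s * x))" for x
  define B' where "B' x = (if 0 \<le> x then - r * K * exp (- r * x) + - s * a * exp (- s * x) else s * b * exp (s * x))" for x
  define B'' where "B'' x = (if 0 \<le> x then r * r * K * exp (- r * x) + s * s * a * exp (- s * x) else s * s * b * exp (s * x))" for x
  have dB: "(B has_real_derivative B' x) (at x)" for x
    unfolding B_def[abs_def] B'_def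
  proof (rule derivative_glued)
    fix x show "((\<lambda>x. K * exp (- r * x) + a * exp (- s * x)) has_real_derivative
        - r * K * exp (- r * x) + - s * a * exp (- s * x)) (at x)"
      "((\<lambda>x. b * exp (s * x)) has_real_derivative s * b * exp (s * x)) (at x)"
      by (rule derivative_eq_intros refl | simp)+
  qed (use match0 match1 in auto)
  have dB': "((\<lambda>y. (B' y - B' x) / (y - x)) \<longlongrightarrow> B'' x) (at_right x)" for x
    unfolding B''_def
  proof (rule right_derivative_glued)
    fix x show "((\<lambda>x. - r * K * exp (- r * x) + - s * a * exp (- s * x)) has_real_derivative
        r * r * K * exp (- r * x) + s * s * a * exp (- s * x)) (at x)"
      "((\<lambda>x. s * b * exp (s * x)) has_real_derivative s * s * b * exp (s * x)) (at x)"
      by (rule derivative_eq_intros refl | simp)+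
  qed (simp add: B'_def)
  define E where "E c x = exp (- c * max x 0)" for c x :: real
  \<comment> \<open>on the left the first two terms vanish, on the right the last one is the constant \<open>s * b\<close>\<close>
  have B'_E: "B' x = (- r * K) * (E r x - 1) + (- s * a) * (E s x - 1) + (s * b) * E s (- x)" for x
  proof (cases "0 \<le> x")
    case True
    have "(- r * K) * (E r x - 1) + (- s * a) * (E s x - 1) + (s * b) * E s (- x)
      = - r * K * exp (- r * x) + - s * a * exp (- s * x) + (s * b - (- r * K - s * a))"
      using True by (simp add: E_def max_def algebra_simps)
    then show ?thesis using True match1 by (simp add: B'_def)
  next
    case False
    then show ?thesis by (simp add: B'_def E_def max_def)
  qed
  have E_lip: "\<bar>k * (E c x - E c y)\<bar> \<le> \<bar>k\<bar> * c * \<bar>x - y\<bar>" if "0 \<le> c" for k c x y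
    using exp_decay_lipschitz[OF that, of x y] unfolding abs_mult E_def mult.assoc
    by (intro mult_left_mono) auto
  have lip: "\<bar>B' x - B' y\<bar> \<le> (\<bar>- r * K\<bar> * r + \<bar>- s * a\<bar> * s + \<bar>s * b\<bar> * s) * \<bar>x - y\<bar>" for x y
  proof -
    have "B' x - B' y = (- r * K) * (E r x - E r y) + (- s * a) * (E s x - E s y) + (s * b) * (E s (- x) - E s (- y))"
      unfolding B'_E by (simp add: algebra_simps)
    moreover have "\<bar>(s * b) * (E s (- x) - E s (- y))\<bar> \<le> \<bar>s * b\<bar> * s * \<bar>x - y\<bar>"
      using E_lip[of s "s * b" "- x" "- y"] s by (simp add: abs_minus_commute)
    ultimately show ?thesis
      using E_lip[of r "- r * K" x y] E_lip[of s "- s * a" x y] r s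
      unfolding distrib_right by linarith
  qed
  have B0: "B \<in> C0"
    by (rule C0_two_sided_exp[OF r s(1) B_def])
       (intro continuous_at_imp_continuous_on ballI DERIV_isCont[OF dB])
  have cB': "continuous_on UNIV B'"
    unfolding B'_E[abs_def] E_def by (intro continuous_intros)
  have B'0: "B' \<in> C0"
    by (rule C0_two_sided_exp[OF r s(1) B'_def cB'])
  have mB'': "B'' \<in> borel_measurable borel" unfolding B''_def by measurable
  have "resolvent l (\<lambda>y. B y - B'' y / (2 * l)) x
       = B x + (2 * \<beta> - 1) * B' 0 / sqrt (2 * l) * exp (- sqrt (2 * l) * \<bar>x\<bar>)"
    by (rule resolvent_C1[OF dB B0 B'0 lip dB' mB'' l])
  moreover have "B y - B'' y / (2 * l) = indicator {0..} y * exp (- (s * q) * y)" for y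
  proof (cases "0 \<le> y")
    case True
    have "B y - B'' y / (2 * l) = K * exp (- r * y) - (r * r * K * exp (- r * y)) / (s * s)
       + (a * exp (- s * y) - (s * s * a * exp (- s * y)) / (s * s))"
      using True unfolding s(2)[symmetric] by (simp add: B_def B''_def add_divide_distrib)
    also have "(r * r * K * exp (- r * y)) / (s * s) = q^2 * (K * exp (- r * y))"
      using s(1) by (simp add: r_def power2_eq_square)
    also have "(s * s * a * exp (- s * y)) / (s * s) = a * exp (- s * y)" using s(1) by simp
    also have "K * exp (- r * y) - q^2 * (K * exp (- r * y)) + (a * exp (- s * y) - a * exp (- s * y))
      = (1 - q^2) * K * exp (- r * y)" by (simp add: algebra_simps)
    also have "(1 - q^2) * K = 1" using nz by (simp add: K_def)
    finally show ?thesis using True by (simp add: r_def)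
  next
    case False
    have "B y - B'' y / (2 * l) = b * exp (s * y) - (s * s * b * exp (s * y)) / (s * s)"
      using False unfolding s(2)[symmetric] by (simp add: B_def B''_def)
    also have "\<dots> = 0" using s(1) by simp
    finally show ?thesis using False by simp
  qed
  moreover have "B' 0 = s * b" using match1 by (simp add: B'_def)
  ultimately have "resolvent l (\<lambda>y. indicator {0..} y * exp (- (s * q) * y)) x
      = B x + (2 * \<beta> - 1) * b * exp (- s * x)"
    using s(1) x by (simp add: s_def[symmetric])
  also have "\<dots> = K * exp (- r * x) + (a + (2 * \<beta> - 1) * b) * exp (- s * x)"
    using x by (simp add: B_def algebra_simps)
  also have "a + (2 * \<beta> - 1) * b = - K * (1 - \<beta> + \<beta> * q)"
    by (simp add: a_def b_def) (simp add: field_simps)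
  finally show ?thesis by (simp add: K_def r_def diff_divide_distrib)
qed

text \<open>
  The limit \<open>q \<longrightarrow> 0\<close> of the previous lemma; the indicator itself does not vanish at infinity and is out of
  reach of \<open>resolvent_C1\<close>.
\<close>

lemma resolvent_indicator:
  assumes l: "0 < l" and x: "0 \<le> x"
  shows "resolvent l (indicator {0..}) x = 1 - (1 - \<beta>) * exp (- sqrt (2 * l) * x)"
proof -
  let ?s = "sqrt (2 * l)"
  define q where "q k = 1 / real (Suc (Suc k))" for k
  have q: "0 < q k" "q k \<noteq> 1" for k by (auto simp: q_def)
  have q0: "q \<longlonglongrightarrow> 0" unfolding q_def by (rule LIMSEQ_Suc[OF LIMSEQ_Suc[OF lim_1_over_n]])
  have "(\<lambda>k. resolvent l (\<lambda>y. indicator {0..} y * exp (- (?s * q k) * y)) x) \<longlonglongrightarrow> resolvent l (indicator {0..}) x"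
  proof (rule resolvent_dominated[where C=1])
    show "\<bar>indicator {0..} y * exp (- (?s * q k) * y)\<bar> \<le> 1" for k y
      using q(1)[of k] l by (auto split: split_indicator)
    have "(\<lambda>k. indicator {0..} y * exp (- (?s * q k) * y)) \<longlonglongrightarrow> indicator {0..} y * exp (- (?s * 0) * y)" for y :: real
      by (intro tendsto_intros q0)
    then show "(\<lambda>k. indicator {0..} y * exp (- (?s * q k) * y)) \<longlonglongrightarrow> indicator {0..} y" for y :: real
      by simp
  qed (use l in auto)
  moreover have "(\<lambda>k. (exp (- (?s * q k) * x) - (1 - \<beta> + \<beta> * q k) * exp (- ?s * x)) / (1 - (q k)^2))
      \<longlonglongrightarrow> (exp (- (?s * 0) * x) - (1 - \<beta> + \<beta> * 0) * exp (- ?s * x)) / (1 - 0^2)"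
    by (intro tendsto_intros q0) simp
  ultimately show ?thesis
    using resolvent_exp[OF q l x] LIMSEQ_unique by fastforce
qed

end

section \<open>The generating function of the Kac iterates\<close>

context regular_diffusion
begin

primrec kac_iterate :: "real \<Rightarrow> nat \<Rightarrow> real \<Rightarrow> real" where
  "kac_iterate l 0 = (\<lambda>x. 1)"
| "kac_iterate l (Suc n) = resolvent l (\<lambda>y. indicator {0..} y * kac_iterate l n y)"

lemma kac_iterate_bounds:
  assumes l: "0 < l"
  shows "kac_iterate l n \<in> borel_measurable borel" "0 \<le> kac_iterate l n x" "kac_iterate l n x \<le> 1"
proof -
  have "kac_iterate l n \<in> borel_measurable borel \<and> (\<forall>x. 0 \<le> kac_iterate l n x \<and> kac_iterate l n x \<le> 1)"
  proof (induction n)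
    case (Suc n)
    then have [measurable]: "kac_iterate l n \<in> borel_measurable borel" by simp
    let ?g = "\<lambda>y. indicator {0..} y * kac_iterate l n y"
    have m: "?g \<in> borel_measurable borel" by measurable
    have b: "\<bar>?g y\<bar> \<le> 1" for y using Suc by (auto split: split_indicator)
    have "0 \<le> resolvent l ?g x" for x using Suc by (intro resolvent_nonneg) auto
    moreover have "resolvent l ?g x \<le> 1" for x using abs_resolvent_le[OF m b l, of x] by simp
    ultimately show ?case using measurable_resolvent[OF m l] by simp
  qed simp
  then show "kac_iterate l n \<in> borel_measurable borel" "0 \<le> kac_iterate l n x" "kac_iterate l n x \<le> 1" by auto
qed

end

context skew_BM
begin

text \<open>
  On the span of \<open>1\<close> and \<open>exp (- s q x)\<close>, the operator \<open>T\<close> produces these two functions and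
  \<open>exp (- s x)\<close>. For \<open>q^2 = 1 - y\<close> the factor \<open>1 / (1 - q^2) = 1 / y\<close> of \<open>resolvent_exp\<close> makes the equation
  \<open>w = 1 + y * T w\<close> hold for the exponential part, \<open>1 / q^2\<close> settles the constant part, and \<open>\<gamma>\<close> is chosen
  to cancel \<open>exp (- s x)\<close>. Iterating the equation expands \<open>w\<close> in powers of \<open>y\<close>, with remainder
  \<open>y ^ n * (T ^^ n) w\<close>, which tends to \<open>0\<close> because \<open>T\<close> is a contraction.
\<close>

lemma kac_generating_function:
  assumes l: "0 < l" and y: "y \<noteq> 0" "\<bar>y\<bar> < 1"
  shows "(\<lambda>n. kac_iterate l n 0 * y ^ n) sums ((\<beta> / sqrt (1 - y) + (1 - \<beta>)) / (\<beta> * sqrt (1 - y) + (1 - \<beta>)))"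
proof -
  define q where "q = sqrt (1 - y)"
  have q: "0 < q" "q \<noteq> 1" "q^2 = 1 - y" "1 - q^2 = y" using y by (auto simp: q_def)
  define s where "s = sqrt (2 * l)"
  have s: "0 < s" using l by (simp add: s_def)
  define c where "c = 1 - \<beta> + \<beta> * q"
  have c: "0 < c" using \<beta> q by (simp add: c_def add_pos_pos)
  define \<gamma> where "\<gamma> = - (y * (1 - \<beta>)) / (q^2 * c)"
  let ?i = "indicator {0..} :: real \<Rightarrow> real"
  \<comment> \<open>the cut-off to the half-line keeps \<open>w\<close> bounded: \<open>exp (- s q x)\<close> blows up on the left\<close>
  define w where "w x = ?i x * (1 / q^2 + \<gamma> * exp (- (s * q) * x))" for x
  define T where "T g = resolvent l (\<lambda>y. ?i y * g y)" for g
  have mi: "?i \<in> borel_measurable borel" by simp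
  have me: "(\<lambda>x. ?i x * exp (- (s * q) * x)) \<in> borel_measurable borel" by measurable
  have be: "\<bar>?i x * exp (- (s * q) * x)\<bar> \<le> 1" for x
    using s q by (auto split: split_indicator)
  have bi: "\<bar>?i x\<bar> \<le> 1" for x by (auto split: split_indicator)
  have w_fix: "w x = 1 + y * T w x" if x: "0 \<le> x" for x
  proof -
    have "T w x = resolvent l (\<lambda>z. (1 / q^2) * ?i z + \<gamma> * (?i z * exp (- (s * q) * z))) x"
      unfolding T_def by (rule arg_cong[where f="\<lambda>g. resolvent l g x"]) (auto simp: w_def split: split_indicator)
    also have "\<dots> = (1 / q^2) * (1 - (1 - \<beta>) * exp (- s * x))
        + \<gamma> * ((exp (- (s * q) * x) - c * exp (- s * x)) / y)"
      unfolding resolvent_lincomb[OF mi bi me be l]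
      using resolvent_exp[OF q(1,2) l x] resolvent_indicator[OF l x]
      by (simp add: s_def[symmetric] c_def q(4))
    finally have T: "T w x = (1 / q^2) * (1 - (1 - \<beta>) * exp (- s * x))
        + \<gamma> * ((exp (- (s * q) * x) - c * exp (- s * x)) / y)" .
    have "y * T w x = y / q^2 - (y * (1 - \<beta>) / q^2) * exp (- s * x)
        + \<gamma> * exp (- (s * q) * x) - (\<gamma> * c) * exp (- s * x)"
      unfolding T using y by (simp add: algebra_simps diff_divide_distrib)
    also have "\<gamma> * c = - (y * (1 - \<beta>) / q^2)" using c by (simp add: \<gamma>_def)
    also have "y / q^2 = 1 / q^2 - 1" using q by (simp add: field_simps)
    finally have "y * T w x = 1 / q^2 + \<gamma> * exp (- (s * q) * x) - 1" by simp
    moreover have "w x = 1 / q^2 + \<gamma> * exp (- (s * q) * x)" using x by (simp add: w_def)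
    ultimately show ?thesis by linarith
  qed
  define R where "R n = (T ^^ n) w" for n
  define W where "W = 1 / q^2 + \<bar>\<gamma>\<bar>"
  have R: "R n \<in> borel_measurable borel \<and> (\<forall>x. \<bar>R n x\<bar> \<le> W)" for n
  proof (induction n)
    case 0
    have "\<bar>w x\<bar> \<le> W" for x
    proof (cases "0 \<le> x")
      case True
      have "\<bar>\<gamma> * exp (- (s * q) * x)\<bar> \<le> \<bar>\<gamma>\<bar> * 1"
        unfolding abs_mult using True s q by (intro mult_left_mono) auto
      moreover have "0 \<le> 1 / q^2" by simp
      moreover have "w x = 1 / q^2 + \<gamma> * exp (- (s * q) * x)" using True by (simp add: w_def)
      ultimately show ?thesis unfolding W_def by linarith
    qed (auto simp: w_def W_def)
    moreover have "w \<in> borel_measurable borel" unfolding w_def by measurable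
    ultimately show ?case by (simp add: R_def)
  next
    case (Suc n)
    then have [measurable]: "R n \<in> borel_measurable borel" by simp
    let ?g = "\<lambda>y. ?i y * R n y"
    have m: "?g \<in> borel_measurable borel" by measurable
    have W0: "0 \<le> W" by (simp add: W_def)
    have b: "\<bar>?g y\<bar> \<le> W" for y using Suc W0 by (auto split: split_indicator)
    show ?case using abs_resolvent_le[OF m b l] measurable_resolvent[OF m l] by (simp add: R_def T_def)
  qed
  have step: "R n x = kac_iterate l n x + y * R (Suc n) x" if "0 \<le> x" for n x
    using that
  proof (induction n arbitrary: x)
    case 0 then show ?case using w_fix by (simp add: R_def)
  next
    case (Suc n)
    have mk: "(\<lambda>z. ?i z * kac_iterate l n z) \<in> borel_measurable borel"
      by (intro borel_measurable_times mi kac_iterate_bounds(1)[OF l])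
    have bk: "\<bar>?i z * kac_iterate l n z\<bar> \<le> 1" for z using kac_iterate_bounds[OF l] by (auto split: split_indicator)
    have mR: "(\<lambda>z. ?i z * R (Suc n) z) \<in> borel_measurable borel"
      using R[of "Suc n"] by (intro borel_measurable_times mi) blast
    have W0: "0 \<le> W" by (simp add: W_def)
    have bR: "\<bar>?i z * R (Suc n) z\<bar> \<le> W" for z using R[of "Suc n"] W0 by (auto split: split_indicator)
    have RS: "R (Suc n) = T (R n)" for n by (simp add: R_def)
    have "R (Suc n) x = resolvent l (\<lambda>z. 1 * (?i z * kac_iterate l n z) + y * (?i z * R (Suc n) z)) x"
      unfolding RS[of n] T_def
      by (rule arg_cong[where f="\<lambda>g. resolvent l g x"])
         (use Suc.IH in \<open>auto simp: RS[symmetric] T_def[symmetric] split: split_indicator\<close>)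
    also have "\<dots> = kac_iterate l (Suc n) x + y * R (Suc (Suc n)) x"
      unfolding resolvent_lincomb[OF mk bk mR bR l] RS[of "Suc n"] T_def by simp
    finally show ?case .
  qed
  have tele: "w 0 = (\<Sum>k<n. kac_iterate l k 0 * y ^ k) + y ^ n * R n 0" for n
  proof (induction n)
    case (Suc n) then show ?case using step[of 0 n] by (simp add: algebra_simps)
  qed (simp add: R_def)
  have "(\<lambda>n. y ^ n * R n 0) \<longlonglongrightarrow> 0"
  proof (rule Lim_null_comparison)
    show "\<forall>\<^sub>F n in sequentially. norm (y ^ n * R n 0) \<le> \<bar>y\<bar> ^ n * W"
      using R by (intro always_eventually allI) (simp add: abs_mult power_abs mult_left_mono)
    show "(\<lambda>n. \<bar>y\<bar> ^ n * W) \<longlonglongrightarrow> 0"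
      using y by (intro tendsto_mult_left_zero LIMSEQ_power_zero) simp
  qed
  then have "(\<lambda>n. w 0 - y ^ n * R n 0) \<longlonglongrightarrow> w 0 - 0" by (intro tendsto_intros)
  moreover have "w 0 - y ^ n * R n 0 = (\<Sum>k<n. kac_iterate l k 0 * y ^ k)" for n using tele[of n] by simp
  ultimately have "(\<lambda>n. kac_iterate l n 0 * y ^ n) sums w 0" by (simp add: sums_def)
  also have "w 0 = (\<beta> / q + (1 - \<beta>)) / c"
  proof -
    have "w 0 = (c - y * (1 - \<beta>)) / (q^2 * c)"
      using c q(1) by (simp add: w_def \<gamma>_def diff_divide_distrib)
    also have "c - y * (1 - \<beta>) = q * (\<beta> + (1 - \<beta>) * q)"
      by (simp add: c_def q(4)[symmetric] algebra_simps power2_eq_square)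
    also have "\<dots> / (q^2 * c) = ((\<beta> + (1 - \<beta>) * q) / q) / c"
      using q(1) by (simp add: power2_eq_square)
    also have "(\<beta> + (1 - \<beta>) * q) / q = \<beta> / q + (1 - \<beta>)"
      using q(1) by (simp add: add_divide_distrib)
    finally show ?thesis .
  qed
  finally show ?thesis by (simp add: q_def c_def add.commute)
qed

lemma kac_iterate_at_0:
  assumes l: "0 < l"
  shows "kac_iterate l (Suc n) 0 = \<beta> * moment_coeff \<beta> n"
  by (rule generating_function_coeff[OF \<beta> kac_generating_function[OF l]]) simp_all

end

section \<open>Powers of an occupation clock\<close>

lemma constant_if_quadratic_increments:
  fixes D :: "real \<Rightarrow> real"
  assumes D: "\<And>u v. s \<le> u \<Longrightarrow> u \<le> v \<Longrightarrow> v \<le> t \<Longrightarrow> \<bar>D u - D v\<bar> \<le> C * (v - u)^2"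
    and st: "s \<le> t"
  shows "D s = D t"
proof -
  have D': "\<bar>D y - D x\<bar> \<le> \<bar>C\<bar> * \<bar>y - x\<bar> * \<bar>y - x\<bar>" if "x \<in> {s..t}" "y \<in> {s..t}" for x y
  proof -
    have K: "C * (v - u)^2 \<le> \<bar>C\<bar> * \<bar>v - u\<bar> * \<bar>v - u\<bar>" for u v :: real
      by (simp add: power2_eq_square abs_mult_self_eq mult.assoc mult_right_mono)
    show ?thesis
    proof (cases "x \<le> y")
      case True
      then have "\<bar>D x - D y\<bar> \<le> C * (y - x)^2" using that by (intro D) auto
      then show ?thesis using K[of y x] by (simp only: abs_minus_commute[of "D y"])
    next
      case False
      then have "\<bar>D y - D x\<bar> \<le> C * (x - y)^2" using that by (intro D) auto
      then show ?thesis using K[of x y] by (simp only: abs_minus_commute[of y])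
    qed
  qed
  have "(D has_field_derivative 0) (at x within {s..t})" if x: "x \<in> {s..t}" for x
    unfolding has_field_derivative_iff
  proof (rule Lim_null_comparison)
    show "\<forall>\<^sub>F y in at x within {s..t}. norm ((D y - D x) / (y - x)) \<le> \<bar>C\<bar> * \<bar>y - x\<bar>"
      unfolding eventually_at_filter
    proof (rule always_eventually, intro allI impI)
      fix y assume y: "y \<noteq> x" "y \<in> {s..t}"
      show "norm ((D y - D x) / (y - x)) \<le> \<bar>C\<bar> * \<bar>y - x\<bar>"
        using D'[OF x y(2)] y(1) by (simp add: abs_divide divide_le_eq)
    qed
    have "((\<lambda>y. \<bar>C\<bar> * \<bar>y - x\<bar>) \<longlongrightarrow> \<bar>C\<bar> * \<bar>x - x\<bar>) (at x within {s..t})"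
      by (intro tendsto_intros)
    then show "((\<lambda>y. \<bar>C\<bar> * \<bar>y - x\<bar>) \<longlongrightarrow> 0) (at x within {s..t})" by simp
  qed
  then obtain c where "\<And>x. x \<in> {s..t} \<Longrightarrow> D x = c"
    using has_field_derivative_zero_constant[of "{s..t}" D] by auto
  then show ?thesis using st by simp
qed

text \<open>
  The speed \<open>z\<close> of the clock \<open>A\<close> is merely measurable: a continuous path may have uncountably many zeros,
  and at each of them the time spent in \<open>[0,\<infinity>)\<close> can fail to be differentiable.
\<close>

locale occupation_clock =
  fixes z A :: "real \<Rightarrow> real"
  assumes z_measurable [measurable]: "z \<in> borel_measurable borel"
    and z_bounds: "\<And>r. 0 \<le> z r" "\<And>r. z r \<le> 1"
    and increment: "\<And>s t. s \<le> t \<Longrightarrow> A t - A s = (LINT r:{s<..t}|lborel. z r)"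
begin

lemma abs_z_le: "\<bar>z r\<bar> \<le> 1" using z_bounds[of r] by simp

lemma set_integrable_bounded:
  fixes f :: "real \<Rightarrow> real"
  assumes [measurable]: "f \<in> borel_measurable borel" and "\<And>r. r \<in> {s<..t} \<Longrightarrow> \<bar>f r\<bar> \<le> C"
  shows "set_integrable lborel {s<..t} f"
  unfolding set_integrable_def
proof (rule Bochner_Integration.integrable_bound[where f="\<lambda>x. indicator {s<..t} x *\<^sub>R C"])
  show "integrable lborel (\<lambda>x. indicator {s<..t} x *\<^sub>R C)"
    by (cases "s \<le> t") (auto intro!: integrable_scaleR_left integrable_real_indicator simp: emeasure_lborel_Ioc)
  show "AE x in lborel. norm (indicator {s<..t} x *\<^sub>R f x) \<le> norm (indicator {s<..t} x *\<^sub>R C)"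
    using assms(2) by (intro AE_I2) (force split: split_indicator)
qed measurable

lemma increment_bounds:
  assumes "s \<le> t" shows "0 \<le> A t - A s" "A t - A s \<le> t - s"
proof -
  show "0 \<le> A t - A s"
    unfolding increment[OF assms] set_lebesgue_integral_def using z_bounds
    by (intro Bochner_Integration.integral_nonneg) (auto split: split_indicator)
  have "(LINT r:{s<..t}|lborel. z r) \<le> (LINT r:{s<..t}|lborel. 1)"
    by (intro set_integral_mono set_integrable_bounded[where C=1]) (use abs_z_le z_bounds in auto)
  also have "\<dots> = t - s" using assms by (simp add: set_lebesgue_integral_def)
  finally show "A t - A s \<le> t - s" by (simp add: increment[OF assms])
qed

lemma A_mono: "s \<le> t \<Longrightarrow> A s \<le> A t" using increment_bounds(1)[of s t] by simp

lemma continuous_A: "continuous_on UNIV A"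
proof (rule continuous_on_subset)
  have "dist (A x) (A y) \<le> 1 * dist x y" for x y
    using increment_bounds[of x y] increment_bounds[of y x] by (cases "x \<le> y") (auto simp: dist_real_def)
  then have "1-lipschitz_on UNIV A" by (intro lipschitz_onI) auto
  then show "continuous_on UNIV A" by (rule lipschitz_on_continuous_on)
qed simp

lemma A_measurable [measurable]: "A \<in> borel_measurable borel"
  using continuous_A by (rule borel_measurable_continuous_onI)

text \<open>
  The fundamental theorem of calculus for the power of \<open>a r = A t - A r\<close>, which is Lipschitz but not
  differentiable everywhere. The difference \<open>D\<close> of the two sides, as a function of the lower end point,
  has increments of second order: with \<open>\<delta> = a u - a v\<close>, the increment over \<open>[u,v]\<close> of the power and that of
  \<open>n + 1\<close> times the integral both lie between \<open>(n + 1) * a v ^ n * \<delta>\<close> and \<open>(n + 1) * a u ^ n * \<delta>\<close>. So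
  \<open>D\<close> is constant, and it is \<open>0\<close> at \<open>t\<close>.
\<close>

lemma power_increment:
  assumes st: "s \<le> t"
  shows "(A t - A s) ^ Suc n = real (Suc n) * (LINT r:{s<..t}|lborel. z r * (A t - A r) ^ n)"
proof -
  define a where "a r = A t - A r" for r
  define M where "M = t - s"
  have a: "0 \<le> a r" "a r \<le> M" if "s \<le> r" "r \<le> t" for r
    using increment_bounds[of r t] that by (auto simp: a_def M_def)
  have a_mono: "a v \<le> a u" if "u \<le> v" for u v using A_mono[OF that] by (simp add: a_def)
  have am [measurable]: "a \<in> borel_measurable borel" unfolding a_def by measurable
  have int: "set_integrable lborel {u<..v} (\<lambda>r. z r * a r ^ n)" if "s \<le> u" "v \<le> t" for u v
  proof (rule set_integrable_bounded[where C="1 * M ^ n"])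
    show "\<bar>z r * a r ^ n\<bar> \<le> 1 * M ^ n" if "r \<in> {u<..v}" for r
      unfolding abs_mult using z_bounds[of r] a[of r] that \<open>s \<le> u\<close> \<open>v \<le> t\<close>
      by (intro mult_mono) (auto simp: power_mono)
  qed measurable
  define I where "I u v = (LINT r:{u<..v}|lborel. z r * a r ^ n)" for u v
  have I_add: "I u t = I u v + I v t" if "s \<le> u" "u \<le> v" "v \<le> t" for u v
  proof -
    have "{u<..t} = {u<..v} \<union> {v<..t}" using that by auto
    then show ?thesis unfolding I_def
      using set_integral_Un[of "{u<..v}" "{v<..t}" lborel] int[of u v] int[of v t] that by auto
  qed
  have I_bounds: "a v ^ n * (A v - A u) \<le> I u v \<and> I u v \<le> a u ^ n * (A v - A u)"
    if uv: "s \<le> u" "u \<le> v" "v \<le> t" for u v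
  proof -
    have av: "0 \<le> a v" using a uv by auto
    have zi: "set_integrable lborel {u<..v} (\<lambda>r. c * z r)" for c
      by (intro set_integrable_mult_right set_integrable_bounded[where C=1]) (use abs_z_le z_bounds in auto)
    have c: "c * (A v - A u) = (LINT r:{u<..v}|lborel. c * z r)" for c
      by (simp add: increment[OF uv(2)])
    have "(LINT r:{u<..v}|lborel. a v ^ n * z r) \<le> I u v"
      unfolding I_def
    proof (rule set_integral_mono[OF zi int])
      fix r assume r: "r \<in> {u<..v}"
      have "a v ^ n \<le> a r ^ n" using a_mono[of r v] av r by (intro power_mono) auto
      then show "a v ^ n * z r \<le> z r * a r ^ n"
        using z_bounds(1)[of r] by (simp add: mult.commute mult_left_mono)
    qed (use uv in auto)
    moreover have "I u v \<le> (LINT r:{u<..v}|lborel. a u ^ n * z r)"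
      unfolding I_def
    proof (rule set_integral_mono[OF int zi])
      fix r assume r: "r \<in> {u<..v}"
      have "a r ^ n \<le> a u ^ n" using a_mono[of u r] a[of r] r uv by (intro power_mono) auto
      then show "z r * a r ^ n \<le> a u ^ n * z r"
        using z_bounds(1)[of r] by (simp add: mult.commute mult_left_mono)
    qed (use uv in auto)
    ultimately show ?thesis unfolding c by simp
  qed
  define D where "D u = a u ^ Suc n - real (Suc n) * I u t" for u
  have "D s = D t"
  proof (rule constant_if_quadratic_increments[OF _ st])
    fix u v assume uv: "s \<le> u" "u \<le> v" "v \<le> t"
    define \<delta> where "\<delta> = A v - A u"
    have \<delta>: "0 \<le> \<delta>" "\<delta> \<le> v - u" using increment_bounds[OF uv(2)] by (auto simp: \<delta>_def)
    have au: "a u - a v = \<delta>" by (simp add: a_def \<delta>_def)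
    have av: "0 \<le> a v" "a v \<le> a u" "a u \<le> M" using a[of v] a[of u] a_mono uv by auto
    have pow: "real m * a v ^ (m - 1) * \<delta> \<le> a u ^ m - a v ^ m \<and> a u ^ m - a v ^ m \<le> real m * a u ^ (m - 1) * \<delta>" for m
    proof (induction m)
      case (Suc m)
      have e: "a u ^ Suc m - a v ^ Suc m = a u ^ m * \<delta> + a v * (a u ^ m - a v ^ m)"
        unfolding au[symmetric] by (simp add: algebra_simps)
      have e': "a u ^ Suc m - a v ^ Suc m = a v ^ m * \<delta> + a u * (a u ^ m - a v ^ m)"
        unfolding au[symmetric] by (simp add: algebra_simps)
      have vp: "real m * a v ^ m * \<delta> = a v * (real m * a v ^ (m - 1) * \<delta>)" by (cases m) auto
      have up: "real m * a u ^ m * \<delta> = a u * (real m * a u ^ (m - 1) * \<delta>)" by (cases m) auto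
      have "a v * (real m * a v ^ (m - 1) * \<delta>) \<le> a v * (a u ^ m - a v ^ m)"
        using Suc av by (intro mult_left_mono) auto
      moreover have "a v ^ m * \<delta> \<le> a u ^ m * \<delta>" using av \<delta> by (intro mult_right_mono power_mono) auto
      moreover have "a u * (a u ^ m - a v ^ m) \<le> a u * (real m * a u ^ (m - 1) * \<delta>)"
        using Suc av by (intro mult_left_mono) auto
      ultimately show ?case
        unfolding diff_Suc_1 of_nat_Suc distrib_right mult_1_left vp[symmetric] up[symmetric]
        using e e' vp up by linarith
    qed simp
    have "D u - D v = (a u ^ Suc n - a v ^ Suc n) - real (Suc n) * I u v"
      unfolding D_def I_add[OF uv] by (simp add: algebra_simps)
    moreover have "\<bar>(a u ^ Suc n - a v ^ Suc n) - real (Suc n) * I u v\<bar>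
        \<le> real (Suc n) * ((a u ^ n - a v ^ n) * \<delta>)"
    proof -
      have p: "real (Suc n) * (a v ^ n * \<delta>) \<le> a u ^ Suc n - a v ^ Suc n"
        "a u ^ Suc n - a v ^ Suc n \<le> real (Suc n) * (a u ^ n * \<delta>)"
        using pow[of "Suc n"] by (simp_all only: diff_Suc_1 mult.assoc)
      have i: "real (Suc n) * (a v ^ n * \<delta>) \<le> real (Suc n) * I u v"
        "real (Suc n) * I u v \<le> real (Suc n) * (a u ^ n * \<delta>)"
        using I_bounds[OF uv] unfolding \<delta>_def by (auto intro!: mult_left_mono)
      have "real (Suc n) * ((a u ^ n - a v ^ n) * \<delta>) = real (Suc n) * (a u ^ n * \<delta>) - real (Suc n) * (a v ^ n * \<delta>)"
        by (simp add: algebra_simps)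
      then show ?thesis using p i by linarith
    qed
    moreover have "(a u ^ n - a v ^ n) * \<delta> \<le> (real n * M ^ (n - 1)) * (v - u)^2"
    proof -
      have "a u ^ n - a v ^ n \<le> real n * a u ^ (n - 1) * \<delta>" using pow[of n] by simp
      also have "\<dots> \<le> real n * M ^ (n - 1) * (v - u)"
        using av \<delta> by (intro mult_mono power_mono) auto
      finally have "(a u ^ n - a v ^ n) * \<delta> \<le> real n * M ^ (n - 1) * (v - u) * (v - u)"
        using av \<delta> uv by (intro mult_mono) (auto intro!: mult_nonneg_nonneg)
      then show ?thesis by (simp add: power2_eq_square mult.assoc)
    qed
    then have "real (Suc n) * ((a u ^ n - a v ^ n) * \<delta>) \<le> real (Suc n) * ((real n * M ^ (n - 1)) * (v - u)^2)"
      by (intro mult_left_mono) auto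
    ultimately show "\<bar>D u - D v\<bar> \<le> (real (Suc n) * (real n * M ^ (n - 1))) * (v - u)^2"
      by (simp only: mult.assoc)
  qed
  moreover have "D t = 0" by (simp add: D_def a_def I_def set_lebesgue_integral_def)
  ultimately show ?thesis by (simp add: D_def I_def a_def)
qed

end

section \<open>Kac's moment formula\<close>

lemma nn_integral_exp_time:
  assumes [measurable]: "f \<in> borel_measurable borel"
  shows "(\<integral>\<^sup>+u. f u \<partial>exp_time l) = (\<integral>\<^sup>+u. ennreal (exponential_density l u) * f u \<partial>lborel)"
  by (rule nn_integral_density) auto

text \<open>
  The exponential law is memoryless: given that an exponential time exceeds \<open>r\<close>, the excess has the same law.
\<close>

lemma exponential_density_add:
  assumes "0 < l" "0 < r"
  shows "ennreal (exponential_density l (r + v)) * indicator {0<..r + v} r * ennreal l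
       = ennreal (exponential_density l r) * ennreal (exponential_density l v)"
proof (cases "0 \<le> v")
  case True
  have "l * exp (- (r + v) * l) * l = (l * exp (- r * l)) * (l * exp (- v * l))"
    by (simp add: algebra_simps exp_add[symmetric])
  then show ?thesis using True assms
    by (simp add: exponential_density_def ennreal_mult[symmetric])
next
  case False
  then show ?thesis using assms by (simp add: exponential_density_def)
qed

text \<open>
  The \<open>n\<close>-th moment of the clock over an independent exponential time after \<open>s\<close>, for a fixed path.
  It takes values in \<open>ennreal\<close> because the integrals are exchanged by Tonelli's theorem.
\<close>

definition exp_moment :: "real \<Rightarrow> (real \<Rightarrow> real) \<Rightarrow> nat \<Rightarrow> real \<Rightarrow> ennreal" where
  "exp_moment l A n s = (\<integral>\<^sup>+u. ennreal ((l * (A (s + u) - A s)) ^ n / fact n) \<partial>exp_time l)"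

context occupation_clock
begin

text \<open>
  Express the power by \<open>power_increment\<close> as an integral over the intermediate time \<open>s + r\<close>, exchange the two
  integrals, and use that the rest of the exponential time after \<open>r\<close> is again exponential.
\<close>

lemma exp_moment_Suc:
  assumes l: "0 < l"
  shows "exp_moment l A (Suc n) s = (\<integral>\<^sup>+u. ennreal (z (s + u)) * exp_moment l A n (s + u) \<partial>exp_time l)"
proof -
  let ?e = "\<lambda>u. ennreal (exponential_density l u)"
  define G where "G u r = z (s + r) * ((l * (A (s + u) - A (s + r))) ^ n / fact n)" for u r
  have inner: "ennreal ((l * (A (s + u) - A s)) ^ Suc n / fact (Suc n))
     = (\<integral>\<^sup>+r. indicator {0<..u} r * ennreal (l * G u r) \<partial>lborel)" if u: "0 \<le> u" for u
  proof -
    let ?f = "\<lambda>r. l * (z r * ((l * (A (s + u) - A r)) ^ n / fact n))"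
    have fnn: "0 \<le> ?f r" if "r \<in> {s<..s + u}" for r
      using A_mono[of r "s + u"] that l z_bounds(1)[of r] by (auto intro!: mult_nonneg_nonneg zero_le_power divide_nonneg_nonneg)
    have int: "set_integrable lborel {s<..s + u} ?f"
    proof (rule set_integrable_bounded[where C="l * (1 * ((l * u) ^ n / fact n))"])
      fix r assume r: "r \<in> {s<..s + u}"
      have "0 \<le> A (s + u) - A r" "A (s + u) - A r \<le> u"
        using increment_bounds[of r "s + u"] r by auto
      then show "\<bar>?f r\<bar> \<le> l * (1 * ((l * u) ^ n / fact n))"
        using fnn[OF r] l z_bounds[of r] unfolding abs_of_nonneg[OF fnn[OF r]]
        by (intro mult_left_mono mult_mono divide_right_mono power_mono) auto
    qed measurable
    have "(l * (A (s + u) - A s)) ^ Suc n / fact (Suc n)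
        = (l ^ Suc n / fact n) * (LINT r:{s<..s + u}|lborel. z r * (A (s + u) - A r) ^ n)"
      using power_increment[of s "s + u" n] u unfolding power_mult_distrib[of l] fact_Suc
      by (simp del: power_Suc of_nat_Suc add: of_nat_Suc[symmetric])
    also have "\<dots> = (LINT r:{s<..s + u}|lborel. ?f r)"
      unfolding set_integral_mult_right[symmetric]
      by (intro set_lebesgue_integral_cong) (auto simp: power_mult_distrib)
    finally have "ennreal ((l * (A (s + u) - A s)) ^ Suc n / fact (Suc n))
        = ennreal (LINT r:{s<..s + u}|lborel. ?f r)" by (rule arg_cong)
    also have "\<dots> = (\<integral>\<^sup>+r. ennreal (indicator {s<..s + u} r *\<^sub>R ?f r) \<partial>lborel)"
      unfolding set_lebesgue_integral_def
      by (rule nn_integral_eq_integral[symmetric])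
         (use int fnn in \<open>auto simp: set_integrable_def split: split_indicator\<close>)
    also have "\<dots> = (\<integral>\<^sup>+r. indicator {s<..s + u} r * ennreal (?f r) \<partial>lborel)"
      by (intro nn_integral_cong) (auto split: split_indicator)
    also have "\<dots> = (\<integral>\<^sup>+r. indicator {s<..s + u} (s + r) * ennreal (?f (s + r)) \<partial>lborel)"
      using nn_integral_real_affine[of "\<lambda>r. indicator {s<..s + u} r * ennreal (?f r)" 1 s] by simp
    also have "\<dots> = (\<integral>\<^sup>+r. indicator {0<..u} r * ennreal (l * G u r) \<partial>lborel)"
      by (intro nn_integral_cong) (auto simp: G_def split: split_indicator)
    finally show ?thesis .
  qed
  have [measurable]: "(\<lambda>(r, u). G u r) \<in> borel_measurable (borel \<Otimes>\<^sub>M borel)"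
    "(\<lambda>(u, r). G u r) \<in> borel_measurable (borel \<Otimes>\<^sub>M borel)"
    "(\<lambda>u. G u r) \<in> borel_measurable borel" for r
    unfolding G_def by measurable
  have "exp_moment l A (Suc n) s
      = (\<integral>\<^sup>+u. ?e u * ennreal ((l * (A (s + u) - A s)) ^ Suc n / fact (Suc n)) \<partial>lborel)"
    unfolding exp_moment_def by (rule nn_integral_exp_time) measurable
  also have "\<dots> = (\<integral>\<^sup>+u. ?e u * (\<integral>\<^sup>+r. indicator {0<..u} r * ennreal (l * G u r) \<partial>lborel) \<partial>lborel)"
  proof (intro nn_integral_cong)
    fix u
    show "?e u * ennreal ((l * (A (s + u) - A s)) ^ Suc n / fact (Suc n))
        = ?e u * (\<integral>\<^sup>+r. indicator {0<..u} r * ennreal (l * G u r) \<partial>lborel)"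
    proof (cases "0 \<le> u")
      case True then show ?thesis by (simp only: inner)
    next
      case False then show ?thesis by (simp add: exponential_density_def)
    qed
  qed
  also have "\<dots> = (\<integral>\<^sup>+u. (\<integral>\<^sup>+r. ?e u * (indicator {0<..u} r * ennreal (l * G u r)) \<partial>lborel) \<partial>lborel)"
    by (intro nn_integral_cong nn_integral_cmult[symmetric]) measurable
  also have "\<dots> = (\<integral>\<^sup>+r. (\<integral>\<^sup>+u. ?e u * (indicator {0<..u} r * ennreal (l * G u r)) \<partial>lborel) \<partial>lborel)"
  proof (rule lborel_pair.Fubini'[symmetric])
    have eq: "(\<lambda>(u, r). ?e u * (indicator {0<..u} r * ennreal (l * G u r)))
        = (\<lambda>z. ?e (fst z) * (indicator {z. 0 < snd z \<and> snd z \<le> fst z} z * ennreal (l * G (fst z) (snd z))))"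
      by (auto simp: fun_eq_iff indicator_def)
    show "(\<lambda>(u, r). ?e u * (indicator {0<..u} r * ennreal (l * G u r)))
        \<in> borel_measurable (lborel \<Otimes>\<^sub>M lborel)"
      unfolding eq by measurable
  qed
  also have "\<dots> = (\<integral>\<^sup>+r. ?e r * (ennreal (z (s + r)) * exp_moment l A n (s + r)) \<partial>lborel)"
  proof (rule nn_integral_cong_AE)
    \<comment> \<open>at \<open>r = 0\<close> the left side is \<open>0\<close> but the density on the right is not\<close>
    have "(\<integral>\<^sup>+u. ?e u * (indicator {0<..u} r * ennreal (l * G u r)) \<partial>lborel)
        = ?e r * (ennreal (z (s + r)) * exp_moment l A n (s + r))" if "r \<noteq> 0" for r
    proof (cases "0 < r")
      case True
      have "(\<integral>\<^sup>+u. ?e u * (indicator {0<..u} r * ennreal (l * G u r)) \<partial>lborel)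
          = (\<integral>\<^sup>+v. ?e (r + v) * (indicator {0<..r + v} r * ennreal (l * G (r + v) r)) \<partial>lborel)"
      proof -
        have "(\<lambda>u. ?e u * (indicator {u. 0 < r \<and> r \<le> u} u * ennreal (l * G u r))) \<in> borel_measurable borel"
          by measurable
        then have "(\<lambda>u. ?e u * (indicator {0<..u} r * ennreal (l * G u r))) \<in> borel_measurable borel"
          by (simp add: indicator_def)
        from nn_integral_real_affine[OF this, of 1 r] show ?thesis by simp
      qed
      also have "\<dots> = (\<integral>\<^sup>+v. (?e r * ennreal (z (s + r))) *
           (?e v * ennreal ((l * (A (s + r + v) - A (s + r))) ^ n / fact n)) \<partial>lborel)"
      proof (intro nn_integral_cong)
        fix v
        show "?e (r + v) * (indicator {0<..r + v} r * ennreal (l * G (r + v) r))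
          = (?e r * ennreal (z (s + r))) * (?e v * ennreal ((l * (A (s + r + v) - A (s + r))) ^ n / fact n))"
        proof (cases "0 \<le> v")
          case v: True
          define d where "d = (l * (A (s + r + v) - A (s + r))) ^ n / fact n"
          have d: "0 \<le> d"
            using A_mono[of "s + r" "s + r + v"] v l by (auto simp: d_def)
          have "G (r + v) r = z (s + r) * d" by (simp add: G_def d_def add.assoc)
          then have "ennreal (l * G (r + v) r) = ennreal l * (ennreal (z (s + r)) * ennreal d)"
            using l z_bounds(1)[of "s + r"] d by (simp only: ennreal_mult mult_nonneg_nonneg less_imp_le)
          then have G: "ennreal (l * G (r + v) r)
              = ennreal l * (ennreal (z (s + r)) * ennreal ((l * (A (s + r + v) - A (s + r))) ^ n / fact n))"
            by (simp only: d_def)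
          have "?e (r + v) * (indicator {0<..r + v} r * ennreal (l * G (r + v) r))
              = (?e (r + v) * indicator {0<..r + v} r * ennreal l) *
                (ennreal (z (s + r)) * ennreal ((l * (A (s + r + v) - A (s + r))) ^ n / fact n))"
            unfolding G by (simp only: mult.assoc)
          then show ?thesis
            unfolding exponential_density_add[OF l True] by (simp only: mult_ac)
        next
          case False
          then show ?thesis using True by (simp add: exponential_density_def)
        qed
      qed
      also have "\<dots> = (?e r * ennreal (z (s + r))) * exp_moment l A n (s + r)"
        unfolding exp_moment_def by (subst nn_integral_cmult) (simp_all add: nn_integral_exp_time)
      finally show ?thesis by (simp only: mult.assoc)
    next
      case False
      then have "r < 0" using that by simp
      then show ?thesis by (simp add: exponential_density_def)
    qed
    then show "AE r in lborel. (\<integral>\<^sup>+u. ?e u * (indicator {0<..u} r * ennreal (l * G u r)) \<partial>lborel)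
        = ?e r * (ennreal (z (s + r)) * exp_moment l A n (s + r))"
      using AE_lborel_singleton[of 0] by (auto elim!: eventually_mono)
  qed
  also have "\<dots> = (\<integral>\<^sup>+u. ennreal (z (s + u)) * exp_moment l A n (s + u) \<partial>exp_time l)"
  proof (rule nn_integral_exp_time[symmetric])
    interpret e: prob_space "exp_time l" by (rule prob_space_exponential_density) fact
    have "(\<lambda>u. exp_moment l A n (s + u)) \<in> borel_measurable borel"
      unfolding exp_moment_def by measurable
    then show "(\<lambda>u. ennreal (z (s + u)) * exp_moment l A n (s + u)) \<in> borel_measurable borel"
      by measurable
  qed
  finally show ?thesis .
qed

end

text \<open>
  A single term of the exponential series; the rate \<open>1/2\<close> is the growth admitted in \<open>laplace_uniqueness\<close>.
\<close>

lemma power_le_exp: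
  fixes t :: real
  assumes "0 \<le> t"
  shows "t ^ n \<le> (2 ^ n * fact n) * exp (t / 2)"
proof -
  have "(t / 2) ^ n / fact n \<le> (\<Sum>k. (t / 2) ^ k /\<^sub>R fact k)"
  proof -
    have "sum (\<lambda>k. (t / 2) ^ k /\<^sub>R fact k) {n} \<le> (\<Sum>k. (t / 2) ^ k /\<^sub>R fact k)"
      by (rule sum_le_suminf[OF summable_exp_generic]) (use assms in auto)
    then show ?thesis by (simp only: sum.insert finite.intros sum.empty empty_iff simp_thms add_0_right
        real_scaleR_def divide_inverse mult.commute)
  qed
  then have "(t / 2) ^ n / fact n \<le> exp (t / 2)" by (simp only: exp_def)
  then have "(2 ^ n * fact n) * ((t / 2) ^ n / fact n) \<le> (2 ^ n * fact n) * exp (t / 2)"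
    by (rule mult_left_mono) simp
  moreover have "(2 ^ n * fact n) * ((t / 2) ^ n / fact n) = (2 * (t / 2)) ^ n"
    unfolding power_mult_distrib by simp
  ultimately have "(2 * (t / 2)) ^ n \<le> (2 ^ n * fact n) * exp (t / 2)" by (simp only:)
  then show ?thesis by simp
qed

context regular_diffusion
begin

definition nonneg_path :: "'a \<Rightarrow> real \<Rightarrow> real" where
  "nonneg_path \<omega> r = indicator {0..} r * indicator {0..} (X (max 0 r) \<omega>)"

lemma measurable_nonneg_path [measurable]:
  "(\<lambda>(r, \<omega>). nonneg_path \<omega> r) \<in> borel_measurable (borel \<Otimes>\<^sub>M N)"
proof -
  have [measurable]: "(\<lambda>z. X (max 0 (fst z)) (snd z)) \<in> borel_measurable (borel \<Otimes>\<^sub>M N)"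
    using measurable_process by (simp add: case_prod_beta')
  have "(\<lambda>z. indicator {0..} (fst z) * indicator {0..} (X (max 0 (fst z)) (snd z)) :: real)
    \<in> borel_measurable (borel \<Otimes>\<^sub>M N)" by measurable
  then show ?thesis by (simp add: nonneg_path_def case_prod_beta')
qed

lemma nonneg_path_section [measurable]:
  assumes "\<omega> \<in> space N" shows "nonneg_path \<omega> \<in> borel_measurable borel"
  using measurable_compose[OF measurable_Pair2'[OF assms, of borel] measurable_nonneg_path] by simp

lemma occupation_time_integral:
  assumes "\<omega> \<in> space N"
  shows "nonneg_occupation_time X t \<omega> = (\<integral>r. indicator {..t} r * nonneg_path \<omega> r \<partial>lborel)"
proof -
  have "(\<integral>r. indicator {..t} r * nonneg_path \<omega> r \<partial>lborel)
      = (\<integral>r. indicator {s \<in> {0..t}. 0 \<le> X s \<omega>} r \<partial>lborel)"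
    by (intro Bochner_Integration.integral_cong) (auto simp: nonneg_path_def indicator_def max_def)
  then show ?thesis by (simp add: nonneg_occupation_time_def)
qed

lemma clock_occupation_time:
  assumes w: "\<omega> \<in> space N"
  shows "occupation_clock (nonneg_path \<omega>) (\<lambda>t. nonneg_occupation_time X t \<omega>)"
proof
  have [measurable]: "nonneg_path \<omega> \<in> borel_measurable borel" by (rule nonneg_path_section[OF w])
  show "nonneg_path \<omega> \<in> borel_measurable borel" by measurable
  show b: "0 \<le> nonneg_path \<omega> r" "nonneg_path \<omega> r \<le> 1" for r
    by (auto simp: nonneg_path_def split: split_indicator)
  have int: "set_integrable lborel {..t} (nonneg_path \<omega>)" for t
    unfolding set_integrable_def
  proof (rule Bochner_Integration.integrable_bound[where f="indicator {0..t} :: real \<Rightarrow> real"])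
    show "integrable lborel (indicator {0..t} :: real \<Rightarrow> real)"
      by (rule integrable_real_indicator) (auto simp: emeasure_lborel_Icc_eq)
    show "AE x in lborel. norm (indicator {..t} x *\<^sub>R nonneg_path \<omega> x) \<le> norm (indicator {0..t} x :: real)"
      by (intro AE_I2) (auto simp: nonneg_path_def split: split_indicator)
  qed measurable
  fix s t :: real assume st: "s \<le> t"
  have dj: "{..s} \<inter> {s<..t} = {}" by auto
  have "{..t} = {..s} \<union> {s<..t}" using st by auto
  then have "(LINT r:{..t}|lborel. nonneg_path \<omega> r)
      = (LINT r:{..s}|lborel. nonneg_path \<omega> r) + (LINT r:{s<..t}|lborel. nonneg_path \<omega> r)"
    using set_integral_Un[OF dj int[of s] set_integrable_subset[OF int[of t], of "{s<..t}"]] by auto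
  then show "nonneg_occupation_time X t \<omega> - nonneg_occupation_time X s \<omega> = (LINT r:{s<..t}|lborel. nonneg_path \<omega> r)"
    unfolding occupation_time_integral[OF w] set_lebesgue_integral_def by simp
qed

lemma measurable_occupation_time [measurable]:
  "(\<lambda>(t, \<omega>). nonneg_occupation_time X t \<omega>) \<in> borel_measurable (borel \<Otimes>\<^sub>M N)"
proof -
  have [measurable]: "(\<lambda>x. nonneg_path (snd (fst x)) (snd x)) \<in> borel_measurable ((borel \<Otimes>\<^sub>M N) \<Otimes>\<^sub>M borel)"
    using measurable_compose[OF _ measurable_nonneg_path,
      of "\<lambda>x. (snd x, snd (fst x))" "(borel \<Otimes>\<^sub>M N) \<Otimes>\<^sub>M borel"] by simp
  have "(\<lambda>z. indicator {x. snd x \<le> fst (fst x)} z * nonneg_path (snd (fst z)) (snd z))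
      \<in> borel_measurable ((borel \<Otimes>\<^sub>M N) \<Otimes>\<^sub>M lborel)"
    by measurable
  then have "(\<lambda>(z, r). indicator {..fst z} r * nonneg_path (snd z) r) \<in> borel_measurable ((borel \<Otimes>\<^sub>M N) \<Otimes>\<^sub>M lborel)"
    by (simp add: case_prod_beta' indicator_def)
  then have "(\<lambda>z. \<integral>r. indicator {..fst z} r * nonneg_path (snd z) r \<partial>lborel) \<in> borel_measurable (borel \<Otimes>\<^sub>M N)"
    by (rule lborel.borel_measurable_lebesgue_integral)
  then show ?thesis
    by (rule measurable_cong[THEN iffD1, rotated])
       (auto simp: space_pair_measure occupation_time_integral)
qed

lemma measurable_exp_moment:
  assumes l: "0 < l"
  shows "(\<lambda>(s, \<omega>). exp_moment l (\<lambda>t. nonneg_occupation_time X t \<omega>) n s) \<in> borel_measurable (borel \<Otimes>\<^sub>M N)"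
proof -
  interpret e: prob_space "exp_time l" by (rule prob_space_exponential_density) fact
  have [measurable]: "(\<lambda>x. nonneg_occupation_time X (fst (fst x) + snd x) (snd (fst x)))
      \<in> borel_measurable ((borel \<Otimes>\<^sub>M N) \<Otimes>\<^sub>M borel)"
    "(\<lambda>x. nonneg_occupation_time X (fst (fst x)) (snd (fst x)))
      \<in> borel_measurable ((borel \<Otimes>\<^sub>M N) \<Otimes>\<^sub>M borel)"
    using measurable_compose[OF _ measurable_occupation_time,
      of "\<lambda>x. (fst (fst x) + snd x, snd (fst x))" "(borel \<Otimes>\<^sub>M N) \<Otimes>\<^sub>M borel"]
     measurable_compose[OF _ measurable_occupation_time,
      of "\<lambda>x. (fst (fst x), snd (fst x))" "(borel \<Otimes>\<^sub>M N) \<Otimes>\<^sub>M borel"] by simp_all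
  have "(\<lambda>z. \<integral>\<^sup>+u. ennreal ((l * (nonneg_occupation_time X (fst z + u) (snd z)
      - nonneg_occupation_time X (fst z) (snd z))) ^ n / fact n) \<partial>exp_time l) \<in> borel_measurable (borel \<Otimes>\<^sub>M N)"
    by (rule e.borel_measurable_nn_integral) (simp add: case_prod_beta')
  then show ?thesis by (simp add: exp_moment_def case_prod_beta')
qed

text \<open>
  Induction on \<open>n\<close>, for all \<open>s\<close> and all events \<open>B\<close> of the past at once. By \<open>exp_moment_Suc\<close> the path functional
  of order \<open>n + 1\<close> at \<open>s\<close> is an average of those of order \<open>n\<close> at later times \<open>s + u\<close>, restricted to the event
  \<open>0 \<le> X (s + u)\<close>; this event belongs to the past of \<open>s + u\<close>, so the induction hypothesis
  replaces the functional by a function of \<open>X (s + u)\<close> alone. To that the one-time Markov property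
  applies.
\<close>

lemma kac_moment_formula:
  assumes l: "0 < l" and "0 \<le> s" "B \<in> sets (F s)"
  shows "(\<integral>\<^sup>+\<omega>. indicator B \<omega> * exp_moment l (\<lambda>t. nonneg_occupation_time X t \<omega>) n s \<partial>P x)
       = (\<integral>\<^sup>+\<omega>. indicator B \<omega> * ennreal (kac_iterate l n (X s \<omega>)) \<partial>P x)"
  using assms(2,3)
proof (induction n arbitrary: s B)
  case 0
  interpret e: prob_space "exp_time l" by (rule prob_space_exponential_density) fact
  have "exp_moment l A 0 s = 1" for A s
    using e.emeasure_space_1 by (simp add: exp_moment_def)
  then show ?case by simp
next
  case (Suc n)
  note s = \<open>0 \<le> s\<close> and B = \<open>B \<in> sets (F s)\<close>
  interpret e: prob_space "exp_time l" by (rule prob_space_exponential_density) fact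
  interpret p: prob_space "P x" by (rule prob_space_P)
  interpret pair_sigma_finite "exp_time l" "P x" ..
  have FN: "sets (F t) \<subseteq> sets N" for t using subalgebra_F by (simp add: subalgebra_def)
  have BN [measurable]: "B \<in> sets N" using B FN by blast
  have [measurable]: "X s \<in> borel_measurable N" using s by simp
  define J where "J n u \<omega> = exp_moment l (\<lambda>t. nonneg_occupation_time X t \<omega>) n u" for n u \<omega>
  define g where "g y = indicator {0..} y * kac_iterate l n y" for y :: real
  have gm [measurable]: "g \<in> borel_measurable borel"
    unfolding g_def using kac_iterate_bounds(1)[OF l] by (intro borel_measurable_times) auto
  have gb: "\<bar>g y\<bar> \<le> 1" and gnn: "0 \<le> g y" for y
    using kac_iterate_bounds(2,3)[OF l, of n y] by (auto simp: g_def split: split_indicator)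
  have Tnn: "0 \<le> transition t g y" for t y
    unfolding transition_def using gnn by (intro Bochner_Integration.integral_nonneg) auto
  have mJ [measurable]: "(\<lambda>z. J n (s + fst z) (snd z)) \<in> borel_measurable (borel \<Otimes>\<^sub>M N)"
  proof -
    have "(\<lambda>z. (s + fst z, snd z)) \<in> borel \<Otimes>\<^sub>M N \<rightarrow>\<^sub>M borel \<Otimes>\<^sub>M N" by measurable
    from measurable_compose[OF this measurable_exp_moment[OF l, of n]] show ?thesis by (simp add: J_def)
  qed
  have mz [measurable]: "(\<lambda>z. nonneg_path (snd z) (s + fst z)) \<in> borel_measurable (borel \<Otimes>\<^sub>M N)"
  proof -
    have "(\<lambda>z. (s + fst z, snd z)) \<in> borel \<Otimes>\<^sub>M N \<rightarrow>\<^sub>M borel \<Otimes>\<^sub>M N" by measurable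
    from measurable_compose[OF this measurable_nonneg_path] show ?thesis by simp
  qed
  have mT [measurable]: "(\<lambda>z. transition (max 0 (fst z)) g (X s (snd z))) \<in> borel_measurable (borel \<Otimes>\<^sub>M N)"
  proof -
    have "(\<lambda>z. (fst z, X s (snd z))) \<in> borel \<Otimes>\<^sub>M N \<rightarrow>\<^sub>M borel \<Otimes>\<^sub>M borel" by measurable
    from measurable_compose[OF this measurable_transition[OF gm]] show ?thesis by simp
  qed
  have "(\<integral>\<^sup>+\<omega>. indicator B \<omega> * J (Suc n) s \<omega> \<partial>P x)
      = (\<integral>\<^sup>+\<omega>. (\<integral>\<^sup>+u. indicator B \<omega> * (ennreal (nonneg_path \<omega> (s + u)) * J n (s + u) \<omega>) \<partial>exp_time l) \<partial>P x)"
  proof (rule nn_integral_cong)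
    fix \<omega> assume "\<omega> \<in> space (P x)"
    then have w: "\<omega> \<in> space N" by simp
    interpret occupation_clock "nonneg_path \<omega>" "\<lambda>t. nonneg_occupation_time X t \<omega>" by (rule clock_occupation_time[OF w])
    have m: "(\<lambda>u. ennreal (nonneg_path \<omega> (s + u)) * J n (s + u) \<omega>) \<in> borel_measurable (exp_time l)"
      unfolding J_def exp_moment_def by measurable
    show "indicator B \<omega> * J (Suc n) s \<omega>
        = (\<integral>\<^sup>+u. indicator B \<omega> * (ennreal (nonneg_path \<omega> (s + u)) * J n (s + u) \<omega>) \<partial>exp_time l)"
      unfolding nn_integral_cmult[OF m] by (simp add: J_def exp_moment_Suc[OF l])
  qed
  also have "\<dots> = (\<integral>\<^sup>+u. (\<integral>\<^sup>+\<omega>. indicator B \<omega> * (ennreal (nonneg_path \<omega> (s + u)) * J n (s + u) \<omega>) \<partial>P x) \<partial>exp_time l)"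
    by (rule Fubini', unfold case_prod_beta') measurable
  also have "\<dots> = (\<integral>\<^sup>+u. (\<integral>\<^sup>+\<omega>. indicator B \<omega> * ennreal (transition (max 0 u) g (X s \<omega>)) \<partial>P x) \<partial>exp_time l)"
  proof (rule nn_integral_cong_AE)
    have "(\<integral>\<^sup>+\<omega>. indicator B \<omega> * (ennreal (nonneg_path \<omega> (s + u)) * J n (s + u) \<omega>) \<partial>P x)
        = (\<integral>\<^sup>+\<omega>. indicator B \<omega> * ennreal (transition (max 0 u) g (X s \<omega>)) \<partial>P x)" if u: "0 \<le> u" for u
    proof -
      have su: "0 \<le> s + u" using s u by simp
      have [measurable]: "X (s + u) \<in> borel_measurable N" using su by simp
      have tm [measurable]: "transition u g \<in> borel_measurable borel" using u by (intro measurable_transition_space gm)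
      define B' where "B' = B \<inter> (X (s + u) -` {0..} \<inter> space N)"
      have "X (s + u) -` {0..} \<inter> space (F (s + u)) \<in> sets (F (s + u))"
        by (rule measurable_sets[OF adapted[OF su]]) simp
      then have B': "B' \<in> sets (F (s + u))"
        using B sets_F_mono[of s "s + u"] u by (auto simp: B'_def space_F)
      have "(\<integral>\<^sup>+\<omega>. indicator B \<omega> * (ennreal (nonneg_path \<omega> (s + u)) * J n (s + u) \<omega>) \<partial>P x)
          = (\<integral>\<^sup>+\<omega>. indicator B' \<omega> * J n (s + u) \<omega> \<partial>P x)"
        using su by (intro nn_integral_cong) (auto simp: B'_def nonneg_path_def max_def split: split_indicator)
      also have "\<dots> = (\<integral>\<^sup>+\<omega>. indicator B' \<omega> * ennreal (kac_iterate l n (X (s + u) \<omega>)) \<partial>P x)"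
        unfolding J_def by (rule Suc.IH[OF su B'])
      also have "\<dots> = (\<integral>\<^sup>+\<omega>. ennreal (indicator B \<omega> * g (X (s + u) \<omega>)) \<partial>P x)"
        by (intro nn_integral_cong) (auto simp: B'_def g_def split: split_indicator)
      also have "\<dots> = ennreal (\<integral>\<omega>. indicator B \<omega> * g (X (s + u) \<omega>) \<partial>P x)"
        by (rule nn_integral_eq_integral[OF p.integrable_const_bound[where B=1]])
           (use gb gnn in \<open>auto split: split_indicator\<close>)
      also have "(\<integral>\<omega>. indicator B \<omega> * g (X (s + u) \<omega>) \<partial>P x) = (\<integral>\<omega>. indicator B \<omega> * transition u g (X s \<omega>) \<partial>P x)"
        by (rule Markov_property[OF s u gm gb B])
      also have "ennreal \<dots> = (\<integral>\<^sup>+\<omega>. ennreal (indicator B \<omega> * transition u g (X s \<omega>)) \<partial>P x)"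
        by (rule nn_integral_eq_integral[OF p.integrable_const_bound[where B=1], symmetric])
           (use abs_transition_le[OF gm gb u] Tnn in \<open>auto split: split_indicator\<close>)
      also have "\<dots> = (\<integral>\<^sup>+\<omega>. indicator B \<omega> * ennreal (transition (max 0 u) g (X s \<omega>)) \<partial>P x)"
        using u by (intro nn_integral_cong) (auto simp: max_def split: split_indicator)
      finally show ?thesis .
    qed
    moreover have "AE u in exp_time l. 0 \<le> u"
      by (subst AE_density) (auto simp: exponential_density_def)
    ultimately show "AE u in exp_time l.
        (\<integral>\<^sup>+\<omega>. indicator B \<omega> * (ennreal (nonneg_path \<omega> (s + u)) * J n (s + u) \<omega>) \<partial>P x)
        = (\<integral>\<^sup>+\<omega>. indicator B \<omega> * ennreal (transition (max 0 u) g (X s \<omega>)) \<partial>P x)"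
      by (auto elim!: eventually_mono)
  qed
  also have "\<dots> = (\<integral>\<^sup>+\<omega>. (\<integral>\<^sup>+u. indicator B \<omega> * ennreal (transition (max 0 u) g (X s \<omega>)) \<partial>exp_time l) \<partial>P x)"
    by (rule Fubini'[symmetric], unfold case_prod_beta') measurable
  also have "\<dots> = (\<integral>\<^sup>+\<omega>. indicator B \<omega> * ennreal (kac_iterate l (Suc n) (X s \<omega>)) \<partial>P x)"
  proof (rule nn_integral_cong)
    fix \<omega>
    have m: "(\<lambda>u. ennreal (transition (max 0 u) g (X s \<omega>))) \<in> borel_measurable (exp_time l)"
      using measurable_transition_time[OF gm] by simp
    have "(\<integral>\<^sup>+u. ennreal (transition (max 0 u) g (X s \<omega>)) \<partial>exp_time l) = ennreal (resolvent l g (X s \<omega>))"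
      unfolding resolvent_def
      by (rule nn_integral_eq_integral[OF integrable_resolvent[OF gm gb l]]) (simp add: Tnn)
    moreover have "resolvent l g = kac_iterate l (Suc n)" by (simp add: g_def[abs_def])
    ultimately show "(\<integral>\<^sup>+u. indicator B \<omega> * ennreal (transition (max 0 u) g (X s \<omega>)) \<partial>exp_time l)
        = indicator B \<omega> * ennreal (kac_iterate l (Suc n) (X s \<omega>))"
      unfolding nn_integral_cmult[OF m] by simp
  qed
  finally show ?case by (simp only: J_def)
qed

section \<open>Moments at a fixed time\<close>

lemma occupation_time_bounds:
  assumes "\<omega> \<in> space N" "0 \<le> t"
  shows "0 \<le> nonneg_occupation_time X t \<omega>" "nonneg_occupation_time X t \<omega> \<le> t"
proof -
  interpret occupation_clock "nonneg_path \<omega>" "\<lambda>t. nonneg_occupation_time X t \<omega>"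
    by (rule clock_occupation_time[OF assms(1)])
  have "{s \<in> {0..0}. 0 \<le> X s \<omega>} = (if 0 \<le> X 0 \<omega> then {0} else {})" by auto
  then have "nonneg_occupation_time X 0 \<omega> = 0" by (simp add: nonneg_occupation_time_def)
  then show "0 \<le> nonneg_occupation_time X t \<omega>" "nonneg_occupation_time X t \<omega> \<le> t"
    using increment_bounds[OF assms(2)] by auto
qed

lemma occupation_time_0: "\<omega> \<in> space N \<Longrightarrow> nonneg_occupation_time X 0 \<omega> = 0"
  using occupation_time_bounds[of \<omega> 0] by simp

lemma measurable_occupation_time1 [measurable]: "nonneg_occupation_time X t \<in> borel_measurable N"
  using measurable_compose[OF measurable_Pair1'[of t borel N] measurable_occupation_time] by simp

lemma continuous_occupation_moment:
  "continuous_on {0..} (\<lambda>t. \<integral>\<omega>. nonneg_occupation_time X t \<omega> ^ n \<partial>P x)"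
  unfolding continuous_on_sequentially
proof (intro allI ballI impI, elim conjE)
  fix u :: "nat \<Rightarrow> real" and a assume a: "a \<in> {0..}" and u: "\<forall>n. u n \<in> {0..}" and lim: "u \<longlonglongrightarrow> a"
  interpret prob_space "P x" by (rule prob_space_P)
  have "Bseq u" using lim by (rule convergentI[THEN convergent_imp_Bseq])
  then obtain K where K: "\<And>k. \<bar>u k\<bar> \<le> K" unfolding Bseq_def by auto
  have "(\<lambda>k. \<integral>\<omega>. nonneg_occupation_time X (u k) \<omega> ^ n \<partial>P x)
      \<longlonglongrightarrow> (\<integral>\<omega>. nonneg_occupation_time X a \<omega> ^ n \<partial>P x)"
  proof (rule integral_dominated_convergence[where w="\<lambda>_. K ^ n"])
    show "AE \<omega> in P x. (\<lambda>k. nonneg_occupation_time X (u k) \<omega> ^ n) \<longlonglongrightarrow> nonneg_occupation_time X a \<omega> ^ n"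
    proof (rule AE_I2)
      fix \<omega> assume "\<omega> \<in> space (P x)"
      then interpret occupation_clock "nonneg_path \<omega>" "\<lambda>t. nonneg_occupation_time X t \<omega>"
        by (intro clock_occupation_time) simp
      show "(\<lambda>k. nonneg_occupation_time X (u k) \<omega> ^ n) \<longlonglongrightarrow> nonneg_occupation_time X a \<omega> ^ n"
        using continuous_on_tendsto_compose[OF continuous_A lim] by (intro tendsto_power) simp
    qed
    show "AE \<omega> in P x. norm (nonneg_occupation_time X (u k) \<omega> ^ n) \<le> K ^ n" for k
    proof (rule AE_I2)
      fix \<omega> assume "\<omega> \<in> space (P x)"
      then have "0 \<le> nonneg_occupation_time X (u k) \<omega>" "nonneg_occupation_time X (u k) \<omega> \<le> K"
        using occupation_time_bounds[of \<omega> "u k"] u K[of k] by auto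
      then show "norm (nonneg_occupation_time X (u k) \<omega> ^ n) \<le> K ^ n"
        by (simp add: norm_power power_mono)
    qed
  qed auto
  then show "((\<lambda>t. \<integral>\<omega>. nonneg_occupation_time X t \<omega> ^ n \<partial>P x) \<circ> u)
      \<longlonglongrightarrow> (\<integral>\<omega>. nonneg_occupation_time X a \<omega> ^ n \<partial>P x)" by (simp add: comp_def)
qed

lemma occupation_moment_bounds:
  assumes t: "0 \<le> t"
  shows "integrable (P x) (\<lambda>\<omega>. nonneg_occupation_time X t \<omega> ^ n)"
    and "0 \<le> (\<integral>\<omega>. nonneg_occupation_time X t \<omega> ^ n \<partial>P x)"
    and "(\<integral>\<omega>. nonneg_occupation_time X t \<omega> ^ n \<partial>P x) \<le> t ^ n"
proof -
  interpret prob_space "P x" by (rule prob_space_P)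
  have b: "0 \<le> nonneg_occupation_time X t \<omega> ^ n" "nonneg_occupation_time X t \<omega> ^ n \<le> t ^ n"
    if "\<omega> \<in> space (P x)" for \<omega>
    using occupation_time_bounds[of \<omega> t] that t by (auto intro: power_mono)
  show i: "integrable (P x) (\<lambda>\<omega>. nonneg_occupation_time X t \<omega> ^ n)"
    by (rule integrable_const_bound[where B="t ^ n"]) (use b in auto)
  show "0 \<le> (\<integral>\<omega>. nonneg_occupation_time X t \<omega> ^ n \<partial>P x)"
    by (rule integral_nonneg_AE) (use b in \<open>auto intro: AE_I2\<close>)
  have "(\<integral>\<omega>. nonneg_occupation_time X t \<omega> ^ n \<partial>P x) \<le> (\<integral>\<omega>. t ^ n \<partial>P x)"
    by (rule integral_mono_AE[OF i]) (use b in \<open>auto intro: AE_I2\<close>)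
  then show "(\<integral>\<omega>. nonneg_occupation_time X t \<omega> ^ n \<partial>P x) \<le> t ^ n" by simp
qed

text \<open>
  The case \<open>s = 0\<close> of \<open>kac_moment_formula\<close>, read as a Laplace transform in the time variable.
\<close>

lemma kac_occupation_moment:
  assumes l: "0 < l"
  shows "(\<integral>\<^sup>+t. ennreal (l ^ n / fact n * (\<integral>\<omega>. nonneg_occupation_time X t \<omega> ^ n \<partial>P x)) \<partial>exp_time l)
       = ennreal (kac_iterate l n x)"
proof -
  interpret e: prob_space "exp_time l" by (rule prob_space_exponential_density) fact
  interpret p: prob_space "P x" by (rule prob_space_P)
  interpret pair_sigma_finite "exp_time l" "P x" ..
  have top: "space N \<in> sets (F 0)" using sets.top[of "F 0"] by (simp add: space_F)
  have [measurable]: "(\<lambda>z. nonneg_occupation_time X (fst z) (snd z)) \<in> borel_measurable (borel \<Otimes>\<^sub>M N)"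
    using measurable_occupation_time by (simp add: case_prod_beta')
  have "(\<integral>\<^sup>+t. ennreal (l ^ n / fact n * (\<integral>\<omega>. nonneg_occupation_time X t \<omega> ^ n \<partial>P x)) \<partial>exp_time l)
      = (\<integral>\<^sup>+t. (\<integral>\<^sup>+\<omega>. ennreal ((l * nonneg_occupation_time X t \<omega>) ^ n / fact n) \<partial>P x) \<partial>exp_time l)"
  proof (rule nn_integral_cong_AE)
    have "ennreal (l ^ n / fact n * (\<integral>\<omega>. nonneg_occupation_time X t \<omega> ^ n \<partial>P x))
        = (\<integral>\<^sup>+\<omega>. ennreal ((l * nonneg_occupation_time X t \<omega>) ^ n / fact n) \<partial>P x)" if t: "0 \<le> t" for t
    proof -
      have "(\<integral>\<^sup>+\<omega>. ennreal ((l * nonneg_occupation_time X t \<omega>) ^ n / fact n) \<partial>P x)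
          = (\<integral>\<^sup>+\<omega>. ennreal (l ^ n / fact n * nonneg_occupation_time X t \<omega> ^ n) \<partial>P x)"
        by (simp add: power_mult_distrib)
      also have "\<dots> = ennreal (\<integral>\<omega>. l ^ n / fact n * nonneg_occupation_time X t \<omega> ^ n \<partial>P x)"
        by (rule nn_integral_eq_integral)
           (use occupation_moment_bounds(1)[OF t] occupation_time_bounds(1)[OF _ t] l in \<open>auto intro!: AE_I2\<close>)
      finally show ?thesis by simp
    qed
    moreover have "AE t in exp_time l. 0 \<le> t"
      by (subst AE_density) (auto simp: exponential_density_def)
    ultimately show "AE t in exp_time l. ennreal (l ^ n / fact n * (\<integral>\<omega>. nonneg_occupation_time X t \<omega> ^ n \<partial>P x))
        = (\<integral>\<^sup>+\<omega>. ennreal ((l * nonneg_occupation_time X t \<omega>) ^ n / fact n) \<partial>P x)"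
      by (auto elim!: eventually_mono)
  qed
  also have "\<dots> = (\<integral>\<^sup>+\<omega>. (\<integral>\<^sup>+t. ennreal ((l * nonneg_occupation_time X t \<omega>) ^ n / fact n) \<partial>exp_time l) \<partial>P x)"
    by (rule Fubini'[symmetric], unfold case_prod_beta') measurable
  also have "\<dots> = (\<integral>\<^sup>+\<omega>. indicator (space N) \<omega> * exp_moment l (\<lambda>t. nonneg_occupation_time X t \<omega>) n 0 \<partial>P x)"
    by (intro nn_integral_cong) (simp add: exp_moment_def occupation_time_0)
  also have "\<dots> = (\<integral>\<^sup>+\<omega>. indicator (space N) \<omega> * ennreal (kac_iterate l n (X 0 \<omega>)) \<partial>P x)"
    by (rule kac_moment_formula[OF l order_refl top])
  also have "\<dots> = (\<integral>\<^sup>+\<omega>. ennreal (kac_iterate l n x) \<partial>P x)"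
    by (rule nn_integral_cong_AE) (use start[of x] AE_space in \<open>eventually_elim, auto\<close>)
  also have "\<dots> = ennreal (kac_iterate l n x)" using p.emeasure_space_1 by simp
  finally show ?thesis .
qed

text \<open>
  That the moment is a multiple of \<open>t ^ n\<close>, as Brownian scaling suggests, is read off from its Laplace transform, which is \<open>c\<close> times that of \<open>t ^ n\<close>. The
  transform of \<open>t ^ n\<close> comes from the total mass of the Erlang density.
\<close>

lemma occupation_moment_scaling:
  assumes const: "\<And>l. 0 < l \<Longrightarrow> kac_iterate l n x = c" and t: "0 \<le> t"
  shows "(\<integral>\<omega>. nonneg_occupation_time X t \<omega> ^ n \<partial>P x) = c * t ^ n"
proof -
  define \<phi> where "\<phi> t = (\<integral>\<omega>. nonneg_occupation_time X t \<omega> ^ n \<partial>P x)" for t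
  have c: "0 \<le> c" "c \<le> 1" using const[of 1] kac_iterate_bounds(2,3)[of 1 n x] by auto
  have cont: "continuous_on {0..} \<phi>" unfolding \<phi>_def by (rule continuous_occupation_moment)
  have b: "0 \<le> \<phi> t" "\<phi> t \<le> t ^ n" if "0 \<le> t" for t
    using occupation_moment_bounds(2,3)[OF that] by (auto simp: \<phi>_def)
  have meas: "(\<lambda>t. indicator {0..} t * \<phi> t) \<in> borel_measurable borel"
    using borel_measurable_continuous_on_indicator[OF _ cont] by simp
  have "\<phi> t - c * t ^ n = 0"
  proof (rule laplace_uniqueness[OF _ _ _ t])
    show "continuous_on {0..} (\<lambda>t. \<phi> t - c * t ^ n)" by (intro continuous_intros cont)
    show "\<bar>\<phi> t - c * t ^ n\<bar> \<le> (2 ^ n * fact n) * exp (t / 2)" if "0 \<le> t" for t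
    proof -
      have "c * t ^ n \<le> 1 * t ^ n" using c that by (intro mult_right_mono) auto
      moreover have "0 \<le> c * t ^ n" using c that by simp
      ultimately have "\<bar>\<phi> t - c * t ^ n\<bar> \<le> t ^ n" using b[OF that] by linarith
      then show ?thesis using power_le_exp[OF that, of n] by linarith
    qed
    fix k :: nat assume "1 \<le> k"
    define l where "l = real k"
    have l: "0 < l" using \<open>1 \<le> k\<close> by (simp add: l_def)
    define C where "C = l ^ Suc n / fact n"
    have C: "0 < C" using l by (simp add: C_def)
    let ?f = "\<lambda>t. C * (indicator {0..} t * (exp (- l * t) * \<phi> t))"
    have fm: "?f \<in> borel_measurable borel"
    proof -
      have "(\<lambda>t. C * exp (- l * t) * (indicator {0..} t * \<phi> t)) \<in> borel_measurable borel"
        using meas by measurable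
      then show ?thesis by (simp add: mult_ac)
    qed
    have fi: "has_bochner_integral lborel ?f c"
    proof (rule has_bochner_integral_nn_integral)
      show "?f \<in> borel_measurable lborel" using fm by simp
      show "AE t in lborel. 0 \<le> ?f t" using b C by (auto split: split_indicator)
      have "(\<integral>\<^sup>+t. ennreal (?f t) \<partial>lborel)
          = (\<integral>\<^sup>+t. ennreal (exponential_density l t) * ennreal (l ^ n / fact n * (indicator {0..} t * \<phi> t)) \<partial>lborel)"
        using l b
        by (intro nn_integral_cong)
           (auto simp: exponential_density_def C_def ennreal_mult'[symmetric] mult_ac split: split_indicator)
      also have "\<dots> = (\<integral>\<^sup>+t. ennreal (l ^ n / fact n * (indicator {0..} t * \<phi> t)) \<partial>exp_time l)"
        by (intro nn_integral_exp_time[symmetric]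
            measurable_compose[OF borel_measurable_times[OF borel_measurable_const meas] measurable_ennreal])
      also have "\<dots> = (\<integral>\<^sup>+t. ennreal (l ^ n / fact n * \<phi> t) \<partial>exp_time l)"
      proof (rule nn_integral_cong_AE)
        have "AE t in exp_time l. 0 \<le> t"
          by (subst AE_density) (auto simp: exponential_density_def)
        then show "AE t in exp_time l. ennreal (l ^ n / fact n * (indicator {0..} t * \<phi> t)) = ennreal (l ^ n / fact n * \<phi> t)"
          by eventually_elim simp
      qed
      also have "\<dots> = ennreal c" using kac_occupation_moment[OF l, of n x] const[OF l] by (simp add: \<phi>_def)
      finally show "(\<integral>\<^sup>+t. ennreal (?f t) \<partial>lborel) = ennreal c" .
    qed (use c in auto)
    have gi: "has_bochner_integral lborel (erlang_density n l) 1"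
    proof (rule has_bochner_integral_nn_integral)
      have "emeasure (density lborel (erlang_density n l)) (space (density lborel (erlang_density n l))) = 1"
        using prob_space.emeasure_space_1[OF prob_space_erlang_density[OF l, of n]] .
      then show "(\<integral>\<^sup>+t. ennreal (erlang_density n l t) \<partial>lborel) = ennreal 1"
        by (simp add: emeasure_density)
    qed (use l in auto)
    have "has_bochner_integral lborel (\<lambda>t. ?f t - c * erlang_density n l t) (c - c * 1)"
      by (intro has_bochner_integral_diff fi has_bochner_integral_mult_right gi)
    then have "(\<integral>t. ?f t - c * erlang_density n l t \<partial>lborel) = 0"
      by (simp add: has_bochner_integral_integral_eq)
    moreover have "(\<integral>t. ?f t - c * erlang_density n l t \<partial>lborel)
        = (\<integral>t. C * (indicator {0..} t *\<^sub>R (exp (- real k * t) * (\<phi> t - c * t ^ n))) \<partial>lborel)"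
      by (intro Bochner_Integration.integral_cong)
         (auto simp: erlang_density_def C_def l_def algebra_simps split: split_indicator)
    ultimately have "C * (LINT t:{0..}|lborel. exp (- real k * t) * (\<phi> t - c * t ^ n)) = 0"
      by (simp add: set_lebesgue_integral_def)
    then show "(LINT t:{0..}|lborel. exp (- real k * t) * (\<phi> t - c * t ^ n)) = 0"
      using C by simp
  qed
  then show ?thesis by (simp add: \<phi>_def)
qed

end

theorem theorem6p7:
  fixes \<beta> :: real and n :: nat
    and N :: "'a measure" and F :: "real \<Rightarrow> 'a measure"
    and P :: "real \<Rightarrow> 'a measure" and X :: "real \<Rightarrow> 'a \<Rightarrow> real"
  assumes "0 < \<beta>" and "\<beta> < 1"
    and "skew_brownian_motion N F P X \<beta>"
    and "n \<ge> 1"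
  shows "(\<integral>\<omega>. nonneg_occupation_time X 1 \<omega> ^ n \<partial>P 0)
       = (\<Sum>k=0..n-1. real ((n - 1 + k) choose k) * (\<beta> ^ (n - k) / 2 ^ (n + k - 1)))"
proof -
  interpret skew_BM N F P X \<beta>
    using assms(1-3) by (simp add: skew_BM_def skew_BM_axioms_def skew_brownian_motion_def)
  obtain m where m: "n = Suc m" using \<open>n \<ge> 1\<close> by (cases n) auto
  have "(\<integral>\<omega>. nonneg_occupation_time X 1 \<omega> ^ n \<partial>P 0) = \<beta> * moment_coeff \<beta> m"
    using occupation_moment_scaling[of n 0 "\<beta> * moment_coeff \<beta> m" 1] kac_iterate_at_0 by (simp add: m)
  also have "\<dots> = (\<Sum>k=0..n-1. real ((n - 1 + k) choose k) * (\<beta> ^ (n - k) / 2 ^ (n + k - 1)))"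
    unfolding moment_coeff_def sum_distrib_left m
    by (intro sum.cong) (auto simp: Suc_diff_le atMost_atLeast0)
  finally show ?thesis .
qed

end
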